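(* Consider observations $Y=(Y_1,Y_2,\dots)$ with $Y_i=\kappa_i\mu_{0,i}+n^{-1/2}Z_i$, $Z_i$ i.i.d. standard normal, $\mu_0\in\ell_2$, and known $(\kappa_i)$ with $C^{-1}i^{-p}\le\kappa_i\le Ci^{-p}$ for some $p\ge0,C\ge1$. For $\alpha\ge0$ let \[ \Pi_\alpha(\cdot\mid Y)=\bigotimes_{i=1}^\infty N\Big(\frac{n\kappa_i^{-1}}{i^{1+2\alpha}\kappa_i^{-2}+n}Y_i,\ \frac{\kappa_i^{-2}}{i^{1+2\alpha}\kappa_i^{-2}+n}\Big), \] which is the posterior distribution of $\mu$ under the prior $\Pi_\alpha=\bigotimes_{i}N(0,i^{-1-2\alpha})$, let \[ \ell_n(\alpha)=-\frac12\sum_{i=1}^\infty\Big(\log\Big(1+\frac{n}{i^{1+2\alpha}\kappa_i^{-2}}\Big)-\frac{n^2}{i^{1+2\alpha}\kappa_i^{-2}+n}Y_i^2\Big), \] let $\hat\alpha_n\in\operatorname*{argmax}_{\alpha\in[0,\log n]}\ell_n(\alpha)$ (any maximizer), and let the empirical Bayes posterior be $\Pi_{\hat\alpha_n}(B\mid Y)=\Pi_\alpha(B\mid Y)|_{\alpha=\hat\alpha_n}$. Then for every $\beta,\gamma,R>0$ and every sequence $M_n\to\infty$, \[ \sup_{\|\mu_0\|_\beta\le R}\mathrm{E}_0\,\Pi_{\hat\alpha_n}\big(\|\mu-\mu_0\|\ge M_nL_n n^{-\beta/(1+2\beta+2p)}\mid Y\big)\to0 \] and \[ \sup_{\|\mu_0\|_{A^\gamma}\le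 R}\mathrm{E}_0\,\Pi_{\hat\alpha_n}\big(\|\mu-\mu_0\|\ge M_nL_n(\log n)^{1/2+p}n^{-1/2}\mid Y\big)\to0, \] where $(L_n)$ is a slowly varying sequence.
   Context: $\mathrm{E}_0$ is expectation under the law of $Y$ with true parameter $\mu_0$. $\|\cdot\|$ is the $\ell_2$-norm; $\|\mu\|_\beta^2=\sum_i i^{2\beta}\mu_i^2$; $\|\mu\|_{A^\gamma}^2=\sum_i e^{2\gamma i}\mu_i^2$. A slowly varying sequence here means one that tends to infinity (if at all) slower than any positive power of $n$. *)

theory Defs
  imports "HOL-Probability.Probability"
begin

text \<open>Indexing convention: coordinate i :: nat corresponds to the paper's index i+1,
  so the paper's weight i is written real (Suc i).\<close>

definition obs_law :: "(nat \<Rightarrow> real) \<Rightarrow> nat \<Rightarrow> (nat \<Rightarrow> real) \<Rightarrow> (nat \<Rightarrow> real) measure" where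
  "obs_law \<kappa> n \<mu>0 = PiM UNIV (\<lambda>i. density lborel (normal_density (\<kappa> i * \<mu>0 i) (1 / sqrt (real n))))"

definition post_mean :: "(nat \<Rightarrow> real) \<Rightarrow> nat \<Rightarrow> real \<Rightarrow> (nat \<Rightarrow> real) \<Rightarrow> nat \<Rightarrow> real" where
  "post_mean \<kappa> n \<alpha> Y i =
     real n * inverse (\<kappa> i) / (real (Suc i) powr (1 + 2*\<alpha>) * (\<kappa> i) powi (-2) + real n) * Y i"

definition post_var :: "(nat \<Rightarrow> real) \<Rightarrow> nat \<Rightarrow> real \<Rightarrow> nat \<Rightarrow> real" where
  "post_var \<kappa> n \<alpha> i =
     (\<kappa> i) powi (-2) / (real (Suc i) powr (1 + 2*\<alpha>) * (\<kappa> i) powi (-2) + real n)"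

text \<open>Posterior Pi_alpha( . | Y): product of the Gaussians N(post_mean, post_var)
  (normal_density takes the standard deviation).\<close>
definition posterior :: "(nat \<Rightarrow> real) \<Rightarrow> nat \<Rightarrow> real \<Rightarrow> (nat \<Rightarrow> real) \<Rightarrow> (nat \<Rightarrow> real) measure" where
  "posterior \<kappa> n \<alpha> Y = PiM UNIV (\<lambda>i. density lborel
      (normal_density (post_mean \<kappa> n \<alpha> Y i) (sqrt (post_var \<kappa> n \<alpha> i))))"

definition loglik :: "(nat \<Rightarrow> real) \<Rightarrow> nat \<Rightarrow> real \<Rightarrow> (nat \<Rightarrow> real) \<Rightarrow> real" where
  "loglik \<kappa> n \<alpha> Y = - 1/2 * (\<Sum>i.
      ln (1 + real n / (real (Suc i) powr (1 + 2*\<alpha>) * (\<kappa> i) powi (-2)))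
      - (real n)\<^sup>2 / (real (Suc i) powr (1 + 2*\<alpha>) * (\<kappa> i) powi (-2) + real n) * (Y i)\<^sup>2)"

definition l2norm :: "(nat \<Rightarrow> real) \<Rightarrow> ennreal" where
  "l2norm f = (if summable (\<lambda>i. (f i)\<^sup>2) then ennreal (sqrt (\<Sum>i. (f i)\<^sup>2)) else \<top>)"

definition sobolev_norm :: "real \<Rightarrow> (nat \<Rightarrow> real) \<Rightarrow> ennreal" where
  "sobolev_norm \<beta> f = (if summable (\<lambda>i. real (Suc i) powr (2*\<beta>) * (f i)\<^sup>2)
      then ennreal (sqrt (\<Sum>i. real (Suc i) powr (2*\<beta>) * (f i)\<^sup>2)) else \<top>)"

definition analytic_norm :: "real \<Rightarrow> (nat \<Rightarrow> real) \<Rightarrow> ennreal" where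
  "analytic_norm \<gamma> f = (if summable (\<lambda>i. exp (2*\<gamma>*real (Suc i)) * (f i)\<^sup>2)
      then ennreal (sqrt (\<Sum>i. exp (2*\<gamma>*real (Suc i)) * (f i)\<^sup>2)) else \<top>)"

definition slowly_varying :: "(nat \<Rightarrow> real) \<Rightarrow> bool" where
  "slowly_varying L \<longleftrightarrow> (\<forall>n. L n > 0) \<and>
     (\<forall>\<epsilon>>0. (\<lambda>n. L n / real n powr \<epsilon>) \<longlonglongrightarrow> 0)"

definition eb_selector :: "(nat \<Rightarrow> real) \<Rightarrow> (nat \<Rightarrow> (nat \<Rightarrow> real) \<Rightarrow> real) \<Rightarrow> bool" where
  "eb_selector \<kappa> ah \<longleftrightarrow> (\<forall>n.
      ah n \<in> borel_measurable (PiM UNIV (\<lambda>_::nat. borel)) \<and>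
      (\<forall>Y. ah n Y \<in> {0..ln (real n)} \<and>
        ((\<exists>a\<in>{0..ln (real n)}. \<forall>b\<in>{0..ln (real n)}. loglik \<kappa> n b Y \<le> loglik \<kappa> n a Y) \<longrightarrow>
         (\<forall>b\<in>{0..ln (real n)}. loglik \<kappa> n b Y \<le> loglik \<kappa> n (ah n Y) Y))))"

definition eb_risk :: "(nat \<Rightarrow> real) \<Rightarrow> (nat \<Rightarrow> (nat \<Rightarrow> real) \<Rightarrow> real) \<Rightarrow> nat \<Rightarrow> (nat \<Rightarrow> real) \<Rightarrow> real \<Rightarrow> real" where
  "eb_risk \<kappa> ah n \<mu>0 r = (\<integral>Y. measure (posterior \<kappa> n (ah n Y) Y)
      {\<mu> \<in> space (posterior \<kappa> n (ah n Y) Y). ennreal r \<le> l2norm (\<lambda>i. \<mu> i - \<mu>0 i)}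
      \<partial>obs_law \<kappa> n \<mu>0)"

end

theory Submission
  imports Defs "HOL-Real_Asymp.Real_Asymp"
begin

text \<open>Maximizing the marginal likelihood minimizes, up to noise, the Kullback--Leibler divergence
  \<open>D(\<alpha>)\<close> of the marginal law of the data from their true law. Comparing with \<open>\<alpha> = \<beta>\<close> shows that
  with high probability \<open>D\<close> at the selected parameter is at most \<open>D(\<beta>)\<close>, hence at most
  \<open>N = n powr (1 / (1 + 2\<beta> + 2p))\<close>, up to logarithmic factors; the noise is
  harmless because its variance is bounded by \<open>D(\<alpha>) + D(\<beta>)\<close>. As \<open>D(\<alpha>)\<close> dominates the effective dimension
  \<open>n powr (1 / (1 + 2\<alpha> + 2p))\<close>, this bounds the posterior variance, and as it dominates the squared bias of the
  direct problem, it bounds the bias in the coordinates below \<open>N\<close>. The bias in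
  the remaining coordinates is bounded by the smoothness of the truth.\<close>

section \<open>Moments of products of normal distributions\<close>

text \<open>Two obstacles shape the proof. \<open>eb_selector\<close> ties the selected parameter to
  the likelihood only where a maximizer exists, so convergence and continuity of the likelihood
  series must be shown first, on an event whose complement has small probability. And the selected
  parameter depends on the data. This is overcome by a deterministic lower bound
  \<open>\<alpha>s\<close> for it: the effective dimension decreases in \<alpha>, so an upper bound
  for it bounds \<alpha> from below, and the shrinkage weights also decrease in \<alpha>; the
  posterior variance and the noise in the posterior mean are therefore dominated by their values at
  \<open>\<alpha>s\<close>, where a plain expectation suffices. The coordinates are truncated at
  \<open>K = n^24\<close>, so large that on this event the discarded part of the likelihood series
  is at most 1 in absolute value, while \<open>K\<close> enters the bounds only through
  \<open>ln K\<close>. Since \<open>L\<close> need only be slowly varying, it is taken as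
  \<open>exp (ln n powr (7/8))\<close>, which absorbs all powers of \<open>ln n\<close> and lets one
  nonasymptotic bound, with smoothness and radius depending on \<open>n\<close>, serve both
  balls.\<close>

lemma nn_integral_PiM_component:
  fixes M :: "'i \<Rightarrow> 'a measure"
  assumes "\<And>i. prob_space (M i)" and [measurable]: "f \<in> borel_measurable (M i)"
  shows "(\<integral>\<^sup>+\<omega>. f (\<omega> i) \<partial>PiM UNIV M) = (\<integral>\<^sup>+x. f x \<partial>M i)"
proof -
  have "(\<integral>\<^sup>+x. f x \<partial>M i) = (\<integral>\<^sup>+x. f x \<partial>distr (PiM UNIV M) (M i) (\<lambda>\<omega>. \<omega> i))"
    using assms by (subst distr_PiM_component) auto
  also have "\<dots> = (\<integral>\<^sup>+\<omega>. f (\<omega> i) \<partial>PiM UNIV M)"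
    by (subst nn_integral_distr) auto
  finally show ?thesis ..
qed

lemma has_bochner_integral_PiM_component:
  fixes M :: "'i \<Rightarrow> 'a measure" and f :: "'a \<Rightarrow> real"
  assumes "\<And>i. prob_space (M i)" and f: "has_bochner_integral (M i) f c"
  shows "has_bochner_integral (PiM UNIV M) (\<lambda>\<omega>. f (\<omega> i)) c"
proof -
  have [measurable]: "f \<in> borel_measurable (M i)"
    using f by (auto elim: has_bochner_integral.cases)
  have "has_bochner_integral (distr (PiM UNIV M) (M i) (\<lambda>\<omega>. \<omega> i)) f c"
    using assms by (subst distr_PiM_component) auto
  then show ?thesis
    by (auto simp: has_bochner_integral_iff integrable_distr_eq integral_distr)
qed

lemma indep_vars_PiM_coordinates:
  fixes M :: "'i \<Rightarrow> 'a measure"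
  assumes "\<And>i. prob_space (M i)"
  shows "prob_space.indep_vars (PiM UNIV M) M (\<lambda>i \<omega>. \<omega> i) UNIV"
proof -
  interpret prob_space "PiM UNIV M" by (intro prob_space_PiM assms)
  show ?thesis
    by (subst indep_vars_iff_distr_eq_PiM')
       (auto simp: distr_PiM_component assms restrict_UNIV)
qed

lemma integral_PiM_coordinates_mult_eq_0:
  fixes M :: "'i \<Rightarrow> 'a measure" and f g :: "'a \<Rightarrow> real"
  assumes M: "\<And>i. prob_space (M i)" and "i \<noteq> j"
    and f: "has_bochner_integral (M i) f 0" and g: "has_bochner_integral (M j) g c"
  shows "has_bochner_integral (PiM UNIV M) (\<lambda>\<omega>. f (\<omega> i) * g (\<omega> j)) 0"
proof -
  interpret prob_space "PiM UNIV M" by (intro prob_space_PiM M)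
  have [measurable]: "f \<in> borel_measurable (M i)" "g \<in> borel_measurable (M j)"
    using f g by (auto elim: has_bochner_integral.cases)
  \<comment> \<open>A single family over \<open>{i, j}\<close> carries both functions, so that the
    product rule for independent families applies.\<close>
  define h where "h = (\<lambda>k. if k = i then f else g)"
  have "indep_vars M (\<lambda>k \<omega>. \<omega> k) {i, j}"
    using indep_vars_PiM_coordinates[OF M] by (rule indep_vars_subset) auto
  then have ind: "indep_vars (\<lambda>_. borel) (\<lambda>k \<omega>. h k (\<omega> k)) {i, j}"
    by (rule indep_vars_compose2) (auto simp: h_def)
  have fi: "has_bochner_integral (PiM UNIV M) (\<lambda>\<omega>. f (\<omega> i)) 0"
    and gi: "has_bochner_integral (PiM UNIV M) (\<lambda>\<omega>. g (\<omega> j)) c"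
    using has_bochner_integral_PiM_component[of M i f 0] has_bochner_integral_PiM_component[of M j g c]
      M f g by auto
  have int: "integrable (PiM UNIV M) (\<lambda>\<omega>. h k (\<omega> k))" if "k \<in> {i, j}" for k
    using that fi gi by (auto simp: h_def has_bochner_integral_iff)
  have "has_bochner_integral (PiM UNIV M) (\<lambda>\<omega>. \<Prod>k\<in>{i, j}. h k (\<omega> k)) 0"
    using indep_vars_lebesgue_integral[OF _ ind int] indep_vars_integrable[OF _ ind int] fi gi assms(2)
    by (auto simp: h_def has_bochner_integral_iff)
  then show ?thesis
    using assms(2) by (auto simp: h_def)
qed

text \<open>The cross terms vanish because distinct coordinates are independent and centred; only
  the diagonal of the double sum survives.\<close>

lemma integral_PiM_sum_coordinates_square:
  fixes M :: "'i \<Rightarrow> 'a measure" and f :: "'i \<Rightarrow> 'a \<Rightarrow> real"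
  assumes M: "\<And>i. prob_space (M i)" and I: "finite I"
    and f: "\<And>i. has_bochner_integral (M i) (f i) 0"
    and v: "\<And>i. has_bochner_integral (M i) (\<lambda>x. (f i x)\<^sup>2) (v i)"
  shows "has_bochner_integral (PiM UNIV M) (\<lambda>\<omega>. (\<Sum>i\<in>I. c i * f i (\<omega> i))\<^sup>2) (\<Sum>i\<in>I. (c i)\<^sup>2 * v i)"
proof -
  have *: "has_bochner_integral (PiM UNIV M) (\<lambda>\<omega>. (c i * f i (\<omega> i)) * (c j * f j (\<omega> j)))
     (if i = j then (c i)\<^sup>2 * v i else 0)" for i j
  proof (cases "i = j")
    case True
    have "has_bochner_integral (PiM UNIV M) (\<lambda>\<omega>. (c i)\<^sup>2 * (f i (\<omega> i))\<^sup>2) ((c i)\<^sup>2 * v i)"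
      using has_bochner_integral_PiM_component[of M i "\<lambda>x. (f i x)\<^sup>2" "v i"] M v
      by (intro has_bochner_integral_mult_right) auto
    then show ?thesis using True by (simp add: power2_eq_square algebra_simps)
  next
    case False
    have "has_bochner_integral (PiM UNIV M) (\<lambda>\<omega>. (c i * c j) * (f i (\<omega> i) * f j (\<omega> j))) ((c i * c j) * 0)"
      using integral_PiM_coordinates_mult_eq_0[of M i j "f i" "f j" 0] M False f
      by (intro has_bochner_integral_mult_right) auto
    then show ?thesis using False by (simp add: algebra_simps)
  qed
  have "has_bochner_integral (PiM UNIV M)
     (\<lambda>\<omega>. \<Sum>i\<in>I. \<Sum>j\<in>I. (c i * f i (\<omega> i)) * (c j * f j (\<omega> j)))
     (\<Sum>i\<in>I. \<Sum>j\<in>I. if i = j then (c i)\<^sup>2 * v i else 0)"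
    by (intro has_bochner_integral_sum *)
  then show ?thesis using I
    by (simp add: power2_eq_square sum_product)
qed

lemma has_bochner_integral_normal_measure:
  fixes f :: "real \<Rightarrow> real"
  assumes "has_bochner_integral lborel (\<lambda>x. normal_density a \<sigma> x * f x) c"
    and [measurable]: "f \<in> borel_measurable borel"
  shows "has_bochner_integral (density lborel (normal_density a \<sigma>)) f c"
  using assms by (auto simp: has_bochner_integral_iff integrable_density integral_density)

lemma normal_measure_second_moment:
  assumes s: "0 < \<sigma>"
  shows "has_bochner_integral (density lborel (normal_density a \<sigma>)) (\<lambda>x. (x - c)\<^sup>2) (\<sigma>\<^sup>2 + (a - c)\<^sup>2)"
proof (rule has_bochner_integral_normal_measure)
  \<comment> \<open>Expansion of (x - c)^2 around the mean \<open>a\<close>; the exponents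
    \<open>2*1\<close>, \<open>2*0+1\<close> and \<open>2*0\<close> are left unevaluated to match
    \<open>normal_moment_even\<close> and \<open>normal_moment_odd\<close>.\<close>
  have "has_bochner_integral lborel (\<lambda>x. normal_density a \<sigma> x * (x - a)^(2*1)
     + 2 * (a - c) * (normal_density a \<sigma> x * (x - a)^(2*0+1))
     + (a - c)\<^sup>2 * (normal_density a \<sigma> x * (x - a)^(2*0)))
     (fact (2*1) / ((2/\<sigma>\<^sup>2)^1 * fact 1) + 2 * (a - c) * 0 + (a - c)\<^sup>2 * (fact (2*0) / ((2/\<sigma>\<^sup>2)^0 * fact 0)))"
    by (intro has_bochner_integral_add has_bochner_integral_mult_right normal_moment_even normal_moment_odd s)
  then show "has_bochner_integral lborel (\<lambda>x. normal_density a \<sigma> x * (x - c)\<^sup>2) (\<sigma>\<^sup>2 + (a - c)\<^sup>2)"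
    by (rule has_bochner_integral_cong[THEN iffD1, rotated -1])
       (auto simp: power2_eq_square algebra_simps)
qed auto

context
  fixes a \<nu> :: real
  assumes \<nu>: "\<nu> > 0"
begin

text \<open>Here \<open>\<nu> * x\<^sup>2\<close> is noncentral chi-square with one degree of
  freedom and noncentrality \<open>\<nu> * a\<^sup>2\<close>; what is subtracted is its
  mean.\<close>

lemma normal_measure_centered_square:
  "has_bochner_integral (density lborel (normal_density a (1 / sqrt \<nu>))) (\<lambda>x. \<nu> * x\<^sup>2 - 1 - \<nu> * a\<^sup>2) 0"
proof (rule has_bochner_integral_normal_measure)
  let ?\<sigma> = "1 / sqrt \<nu>"
  let ?d = "normal_density a (1 / sqrt \<nu>)"
  have s: "0 < ?\<sigma>" using \<nu> by simp
  have "has_bochner_integral lborel (\<lambda>x. \<nu> * (?d x * (x - a)^(2*1))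
     + 2 * \<nu> * a * (?d x * (x - a)^(2*0+1)) + (-1) * (?d x * (x - a)^(2*0)))
     (\<nu> * (fact (2*1) / ((2/?\<sigma>\<^sup>2)^1 * fact 1)) + 2 * \<nu> * a * 0 + (-1) * (fact (2*0) / ((2/?\<sigma>\<^sup>2)^0 * fact 0)))"
    by (intro has_bochner_integral_add has_bochner_integral_mult_right normal_moment_even normal_moment_odd s)
  then show "has_bochner_integral lborel (\<lambda>x. ?d x * (\<nu> * x\<^sup>2 - 1 - \<nu> * a\<^sup>2)) 0"
    by (rule has_bochner_integral_cong[THEN iffD1, rotated -1])
       (use \<nu> in \<open>auto simp: power2_eq_square algebra_simps\<close>)
qed auto

text \<open>In the expansion around \<open>a\<close> the odd moments drop out and the fourth central
  moment is \<open>3 / \<nu>\<^sup>2\<close>, which leaves the variance of the noncentral chi-square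
  law.\<close>

lemma normal_measure_centered_square_variance:
  "has_bochner_integral (density lborel (normal_density a (1 / sqrt \<nu>)))
     (\<lambda>x. (\<nu> * x\<^sup>2 - 1 - \<nu> * a\<^sup>2)\<^sup>2) (2 + 4 * \<nu> * a\<^sup>2)"
proof (rule has_bochner_integral_normal_measure)
  let ?\<sigma> = "1 / sqrt \<nu>"
  let ?d = "normal_density a (1 / sqrt \<nu>)"
  have s: "0 < ?\<sigma>" using \<nu> by simp
  have ex: "(\<nu> * x\<^sup>2 - 1 - \<nu> * a\<^sup>2)\<^sup>2 = \<nu>\<^sup>2 * (x - a)^(2*2) + 4 * \<nu>\<^sup>2 * a * (x-a)^(2*1+1)
     + (4 * \<nu>\<^sup>2 * a\<^sup>2 - 2 * \<nu>) * (x - a)^(2*1) + (- 4 * \<nu> * a) * (x-a)^(2*0+1) + 1 * (x-a)^(2*0)" for x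
    by (simp add: power2_eq_square power_numeral_reduce algebra_simps)
  have "has_bochner_integral lborel (\<lambda>x. \<nu>\<^sup>2 * (?d x * (x - a)^(2*2))
     + 4 * \<nu>\<^sup>2 * a * (?d x * (x - a)^(2*1+1)) + (4 * \<nu>\<^sup>2 * a\<^sup>2 - 2 * \<nu>) * (?d x * (x - a)^(2*1))
     + (- 4 * \<nu> * a) * (?d x * (x - a)^(2*0+1)) + 1 * (?d x * (x - a)^(2*0)))
     (\<nu>\<^sup>2 * (fact (2*2) / ((2/?\<sigma>\<^sup>2)^2 * fact 2)) + 4 * \<nu>\<^sup>2 * a * 0
      + (4 * \<nu>\<^sup>2 * a\<^sup>2 - 2 * \<nu>) * (fact (2*1) / ((2/?\<sigma>\<^sup>2)^1 * fact 1)) + (- 4 * \<nu> * a) * 0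
      + 1 * (fact (2*0) / ((2/?\<sigma>\<^sup>2)^0 * fact 0)))"
    by (intro has_bochner_integral_add has_bochner_integral_mult_right normal_moment_even normal_moment_odd s)
  also have "(\<nu>\<^sup>2 * (fact (2*2) / ((2/?\<sigma>\<^sup>2)^2 * fact 2)) + 4 * \<nu>\<^sup>2 * a * 0
      + (4 * \<nu>\<^sup>2 * a\<^sup>2 - 2 * \<nu>) * (fact (2*1) / ((2/?\<sigma>\<^sup>2)^1 * fact 1)) + (- 4 * \<nu> * a) * 0
      + 1 * (fact (2*0) / ((2/?\<sigma>\<^sup>2)^0 * fact 0))) = 2 + 4 * \<nu> * a\<^sup>2"
    using \<nu> by (simp add: fact_numeral field_simps power2_eq_square)
  finally show "has_bochner_integral lborel (\<lambda>x. ?d x * (\<nu> * x\<^sup>2 - 1 - \<nu> * a\<^sup>2)\<^sup>2) (2 + 4 * \<nu> * a\<^sup>2)"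
    unfolding ex by (rule has_bochner_integral_cong[THEN iffD1, rotated -1])
       (auto simp: algebra_simps)
qed auto

end

section \<open>Uniform convergence of the likelihood series\<close>

text \<open>For \<open>p = 0\<close> and \<open>\<alpha> = 0\<close> the series defining the likelihood converges only conditionally.
  Its tails are controlled uniformly in \<open>\<alpha>\<close> by Abel summation over blocks of indices between
  consecutive cubes: the block sums have summable \<open>L\<^sup>2\<close> norms, and so short are the blocks that inside
  one of them the triangle inequality suffices.\<close>

lemma abel_summation_bound:
  fixes b \<eta> :: "nat \<Rightarrow> real"
  assumes b: "\<And>i. b (Suc i) \<le> b i" "\<And>i. 0 \<le> b i" "\<And>i. b i \<le> 1" and "K \<le> m"
    and S: "\<And>j. K \<le> j \<Longrightarrow> j \<le> m \<Longrightarrow> \<bar>\<Sum>i=K..<j. \<eta> i\<bar> \<le> \<omega>"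
  shows "\<bar>\<Sum>i=K..<m. b i * \<eta> i\<bar> \<le> \<omega>"
proof -
  define S where "S j = (\<Sum>i=K..<j. \<eta> i)" for j
  \<comment> \<open>Summation by parts. The weights \<open>b i - b (Suc i)\<close> are nonnegative
    and telescope, so together with \<open>b m\<close> they add up to \<open>b K\<close>, which is
    at most 1.\<close>
  have eq: "(\<Sum>i=K..<m. b i * \<eta> i) = b m * S m + (\<Sum>i=K..<m. (b i - b (Suc i)) * S (Suc i))"
    using \<open>K \<le> m\<close> by (induction m rule: dec_induct) (auto simp: S_def algebra_simps)
  have "\<bar>\<Sum>i=K..<m. b i * \<eta> i\<bar> \<le> b m * \<omega> + (\<Sum>i=K..<m. (b i - b (Suc i)) * \<omega>)"
    unfolding eq
  proof (intro abs_triangle_ineq[THEN order_trans] add_mono sum_abs[THEN order_trans] sum_mono)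
    show "\<bar>b m * S m\<bar> \<le> b m * \<omega>"
      using b S[of m] \<open>K \<le> m\<close> by (auto simp: abs_mult S_def intro!: mult_left_mono)
    show "\<bar>(b i - b (Suc i)) * S (Suc i)\<bar> \<le> (b i - b (Suc i)) * \<omega>" if "i \<in> {K..<m}" for i
      using b(1)[of i] S[of "Suc i"] that
      by (auto simp only: abs_mult S_def atLeastLessThan_iff intro!: mult_mono)
  qed
  also have "\<dots> = b K * \<omega>"
    using \<open>K \<le> m\<close> by (induction m rule: dec_induct) (auto simp: algebra_simps)
  also have "\<dots> \<le> \<omega>"
    using b S[of K] \<open>K \<le> m\<close> by (intro mult_left_le_one_le) auto
  finally show ?thesis .
qed

lemma cube_interval:
  fixes k0 j :: nat
  assumes "k0 ^ 3 \<le> j"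
  obtains k where "k0 \<le> k" "k ^ 3 \<le> j" "j < (Suc k) ^ 3"
proof -
  define k where "k = (GREATEST k. k ^ 3 \<le> j)"
  have bd: "k \<le> j" if "k ^ 3 \<le> j" for k :: nat
    using self_le_power[of k 3] that by (cases "k = 0") auto
  have 1: "k ^ 3 \<le> j"
    unfolding k_def using assms bd by (rule GreatestI_nat) auto
  have 2: "k0 \<le> k"
    unfolding k_def using assms bd by (rule Greatest_le_nat) auto
  have 3: "j < (Suc k) ^ 3"
  proof (rule ccontr)
    assume "\<not> j < (Suc k) ^ 3"
    then have "Suc k \<le> k"
      unfolding k_def[symmetric] by (subst (2) k_def, intro Greatest_le_nat[of _ _ j]) (use bd in auto)
    then show False by simp
  qed
  show ?thesis using 1 2 3 that by blast
qed

lemma cube_gap_le: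
  assumes "k \<ge> 1"
  shows "real ((Suc k) ^ 3 - k ^ 3) \<le> 7 * (real k)\<^sup>2"
proof -
  have "1 \<le> k * k" "k \<le> k * k" using assms by auto
  moreover have "(Suc k) ^ 3 = k ^ 3 + 3 * (k * k) + 3 * k + 1"
    by (simp add: power3_eq_cube algebra_simps)
  ultimately have "(Suc k) ^ 3 - k ^ 3 \<le> 7 * (k * k)" by linarith
  then have "real ((Suc k) ^ 3 - k ^ 3) \<le> real (7 * (k * k))" by (rule of_nat_mono)
  then show ?thesis by (simp add: power2_eq_square)
qed

lemma sum_cube_blocks:
  fixes f :: "nat \<Rightarrow> real"
  assumes "k0 \<le> k"
  shows "(\<Sum>i=k0^3..<k^3. f i) = (\<Sum>k'=k0..<k. \<Sum>i=k'^3..<(Suc k')^3. f i)"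
  using assms
proof (induction k rule: dec_induct)
  case (step k)
  have "k0 ^ 3 \<le> k ^ 3" "k ^ 3 \<le> (Suc k) ^ 3"
    using step by (auto intro!: power_mono)
  then have "(\<Sum>i=k0^3..<(Suc k)^3. f i) = (\<Sum>i=k0^3..<k^3. f i) + (\<Sum>i=k^3..<(Suc k)^3. f i)"
    by (subst sum.atLeastLessThan_concat) auto
  then show ?case using step by simp
qed auto

text \<open>Complete blocks are paid for by their own \<open>Q k\<close>. The last, incomplete block
  has at most \<open>7 * k\<^sup>2\<close> indices, so Cauchy-Schwarz and the weighted squares in
  \<open>A\<close> bound its square by a single \<open>Q k\<close>; this is the origin of the term
  \<open>sqrt q\<close>.\<close>

lemma cube_block_partial_sum_bound:
  fixes \<eta> Q :: "nat \<Rightarrow> real"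
  assumes k0: "k0 \<ge> 1" and j: "k0 ^ 3 \<le> j"
    and B: "\<And>k. k \<ge> k0 \<Longrightarrow> \<bar>\<Sum>i=k^3..<(Suc k)^3. \<eta> i\<bar> \<le> Q k"
    and A: "\<And>k. k \<ge> k0 \<Longrightarrow> 7 * (real k)\<^sup>2 * (\<Sum>i=k^3..<(Suc k)^3. (\<eta> i)\<^sup>2) \<le> Q k"
    and Q: "\<And>k. (\<Sum>k'=k0..<k. Q k') \<le> q"
  shows "\<bar>\<Sum>i=k0^3..<j. \<eta> i\<bar> \<le> q + sqrt q"
proof -
  obtain k where k: "k0 \<le> k" "k ^ 3 \<le> j" "j < (Suc k) ^ 3"
    using cube_interval[OF j] by blast
  have Q0: "0 \<le> Q k" if "k \<ge> k0" for k using B[OF that] by linarith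
  have Qk: "Q k \<le> q"
  proof -
    have "Q k \<le> (\<Sum>k'=k0..<Suc k. Q k')"
      using k by (intro member_le_sum) (auto simp: Q0)
    then show ?thesis using Q[of "Suc k"] by linarith
  qed
  have "k0 ^ 3 \<le> k ^ 3" using k by (intro power_mono) auto
  then have "(\<Sum>i=k0^3..<j. \<eta> i) = (\<Sum>i=k0^3..<k^3. \<eta> i) + (\<Sum>i=k^3..<j. \<eta> i)"
    using k by (subst sum.atLeastLessThan_concat) auto
  moreover have "\<bar>\<Sum>i=k0^3..<k^3. \<eta> i\<bar> \<le> q"
    unfolding sum_cube_blocks[OF k(1)]
    by (rule order_trans[OF sum_abs], rule order_trans[OF sum_mono Q[of k]]) (auto intro: B)
  moreover have "\<bar>\<Sum>i=k^3..<j. \<eta> i\<bar> \<le> sqrt q"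
  proof (rule real_le_rsqrt)
    have "real (card {k^3..<j}) \<le> 7 * (real k)\<^sup>2"
    proof -
      have "card {k^3..<j} \<le> (Suc k)^3 - k^3" using k(3) by simp
      then show ?thesis using cube_gap_le[of k] k(1) k0 by linarith
    qed
    then have "\<bar>\<Sum>i=k^3..<j. \<eta> i\<bar>\<^sup>2 \<le> (\<Sum>i=k^3..<j. (\<eta> i)\<^sup>2) * (7 * (real k)\<^sup>2)"
      unfolding power2_abs
      by (intro order_trans[OF sum_squared_le_sum_of_squares] mult_left_mono sum_nonneg) auto
    also have "\<dots> \<le> (\<Sum>i=k^3..<(Suc k)^3. (\<eta> i)\<^sup>2) * (7 * (real k)\<^sup>2)"
      using k by (intro mult_right_mono sum_mono2) auto
    also have "\<dots> \<le> q" using A[OF k(1)] Qk by (simp add: mult.commute)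
    finally show "\<bar>\<Sum>i=k^3..<j. \<eta> i\<bar>\<^sup>2 \<le> q" .
  qed
  ultimately show ?thesis by linarith
qed

text \<open>Minus twice the log-likelihood ratio of N(0, 1 + s) against N(0, 1) at \<open>x\<close>;
  maximizing the likelihood means minimizing the sum of these terms.\<close>

definition lik_term :: "real \<Rightarrow> real \<Rightarrow> real" where
  "lik_term s x = ln (1 + s) - s / (1 + s) * x\<^sup>2"

text \<open>The first-order term \<open>s * (x\<^sup>2 - 1)\<close> is centred for standard normal
  \<open>x\<close>, so its series can converge by cancellation; the remainder is quadratic in
  \<open>s\<close> and can be summed absolutely. It is expressed through
  \<open>x\<^sup>2 - 1\<close> because the moments of that quantity are available.\<close>

lemma lik_term_approx:
  assumes "0 \<le> s"
  shows "\<bar>lik_term s x + s * (x\<^sup>2 - 1)\<bar> \<le> s\<^sup>2 * (3 + (x\<^sup>2 - 1)\<^sup>2)"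
proof -
  have 1: "ln (1 + s) \<le> s" using assms by (rule ln_add_one_self_le_self)
  have "ln (1 / (1 + s)) \<le> 1 / (1 + s) - 1" using assms by (intro ln_le_minus_one) auto
  then have 2: "s / (1 + s) \<le> ln (1 + s)" using assms by (simp add: ln_div field_simps)
  have 3: "s / (1 + s) = s - s\<^sup>2 / (1 + s)" "0 \<le> s\<^sup>2 / (1 + s)" "s\<^sup>2 / (1 + s) \<le> s\<^sup>2"
    using assms by (auto simp: field_simps power2_eq_square)
  have "lik_term s x + s * (x\<^sup>2 - 1) = (ln (1 + s) - s) + s\<^sup>2 / (1 + s) * x\<^sup>2"
    unfolding lik_term_def 3(1) by (simp add: algebra_simps)
  also have "\<bar>\<dots>\<bar> \<le> s\<^sup>2 + s\<^sup>2 * x\<^sup>2"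
  proof (rule order_trans[OF abs_triangle_ineq], rule add_mono)
    show "\<bar>ln (1 + s) - s\<bar> \<le> s\<^sup>2" using 1 2 3 by linarith
    show "\<bar>s\<^sup>2 / (1 + s) * x\<^sup>2\<bar> \<le> s\<^sup>2 * x\<^sup>2" using mult_right_mono[OF 3(3), of "x\<^sup>2"] 3 assms by simp
  qed
  also have "\<dots> = s\<^sup>2 * (1 + x\<^sup>2)" by (simp add: algebra_simps)
  also have "\<dots> \<le> s\<^sup>2 * (3 + (x\<^sup>2 - 1)\<^sup>2)"
  proof (rule mult_left_mono)
    \<comment> \<open>The difference of the two sides equals this square plus 3/4.\<close>
    have "0 \<le> (x\<^sup>2 - 3/2)\<^sup>2" by simp
    then show "1 + x\<^sup>2 \<le> 3 + (x\<^sup>2 - 1)\<^sup>2" by (simp add: power2_eq_square algebra_simps)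
  qed auto
  finally show ?thesis .
qed

text \<open>The first two summands majorize the absolute block sum B through \<open>2 *
  \<bar>B\<bar> \<le> k\<^sup>2 * B\<^sup>2 + 1 / k\<^sup>2\<close>, which replaces absolute values
  by squares of computable mean. The last summand serves both the incomplete blocks and the
  quadratic remainder in \<open>lik_term_approx\<close>. For \<open>a i\<close> of order 1/i a block
  has about k^2 entries of size k^-3, so that all three parts have mean of order k^-2.\<close>

definition block_bound :: "(nat \<Rightarrow> real) \<Rightarrow> (nat \<Rightarrow> real) \<Rightarrow> nat \<Rightarrow> real" where
  "block_bound a X k = (real k)\<^sup>2 * (\<Sum>i=k^3..<(Suc k)^3. a i * ((X i)\<^sup>2 - 1))\<^sup>2 + 1 / (real k)\<^sup>2
     + 7 * (real k)\<^sup>2 * (\<Sum>i=k^3..<(Suc k)^3. (a i)\<^sup>2 * (3 + ((X i)\<^sup>2 - 1)\<^sup>2))"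

lemma block_bound_nonneg: "0 \<le> block_bound a X k"
  unfolding block_bound_def by (intro add_nonneg_nonneg mult_nonneg_nonneg sum_nonneg) auto

lemma block_bound_sum:
  assumes "k \<ge> 1"
  shows "\<bar>\<Sum>i=k^3..<(Suc k)^3. a i * ((X i)\<^sup>2 - 1)\<bar> \<le> block_bound a X k"
proof -
  let ?B = "\<bar>\<Sum>i=k^3..<(Suc k)^3. a i * ((X i)\<^sup>2 - 1)\<bar>"
  have "0 \<le> (real k * ?B - 1 / real k)\<^sup>2" by simp
  then have "2 * ?B \<le> (real k)\<^sup>2 * ?B\<^sup>2 + 1 / (real k)\<^sup>2"
    using assms by (simp add: power2_diff power_mult_distrib power_divide)
  moreover have "0 \<le> 7 * (real k)\<^sup>2 * (\<Sum>i=k^3..<(Suc k)^3. (a i)\<^sup>2 * (3 + ((X i)\<^sup>2 - 1)\<^sup>2))"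
    by (intro mult_nonneg_nonneg sum_nonneg) auto
  ultimately show ?thesis unfolding block_bound_def power2_abs by linarith
qed

lemma block_bound_squares:
  "7 * (real k)\<^sup>2 * (\<Sum>i=k^3..<(Suc k)^3. (a i)\<^sup>2 * (3 + ((X i)\<^sup>2 - 1)\<^sup>2)) \<le> block_bound a X k"
  unfolding block_bound_def by auto

text \<open>For every \<alpha> \<ge> 0 the factor \<open>real (Suc i) powr (-2*\<alpha>)\<close> is
  nonincreasing in \<open>i\<close> with values in [0, 1]. Abel summation therefore transfers the
  bound on the linear part from \<alpha> = 0 to all \<alpha> at once, and the quadratic remainder is
  largest at \<alpha> = 0.\<close>

lemma lik_partial_tail_bound:
  fixes \<nu> :: real and a X :: "nat \<Rightarrow> real" and k0 :: nat
  assumes \<nu>: "\<nu> \<ge> 1" and a: "\<And>i. 0 \<le> a i" and k0: "k0 \<ge> 1"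
    and Q: "\<And>k. (\<Sum>k'=k0..<k. block_bound a X k') \<le> q" and m: "k0 ^ 3 \<le> m" and \<alpha>: "0 \<le> \<alpha>"
  shows "\<bar>\<Sum>i=k0^3..<m. lik_term (\<nu> * a i * real (Suc i) powr (-2*\<alpha>)) (X i)\<bar> \<le> \<nu> * (q + sqrt q) + \<nu>\<^sup>2 * q"
proof -
  define b where "b i = real (Suc i) powr (-2*\<alpha>)" for i
  define u where "u i = (X i)\<^sup>2 - 1" for i
  define s where "s i = \<nu> * a i * b i" for i
  have b: "b (Suc i) \<le> b i" "0 \<le> b i" "b i \<le> 1" for i
    unfolding b_def using \<alpha> powr_mono2'[of "-2*\<alpha>" 1 "real (Suc i)"] by (auto intro!: powr_mono2')
  have s0: "0 \<le> s i" for i using \<nu> a b by (simp add: s_def)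
  have s2: "(s i)\<^sup>2 \<le> \<nu>\<^sup>2 * (a i)\<^sup>2" for i
  proof -
    have "(s i)\<^sup>2 \<le> (\<nu> * a i)\<^sup>2"
      using b[of i] \<nu> a[of i] unfolding s_def
      by (intro power_mono) (auto intro!: mult_right_le_one_le)
    then show ?thesis by (simp add: power_mult_distrib)
  qed
  have part: "\<bar>\<Sum>i=k0^3..<j. a i * u i\<bar> \<le> q + sqrt q" if "k0^3 \<le> j" for j
  proof (rule cube_block_partial_sum_bound[OF k0 that])
    show "\<bar>\<Sum>i=k^3..<(Suc k)^3. a i * u i\<bar> \<le> block_bound a X k" if "k \<ge> k0" for k
      unfolding u_def using that k0 by (intro block_bound_sum) auto
    show "7 * (real k)\<^sup>2 * (\<Sum>i=k^3..<(Suc k)^3. (a i * u i)\<^sup>2) \<le> block_bound a X k" if "k \<ge> k0" for k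
      by (rule order_trans[OF _ block_bound_squares], intro mult_left_mono sum_mono)
         (auto simp: u_def power_mult_distrib intro!: mult_left_mono)
  qed (rule Q)
  have 1: "\<bar>\<Sum>i=k0^3..<m. b i * (a i * u i)\<bar> \<le> q + sqrt q"
    by (rule abel_summation_bound) (use b m part in auto)
  have 2: "(\<Sum>i=k0^3..<m. (a i)\<^sup>2 * (3 + (u i)\<^sup>2)) \<le> q"
  proof -
    obtain k where k: "k0 \<le> k" "k ^ 3 \<le> m" "m < (Suc k) ^ 3"
      using cube_interval[OF m] by blast
    have "(\<Sum>i=k0^3..<m. (a i)\<^sup>2 * (3 + (u i)\<^sup>2)) \<le> (\<Sum>i=k0^3..<(Suc k)^3. (a i)\<^sup>2 * (3 + (u i)\<^sup>2))"
      using k by (intro sum_mono2) auto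
    also have "\<dots> = (\<Sum>k'=k0..<Suc k. \<Sum>i=k'^3..<(Suc k')^3. (a i)\<^sup>2 * (3 + (u i)\<^sup>2))"
      using k by (intro sum_cube_blocks) auto
    also have "\<dots> \<le> (\<Sum>k'=k0..<Suc k. block_bound a X k')"
    proof (rule sum_mono)
      fix k' assume "k' \<in> {k0..<Suc k}"
      then have "1 \<le> k'" using k0 by simp
      then have "1 \<le> 7 * (real k')\<^sup>2"
        using one_le_power[of "real k'" 2] by (simp del: one_le_power)
      then have "(\<Sum>i=k'^3..<(Suc k')^3. (a i)\<^sup>2 * (3 + (u i)\<^sup>2)) \<le>
         7 * (real k')\<^sup>2 * (\<Sum>i=k'^3..<(Suc k')^3. (a i)\<^sup>2 * (3 + (u i)\<^sup>2))"
        using mult_right_mono[of 1 "7 * (real k')\<^sup>2" "\<Sum>i=k'^3..<(Suc k')^3. (a i)\<^sup>2 * (3 + (u i)\<^sup>2)"]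
        by (simp add: sum_nonneg)
      then show "(\<Sum>i=k'^3..<(Suc k')^3. (a i)\<^sup>2 * (3 + (u i)\<^sup>2)) \<le> block_bound a X k'"
        unfolding u_def using block_bound_squares[of k' a X] by linarith
    qed
    also have "\<dots> \<le> q" by (rule Q)
    finally show ?thesis .
  qed
  have "(\<Sum>i=k0^3..<m. lik_term (s i) (X i)) =
      - \<nu> * (\<Sum>i=k0^3..<m. b i * (a i * u i)) + (\<Sum>i=k0^3..<m. lik_term (s i) (X i) + s i * u i)"
    by (simp add: sum.distrib sum_distrib_left s_def algebra_simps sum_negf)
  also have "\<bar>\<dots>\<bar> \<le> \<nu> * (q + sqrt q) + (\<Sum>i=k0^3..<m. \<nu>\<^sup>2 * ((a i)\<^sup>2 * (3 + (u i)\<^sup>2)))"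
  proof (rule order_trans[OF abs_triangle_ineq], intro add_mono order_trans[OF sum_abs] sum_mono)
    show "\<bar>- \<nu> * (\<Sum>i=k0^3..<m. b i * (a i * u i))\<bar> \<le> \<nu> * (q + sqrt q)"
      using 1 \<nu> by (auto simp: abs_mult intro!: mult_left_mono)
    show "\<bar>lik_term (s i) (X i) + s i * u i\<bar> \<le> \<nu>\<^sup>2 * ((a i)\<^sup>2 * (3 + (u i)\<^sup>2))" for i
      using lik_term_approx[OF s0, of i "X i"] mult_right_mono[OF s2[of i], of "3 + (u i)\<^sup>2"]
      unfolding u_def by (auto simp: mult.assoc)
  qed
  also have "\<dots> \<le> \<nu> * (q + sqrt q) + \<nu>\<^sup>2 * q"
    using 2 by (auto simp flip: sum_distrib_left intro!: mult_left_mono)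
  finally show ?thesis unfolding s_def b_def .
qed

text \<open>The tails are small uniformly in \<alpha>, so the partial sums are uniformly Cauchy;
  convergence and continuity of the limit follow together. Continuity is what later yields a
  maximizer on a compact interval.\<close>

lemma lik_series_bounds:
  fixes \<nu> :: real and a X :: "nat \<Rightarrow> real" and k0 :: nat
  assumes \<nu>: "\<nu> \<ge> 1" and a: "\<And>i. 0 \<le> a i" and k0: "k0 \<ge> 1"
    and Q: "summable (\<lambda>k. block_bound a X (k + k0))" "(\<Sum>k. block_bound a X (k + k0)) \<le> 1 / (9 * \<nu>^4)"
  defines "T \<equiv> \<lambda>\<alpha> i. lik_term (\<nu> * a i * real (Suc i) powr (-2*\<alpha>)) (X i)"
  shows "\<And>\<alpha>. 0 \<le> \<alpha> \<Longrightarrow> summable (T \<alpha>)"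
    and "\<And>\<alpha>. 0 \<le> \<alpha> \<Longrightarrow> \<bar>(\<Sum>i. T \<alpha> i) - (\<Sum>i<k0^3. T \<alpha> i)\<bar> \<le> 1"
    and "continuous_on {0..} (\<lambda>\<alpha>. \<Sum>i. T \<alpha> i)"
proof -
  define q where "q k1 = (\<Sum>k. block_bound a X (k + k1))" for k1
  define B where "B k1 = \<nu> * (q k1 + sqrt (q k1)) + \<nu>\<^sup>2 * q k1" for k1
  have sm: "summable (\<lambda>k. block_bound a X (k + k1))" for k1
    using Q(1) by (subst summable_iff_shift) (simp add: summable_iff_shift)
  have part: "(\<Sum>k'=k1..<k. block_bound a X k') \<le> q k1" for k k1
  proof -
    have "(\<Sum>k'=k1..<k. block_bound a X k') = (\<Sum>k'<k-k1. block_bound a X (k' + k1))"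
      by (cases "k1 \<le> k") (auto simp: sum.shift_bounds_nat_ivl[of _ 0 k1, simplified, symmetric] lessThan_atLeast0)
    also have "\<dots> \<le> q k1"
      unfolding q_def using sm by (intro sum_le_suminf) (auto simp: block_bound_nonneg)
    finally show ?thesis .
  qed
  have bd: "\<bar>\<Sum>i=k1^3..<m. T \<alpha> i\<bar> \<le> B k1" if "k1 \<ge> k0" "k1^3 \<le> m" "0 \<le> \<alpha>" for k1 m \<alpha>
    unfolding T_def B_def using that k0 part
    by (intro lik_partial_tail_bound \<nu> a) auto
  have "q \<longlonglongrightarrow> 0"
  proof -
    have "(\<lambda>k1. (\<Sum>k. block_bound a X k) - (\<Sum>k<k1. block_bound a X k)) \<longlonglongrightarrow>
        (\<Sum>k. block_bound a X k) - (\<Sum>k. block_bound a X k)"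
      using sm[of 0] by (intro tendsto_intros summable_LIMSEQ) auto
    then show ?thesis
      unfolding q_def using suminf_minus_initial_segment[OF sm[of 0, simplified]] by simp
  qed
  then have "B \<longlonglongrightarrow> \<nu> * (0 + sqrt 0) + \<nu>\<^sup>2 * 0"
    unfolding B_def by (intro tendsto_intros)
  then have B0: "B \<longlonglongrightarrow> 0" by simp
  have "uniformly_Cauchy_on {0..} (\<lambda>m \<alpha>. \<Sum>i<m. T \<alpha> i)"
  proof (rule uniformly_Cauchy_onI)
    fix e :: real assume "e > 0"
    then have "eventually (\<lambda>k. B k < e / 2 \<and> k \<ge> k0) sequentially"
      using order_tendstoD(2)[OF B0, of "e/2"] by (intro eventually_conj eventually_ge_at_top) auto
    then obtain k1 where k1: "B k1 < e / 2" "k1 \<ge> k0"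
      by (auto simp: eventually_sequentially)
    have "dist (\<Sum>i<m. T \<alpha> i) (\<Sum>i<m'. T \<alpha> i) < e" if "\<alpha> \<in> {0..}" "m \<ge> k1^3" "m' \<ge> k1^3" for \<alpha> m m'
    proof -
      have split: "(\<Sum>i<m. T \<alpha> i) = (\<Sum>i<k1^3. T \<alpha> i) + (\<Sum>i=k1^3..<m. T \<alpha> i)" if "m \<ge> k1^3" for m
        using that by (simp add: lessThan_atLeast0 sum.atLeastLessThan_concat)
      show ?thesis
        using bd[of k1 m \<alpha>] bd[of k1 m' \<alpha>] that k1 split[of m] split[of m'] by (simp add: dist_real_def)
    qed
    then show "\<exists>M. \<forall>\<alpha>\<in>{0..}. \<forall>m\<ge>M. \<forall>m'\<ge>M. dist (\<Sum>i<m. T \<alpha> i) (\<Sum>i<m'. T \<alpha> i) < e"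
      by blast
  qed
  then have "uniformly_convergent_on {0..} (\<lambda>m \<alpha>. \<Sum>i<m. T \<alpha> i)"
    by (rule Cauchy_uniformly_convergent)
  then obtain L where L: "uniform_limit {0..} (\<lambda>m \<alpha>. \<Sum>i<m. T \<alpha> i) L sequentially"
    by (auto simp: uniformly_convergent_on_def)
  have sums: "T \<alpha> sums L \<alpha>" if "0 \<le> \<alpha>" for \<alpha>
    using tendsto_uniform_limitI[OF L, of \<alpha>] that by (simp add: sums_def)
  show "summable (T \<alpha>)" if "0 \<le> \<alpha>" for \<alpha>
    using sums[OF that] by (rule sums_summable)
  have "continuous_on {0..} L"
  proof (rule uniform_limit_theorem[OF _ L])
    have "continuous_on {0..} (\<lambda>\<alpha>. T \<alpha> i)" for i
      unfolding T_def lik_term_def using \<nu> a[of i]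
      by (intro continuous_intros) (auto simp: add_nonneg_eq_0_iff)
    then show "\<forall>\<^sub>F m in sequentially. continuous_on {0..} (\<lambda>\<alpha>. \<Sum>i<m. T \<alpha> i)"
      by (intro always_eventually allI continuous_on_sum) auto
  qed auto
  then show "continuous_on {0..} (\<lambda>\<alpha>. \<Sum>i. T \<alpha> i)"
    by (rule continuous_on_eq) (use sums in \<open>auto simp: sums_iff\<close>)
  have q0: "0 \<le> q k0" "q k0 \<le> 1 / (9 * \<nu>^4)"
    using Q sm by (auto simp: q_def block_bound_nonneg intro!: suminf_nonneg)
  \<comment> \<open>Origin of the threshold \<open>1 / (9 * \<nu>^4)\<close>: since
    \<open>q k0 \<le> sqrt (q k0)\<close> and \<open>\<nu> \<le> \<nu>\<^sup>2\<close>,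
    \<open>B k0\<close> is at most \<open>3 * \<nu>\<^sup>2 * sqrt (q k0)\<close>.\<close>
  have "B k0 \<le> 1"
  proof -
    have "1 / (9 * \<nu>^4) = (1 / (3 * \<nu>\<^sup>2))\<^sup>2" by (simp add: power2_eq_square power4_eq_xxxx)
    then have sq: "sqrt (q k0) \<le> 1 / (3 * \<nu>\<^sup>2)"
      using q0 \<nu> by (intro real_le_lsqrt) auto
    have "1 / (3 * \<nu>\<^sup>2) \<le> 1" using \<nu> one_le_power[of \<nu> 2] by (simp add: field_simps del: one_le_power)
    then have "sqrt (q k0) \<le> 1" using sq by linarith
    then have "sqrt (q k0) * sqrt (q k0) \<le> sqrt (q k0) * 1"
      using q0 by (intro mult_left_mono) auto
    then have qs: "q k0 \<le> sqrt (q k0)" using q0 by simp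
    have \<nu>2: "\<nu> \<le> \<nu>\<^sup>2" using \<nu> by (simp add: power2_eq_square)
    have "B k0 \<le> \<nu>\<^sup>2 * (sqrt (q k0) + sqrt (q k0)) + \<nu>\<^sup>2 * sqrt (q k0)"
      unfolding B_def using qs q0 \<nu> \<nu>2 by (intro add_mono mult_mono) auto
    also have "\<dots> = 3 * \<nu>\<^sup>2 * sqrt (q k0)" by simp
    also have "\<dots> \<le> 3 * \<nu>\<^sup>2 * (1 / (3 * \<nu>\<^sup>2))" using sq \<nu> by (intro mult_left_mono) auto
    also have "\<dots> = 1" using \<nu> by simp
    finally show ?thesis .
  qed
  show "\<bar>(\<Sum>i. T \<alpha> i) - (\<Sum>i<k0^3. T \<alpha> i)\<bar> \<le> 1" if "0 \<le> \<alpha>" for \<alpha>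
  proof (rule tendsto_upperbound)
    show "(\<lambda>m. \<bar>(\<Sum>i<m. T \<alpha> i) - (\<Sum>i<k0^3. T \<alpha> i)\<bar>) \<longlonglongrightarrow> \<bar>(\<Sum>i. T \<alpha> i) - (\<Sum>i<k0^3. T \<alpha> i)\<bar>"
      using sums[OF that] by (intro tendsto_intros summable_LIMSEQ) (auto simp: sums_iff)
    show "\<forall>\<^sub>F m in sequentially. \<bar>(\<Sum>i<m. T \<alpha> i) - (\<Sum>i<k0^3. T \<alpha> i)\<bar> \<le> 1"
      using eventually_ge_at_top[of "k0^3"]
    proof eventually_elim
      case (elim m)
      then have "(\<Sum>i<m. T \<alpha> i) = (\<Sum>i<k0^3. T \<alpha> i) + (\<Sum>i=k0^3..<m. T \<alpha> i)"
        by (simp add: lessThan_atLeast0 sum.atLeastLessThan_concat)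
      then show ?case using bd[of k0 m \<alpha>] elim that \<open>B k0 \<le> 1\<close> by simp
    qed
  qed auto
qed

section \<open>Kullback--Leibler functional\<close>

text \<open>The difference of the two sides vanishes at 0 and has derivative
  \<open>x\<^sup>2 / (1 + x) ^ 3\<close>. The right-hand side is twice a Kullback-Leibler
  divergence, the left-hand side governs the noise variance; hence the divergence can absorb the
  noise.\<close>

lemma ln_one_plus_minus_ratio_ge:
  assumes "0 \<le> s"
  shows "(s / (1 + s))\<^sup>2 / 2 \<le> ln (1 + s) - s / (1 + s :: real)"
proof -
  define r where "r = (\<lambda>s::real. s / (1 + s))"
  define f where "f = (\<lambda>s::real. ln (1 + s) - r s - (r s)\<^sup>2 / 2)"
  have "f 0 \<le> f s"
  proof (rule DERIV_nonneg_imp_nondecreasing[OF assms])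
    fix x :: real assume x: "0 \<le> x"
    have d: "DERIV r x :> 1 / (1 + x)\<^sup>2"
      unfolding r_def using x by (auto intro!: derivative_eq_intros simp: power2_eq_square)
    have "DERIV f x :> 1 / (1 + x) - 1 / (1 + x)\<^sup>2 - r x * (1 / (1 + x)\<^sup>2)"
      unfolding f_def using x by (auto intro!: derivative_eq_intros d)
    then have "DERIV f x :> 1 / (1 + x) - 1 / (1 + x)\<^sup>2 - x / (1 + x) * (1 / (1 + x)\<^sup>2)"
      by (simp add: r_def)
    moreover have "1 / (1 + x) - 1 / (1 + x)\<^sup>2 - x / (1 + x) * (1 / (1 + x)\<^sup>2) = x\<^sup>2 / (1 + x) ^ 3"
      using x by (simp add: divide_simps power2_eq_square power3_eq_cube) (simp add: algebra_simps)
    ultimately show "\<exists>y. DERIV f x :> y \<and> 0 \<le> y" using x by (intro exI[of _ "x\<^sup>2 / (1 + x) ^ 3"]) auto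
  qed
  then show ?thesis by (simp add: f_def r_def)
qed

text \<open>Convexity of \<open>exp\<close> on the segment from 0 to \<open>- v\<close>, with weight
  \<open>s / (1 + s)\<close> on \<open>- v\<close>. It bounds the loss in the logarithm when a small
  increase of \<alpha> damps the signal-to-noise ratio by \<open>exp (- v)\<close>.\<close>

lemma ln_one_plus_scaled_ge:
  assumes "0 \<le> s" "0 \<le> v"
  shows "ln (1 + s) - s / (1 + s) * v \<le> ln (1 + s * exp (- v :: real))"
proof -
  let ?w = "s / (1 + s)"
  have "exp ((1 - ?w) *\<^sub>R 0 + ?w *\<^sub>R (- v)) \<le> (1 - ?w) * exp 0 + ?w * exp (- v)"
    using assms by (intro convex_onD[OF exp_convex]) auto
  also have "\<dots> = (1 + s * exp (- v)) / (1 + s)"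
    using assms by (simp add: field_simps)
  finally have "(1 + s) * exp (- (?w * v)) \<le> 1 + s * exp (- v)"
    using assms by (simp add: field_simps)
  then have "ln ((1 + s) * exp (- (?w * v))) \<le> ln (1 + s * exp (- v))"
    using assms by (intro ln_mono) (auto intro!: mult_pos_pos)
  then show ?thesis using assms by (simp add: ln_mult)
qed

lemma sum_inverse_le_ln:
  assumes "K \<ge> 1"
  shows "(\<Sum>i<K. 1 / real (Suc i)) \<le> 1 + ln (real K)"
  using assms
proof (induction K rule: dec_induct)
  case (step K)
  have "ln (real K / real (Suc K)) \<le> real K / real (Suc K) - 1"
    using step by (intro ln_le_minus_one) auto
  then have "1 / real (Suc K) \<le> ln (real (Suc K)) - ln (real K)"
    using step by (simp add: ln_div field_simps)
  then show ?case using step by simp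
qed auto

lemma card_Suc_le_real:
  assumes "0 \<le> N"
  shows "real (card {i. i < K \<and> real (Suc i) \<le> N}) \<le> N"
proof -
  have "{i. i < K \<and> real (Suc i) \<le> N} \<subseteq> {..<nat \<lfloor>N\<rfloor>}"
  proof safe
    fix i assume "real (Suc i) \<le> N"
    then have "int (Suc i) \<le> \<lfloor>N\<rfloor>" by (subst le_floor_iff) simp
    then show "i < nat \<lfloor>N\<rfloor>" by linarith
  qed
  from card_mono[OF _ this] have "card {i. i < K \<and> real (Suc i) \<le> N} \<le> nat \<lfloor>N\<rfloor>" by simp
  also have "real (nat \<lfloor>N\<rfloor>) \<le> N" using assms by simp
  finally show ?thesis by simp
qed

section \<open>The sequence model: signal-to-noise ratios, shrinkage weights and divergence\<close>

locale mildly_ill_posed =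
  fixes \<kappa> :: "nat \<Rightarrow> real" and p C :: real
  assumes p: "0 \<le> p" and C: "1 \<le> C"
    and \<kappa>: "\<And>i. inverse C * real (Suc i) powr (-p) \<le> \<kappa> i \<and> \<kappa> i \<le> C * real (Suc i) powr (-p)"
begin

definition amp :: "nat \<Rightarrow> real" where
  "amp i = (\<kappa> i)\<^sup>2 / real (Suc i)"

text \<open>The ratio of prior signal variance to noise variance in one coordinate, factored as
  required by \<open>lik_series_bounds\<close> with \<open>\<nu> = n\<close> and
  \<open>a = amp\<close>.\<close>

definition snr :: "nat \<Rightarrow> real \<Rightarrow> nat \<Rightarrow> real" where
  "snr n \<alpha> i = real n * amp i * real (Suc i) powr (-2*\<alpha>)"

text \<open>The weight that the posterior mean gives to the naive estimate
  \<open>Y i / \<kappa> i\<close>; its complement is the relative bias.\<close>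

definition shr :: "nat \<Rightarrow> real \<Rightarrow> nat \<Rightarrow> real" where
  "shr n \<alpha> i = snr n \<alpha> i / (1 + snr n \<alpha> i)"

text \<open>The noncentrality of \<open>n * (Y i)\<^sup>2\<close>.\<close>

definition sig :: "nat \<Rightarrow> (nat \<Rightarrow> real) \<Rightarrow> nat \<Rightarrow> real" where
  "sig n \<mu> i = real n * (\<kappa> i * \<mu> i)\<^sup>2"

text \<open>Up to the factor 2 and the truncation at \<open>K\<close>, this is the Kullback--Leibler divergence of the
  marginal law of the data under the prior with parameter \<open>\<alpha>\<close> from their true law.\<close>
definition kl :: "nat \<Rightarrow> (nat \<Rightarrow> real) \<Rightarrow> nat \<Rightarrow> real \<Rightarrow> real" where
  "kl n \<mu> K \<alpha> = (\<Sum>i<K. ln (1 + snr n \<alpha> i) - shr n \<alpha> i + (1 - shr n \<alpha> i) * sig n \<mu> i)"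

text \<open>The index at which the prior and the noise balance.\<close>
definition eff :: "nat \<Rightarrow> real \<Rightarrow> real" where
  "eff n \<alpha> = real n powr (1 / (1 + 2*\<alpha> + 2*p))"

lemma kappa_pos: "0 < \<kappa> i"
proof -
  have "0 < inverse C * real (Suc i) powr (-p)" using C by simp
  then show ?thesis using \<kappa>[of i] by linarith
qed

lemma one_plus_C_pos: "0 < 1 + C\<^sup>2"
  by (intro add_pos_nonneg) auto

lemma kappa_sq_le: "(\<kappa> i)\<^sup>2 \<le> C\<^sup>2 * real (Suc i) powr (-2*p)"
proof -
  have "(\<kappa> i)\<^sup>2 \<le> (C * real (Suc i) powr (-p))\<^sup>2"
    using \<kappa>[of i] kappa_pos[of i] by (intro power_mono) auto
  also have "\<dots> = C\<^sup>2 * real (Suc i) powr (-2*p)"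
    by (simp add: power_mult_distrib power2_eq_square[of "_ powr _"] flip: powr_add)
  finally show ?thesis .
qed

lemma kappa_sq_ge: "real (Suc i) powr (-2*p) / C\<^sup>2 \<le> (\<kappa> i)\<^sup>2"
proof -
  have "(inverse C * real (Suc i) powr (-p))\<^sup>2 \<le> (\<kappa> i)\<^sup>2"
    using \<kappa>[of i] C by (intro power_mono) auto
  also have "(inverse C * real (Suc i) powr (-p))\<^sup>2 = real (Suc i) powr (-2*p) / C\<^sup>2"
    by (simp add: power_mult_distrib power2_eq_square[of "_ powr _"] power_inverse field_simps flip: powr_add)
  finally show ?thesis .
qed

lemma inverse_kappa_sq_le: "1 / (\<kappa> i)\<^sup>2 \<le> C\<^sup>2 * real (Suc i) powr (2*p)"
proof -
  have "1 / (\<kappa> i)\<^sup>2 \<le> 1 / (real (Suc i) powr (-2*p) / C\<^sup>2)"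
    using kappa_sq_ge[of i] C kappa_pos[of i] by (intro divide_left_mono) auto
  then show ?thesis by (simp add: powr_minus field_simps)
qed

lemma amp_pos: "0 < amp i"
  using kappa_pos[of i] by (simp add: amp_def)

lemma kappa_sq_le_const: "(\<kappa> i)\<^sup>2 \<le> C\<^sup>2"
proof -
  have "real (Suc i) powr (-2*p) \<le> 1" using p powr_mono2'[of "-2*p" 1 "real (Suc i)"] by auto
  then have "(\<kappa> i)\<^sup>2 \<le> C\<^sup>2 * 1"
    using order_trans[OF kappa_sq_le[of i] mult_left_mono[of _ 1 "C\<^sup>2"]] by auto
  then show ?thesis by simp
qed

lemma amp_le: "amp i \<le> C\<^sup>2 / real (Suc i)"
  unfolding amp_def by (intro divide_right_mono kappa_sq_le_const) auto

lemma snr_nonneg: "0 \<le> snr n \<alpha> i"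
  using amp_pos[of i] by (simp add: snr_def)

lemma kappa_powi: "(\<kappa> i) powi (-2) = 1 / (\<kappa> i)\<^sup>2"
  by (simp add: power_int_def divide_inverse power_inverse nat_numeral)

lemma snr_eq: "real n / (real (Suc i) powr (1 + 2*\<alpha>) * (\<kappa> i) powi (-2)) = snr n \<alpha> i"
proof -
  have "real (Suc i) powr (1 + 2*\<alpha>) = real (Suc i) * real (Suc i) powr (2*\<alpha>)"
    by (simp add: powr_add)
  then show ?thesis
    by (simp add: kappa_powi snr_def amp_def powr_minus field_simps)
qed

lemma snr_alt: "snr n \<alpha> i = (\<kappa> i)\<^sup>2 * (real n * real (Suc i) powr (-1-2*\<alpha>))"
  by (simp add: snr_def amp_def powr_diff powr_minus field_simps)

lemma snr_le: "snr n \<alpha> i \<le> C\<^sup>2 * (real n * real (Suc i) powr (-(1+2*\<alpha>+2*p)))"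
proof -
  have "snr n \<alpha> i \<le> (C\<^sup>2 * real (Suc i) powr (-2*p)) * (real n * real (Suc i) powr (-1-2*\<alpha>))"
    unfolding snr_alt by (intro mult_right_mono kappa_sq_le) auto
  also have "\<dots> = C\<^sup>2 * (real n * (real (Suc i) powr (-2*p) * real (Suc i) powr (-1-2*\<alpha>)))"
    by simp
  also have "real (Suc i) powr (-2*p) * real (Suc i) powr (-1-2*\<alpha>) = real (Suc i) powr (-(1+2*\<alpha>+2*p))"
    unfolding powr_add[symmetric] by (rule arg_cong[where f="\<lambda>z. _ powr z"]) simp
  finally show ?thesis .
qed

lemma snr_ge: "real n * real (Suc i) powr (-(1+2*\<alpha>+2*p)) / C\<^sup>2 \<le> snr n \<alpha> i"
proof -
  have "(real (Suc i) powr (-2*p) / C\<^sup>2) * (real n * real (Suc i) powr (-1-2*\<alpha>)) \<le> snr n \<alpha> i"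
    unfolding snr_alt by (intro mult_right_mono kappa_sq_ge) auto
  also have "(real (Suc i) powr (-2*p) / C\<^sup>2) * (real n * real (Suc i) powr (-1-2*\<alpha>)) =
      real n * (real (Suc i) powr (-2*p) * real (Suc i) powr (-1-2*\<alpha>)) / C\<^sup>2"
    by simp
  also have "real (Suc i) powr (-2*p) * real (Suc i) powr (-1-2*\<alpha>) = real (Suc i) powr (-(1+2*\<alpha>+2*p))"
    unfolding powr_add[symmetric] by (rule arg_cong[where f="\<lambda>z. _ powr z"]) simp
  finally show ?thesis .
qed

lemma snr_antimono: "\<alpha> \<le> \<alpha>' \<Longrightarrow> snr n \<alpha>' i \<le> snr n \<alpha> i"
  unfolding snr_def using amp_pos[of i] powr_mono[of "-2*\<alpha>'" "-2*\<alpha>" "real (Suc i)"]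
  by (intro mult_left_mono) auto

lemma snr_shift: "snr n (\<alpha> + \<delta>) i = snr n \<alpha> i * exp (- (2 * \<delta> * ln (real (Suc i))))"
proof -
  have "real (Suc i) powr (-2*(\<alpha>+\<delta>)) = real (Suc i) powr (-2*\<alpha>) * real (Suc i) powr (-2*\<delta>)"
    unfolding powr_add[symmetric] by (rule arg_cong[where f="\<lambda>z. _ powr z"]) simp
  also have "real (Suc i) powr (-2*\<delta>) = exp (- (2 * \<delta> * ln (real (Suc i))))"
    by (simp add: powr_def)
  finally show ?thesis by (simp add: snr_def)
qed

lemma shr_bounds: "0 \<le> shr n \<alpha> i" "shr n \<alpha> i \<le> 1" "shr n \<alpha> i \<le> snr n \<alpha> i"
  using snr_nonneg[of n \<alpha> i] by (auto simp: shr_def field_simps add_nonneg_eq_0_iff)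

lemma one_minus_shr: "1 - shr n \<alpha> i = 1 / (1 + snr n \<alpha> i)"
  using snr_nonneg[of n \<alpha> i] by (auto simp: shr_def field_simps)

lemma shr_antimono: "\<alpha> \<le> \<alpha>' \<Longrightarrow> shr n \<alpha>' i \<le> shr n \<alpha> i"
proof -
  assume "\<alpha> \<le> \<alpha>'"
  then have "1 / (1 + snr n \<alpha> i) \<le> 1 / (1 + snr n \<alpha>' i)"
    using snr_antimono[of \<alpha> \<alpha>' n i] snr_nonneg[of n \<alpha>' i] by (intro divide_left_mono) auto
  then show ?thesis by (simp flip: one_minus_shr)
qed

lemma sig_nonneg: "0 \<le> sig n \<mu> i" by (simp add: sig_def)

lemma kl_term_nonneg:
  "(shr n \<alpha> i)\<^sup>2 / 2 \<le> ln (1 + snr n \<alpha> i) - shr n \<alpha> i"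
  "0 \<le> (1 - shr n \<alpha> i) * sig n \<mu> i"
  using ln_one_plus_minus_ratio_ge[OF snr_nonneg] shr_bounds[of n \<alpha> i] sig_nonneg[of n \<mu> i]
  by (auto simp: shr_def)

lemma kl_nonneg: "0 \<le> kl n \<mu> K \<alpha>"
  unfolding kl_def
proof (rule sum_nonneg)
  show "0 \<le> ln (1 + snr n \<alpha> i) - shr n \<alpha> i + (1 - shr n \<alpha> i) * sig n \<mu> i" for i
    using kl_term_nonneg(1)[of n \<alpha> i] kl_term_nonneg(2)[of n \<alpha> i \<mu>] zero_le_power2[of "shr n \<alpha> i"]
    by linarith
qed

lemma kl_ge_bias: "(\<Sum>i<K. (1 - shr n \<alpha> i) * sig n \<mu> i) \<le> kl n \<mu> K \<alpha>"
  unfolding kl_def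
proof (rule sum_mono)
  show "(1 - shr n \<alpha> i) * sig n \<mu> i \<le> ln (1 + snr n \<alpha> i) - shr n \<alpha> i + (1 - shr n \<alpha> i) * sig n \<mu> i" for i
    using kl_term_nonneg(1)[of n \<alpha> i] zero_le_power2[of "shr n \<alpha> i"] by linarith
qed

section \<open>Bounds in terms of the effective dimension\<close>

context
  fixes n :: nat and \<alpha> :: real
  assumes n: "n \<ge> 1" and \<alpha>: "0 \<le> \<alpha>"
begin

lemma eff_ge_1: "1 \<le> eff n \<alpha>"
  unfolding eff_def using n p \<alpha> by (intro ge_one_powr_ge_zero) auto

lemma eff_powr: "eff n \<alpha> powr (1 + 2*\<alpha> + 2*p) = real n"
  unfolding eff_def using n p \<alpha> by (simp add: powr_powr add_nonneg_eq_0_iff)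

lemma eff_le: "eff n \<alpha> \<le> real n"
proof -
  have "eff n \<alpha> \<le> real n powr 1"
    unfolding eff_def using n p \<alpha> by (intro powr_mono) auto
  then show ?thesis using n by simp
qed

text \<open>Only a decay of order 1/i is retained beyond the effective dimension. This keeps the
  constant uniform down to \<alpha> = p = 0, at the price of a factor \<open>ln K\<close> after
  summation.\<close>

lemma snr_le_eff:
  assumes "eff n \<alpha> \<le> real (Suc i)"
  shows "snr n \<alpha> i \<le> C\<^sup>2 * eff n \<alpha> * (1 / real (Suc i))"
proof -
  let ?q = "1 + 2*\<alpha> + 2*p" and ?x = "real (Suc i)"
  have "?x powr (1-?q) = ?x * ?x powr (-?q)"
    by (subst powr_mult_base) simp_all
  then have "real n * ?x powr (-?q) = real n * ?x powr (1-?q) / ?x"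
    by (simp del: of_nat_Suc)
  also have "\<dots> \<le> real n * eff n \<alpha> powr (1-?q) / ?x"
    using assms eff_ge_1 p \<alpha> by (intro divide_right_mono mult_left_mono powr_mono2') auto
  also have "real n * eff n \<alpha> powr (1-?q) = eff n \<alpha>"
    using eff_ge_1 by (simp add: eff_powr[symmetric] powr_add[symmetric] del: eff_powr)
  finally have "C\<^sup>2 * (real n * ?x powr (-?q)) \<le> C\<^sup>2 * (eff n \<alpha> / ?x)"
    by (intro mult_left_mono) auto
  then show ?thesis using snr_le[of n \<alpha> i] by simp
qed

lemma snr_ge_inside:
  assumes "real (Suc i) \<le> eff n \<alpha>"
  shows "1 / C\<^sup>2 \<le> snr n \<alpha> i"
proof -
  let ?q = "1 + 2*\<alpha> + 2*p" and ?x = "real (Suc i)"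
  have "real n * eff n \<alpha> powr (-?q) \<le> real n * ?x powr (-?q)"
    using assms p \<alpha> by (intro mult_left_mono powr_mono2') auto
  moreover have "real n * eff n \<alpha> powr (-?q) = 1"
    using n by (simp only: powr_minus eff_powr) simp
  ultimately have "1 / C\<^sup>2 \<le> real n * ?x powr (-?q) / C\<^sup>2"
    by (intro divide_right_mono) auto
  then show ?thesis using snr_ge[of n i \<alpha>] by linarith
qed

lemma sum_split_eff:
  assumes "K \<ge> 1" and "0 \<le> c"
    and f1: "\<And>i. real (Suc i) \<le> eff n \<alpha> \<Longrightarrow> f i \<le> c"
    and f2: "\<And>i. eff n \<alpha> \<le> real (Suc i) \<Longrightarrow> f i \<le> C\<^sup>2 * eff n \<alpha> * (1 / real (Suc i))"
  shows "(\<Sum>i<K. f i) \<le> eff n \<alpha> * (c + C\<^sup>2 * (1 + ln (real K)))"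
proof -
  have e: "0 \<le> eff n \<alpha>" using eff_ge_1 by simp
  have "f i \<le> (if real (Suc i) \<le> eff n \<alpha> then c else 0) + C\<^sup>2 * eff n \<alpha> * (1 / real (Suc i))" for i
  proof -
    have "0 \<le> C\<^sup>2 * eff n \<alpha> * (1 / real (Suc i))" using e by simp
    moreover have "f i \<le> C\<^sup>2 * eff n \<alpha> * (1 / real (Suc i))" if "\<not> real (Suc i) \<le> eff n \<alpha>"
      using that by (intro f2) linarith
    ultimately show ?thesis
      using f1[of i] by (cases "real (Suc i) \<le> eff n \<alpha>") (auto intro: add_increasing2 simp del: of_nat_Suc)
  qed
  then have "(\<Sum>i<K. f i) \<le> (\<Sum>i<K. (if real (Suc i) \<le> eff n \<alpha> then c else 0) + C\<^sup>2 * eff n \<alpha> * (1 / real (Suc i)))"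
    by (intro sum_mono)
  also have "\<dots> = c * real (card {i. i < K \<and> real (Suc i) \<le> eff n \<alpha>}) + C\<^sup>2 * eff n \<alpha> * (\<Sum>i<K. 1 / real (Suc i))"
    by (simp add: sum.distrib sum_distrib_left sum.If_cases Int_def del: of_nat_Suc)
  also have "\<dots> \<le> c * eff n \<alpha> + C\<^sup>2 * eff n \<alpha> * (1 + ln (real K))"
    using assms e by (intro add_mono mult_left_mono card_Suc_le_real sum_inverse_le_ln) auto
  finally show ?thesis by (simp add: algebra_simps)
qed

lemma sum_shr_le:
  assumes "K \<ge> 1"
  shows "(\<Sum>i<K. shr n \<alpha> i) \<le> eff n \<alpha> * (1 + C\<^sup>2 * (1 + ln (real K)))"
  using assms shr_bounds(2) order_trans[OF shr_bounds(3) snr_le_eff]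
  by (intro sum_split_eff) auto

lemma sum_ln_snr_le:
  assumes "K \<ge> 1"
  shows "(\<Sum>i<K. ln (1 + snr n \<alpha> i)) \<le> eff n \<alpha> * (ln (1 + C\<^sup>2 * real n) + C\<^sup>2 * (1 + ln (real K)))"
proof (rule sum_split_eff[OF assms])
  fix i
  have "ln (1 + snr n \<alpha> i) \<le> snr n \<alpha> i"
    using snr_nonneg by (rule ln_add_one_self_le_self)
  then show "ln (1 + snr n \<alpha> i) \<le> C\<^sup>2 * eff n \<alpha> * (1 / real (Suc i))" if "eff n \<alpha> \<le> real (Suc i)"
    using snr_le_eff[OF that] by linarith
  have "real (Suc i) powr (-(1+2*\<alpha>+2*p)) \<le> 1"
    using p \<alpha> powr_mono2'[of "-(1+2*\<alpha>+2*p)" 1 "real (Suc i)"] by auto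
  then have "C\<^sup>2 * (real n * real (Suc i) powr (-(1+2*\<alpha>+2*p))) \<le> C\<^sup>2 * (real n * 1)"
    by (intro mult_left_mono) auto
  then show "ln (1 + snr n \<alpha> i) \<le> ln (1 + C\<^sup>2 * real n)"
    using snr_le[of n \<alpha> i] snr_nonneg[of n \<alpha> i] by (intro ln_mono) auto
qed auto

text \<open>Every coordinate below \<open>eff n \<alpha>\<close> has \<open>snr\<close> at least
  1/C^2, hence \<open>shr\<close> at least 1/(1 + C^2), and contributes at least half of the square
  of that. Rounding the number of these coordinates down costs another factor 2;
  \<open>n \<le> K\<close> ensures that the truncation keeps them all.\<close>

lemma kl_ge_eff:
  assumes "n \<le> K"
  shows "eff n \<alpha> / (4 * (1 + C\<^sup>2)\<^sup>2) \<le> kl n \<mu> K \<alpha>"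
proof -
  let ?m = "nat \<lfloor>eff n \<alpha>\<rfloor>"
  have "1 \<le> \<lfloor>eff n \<alpha>\<rfloor>" using eff_ge_1 by simp
  then have "1 \<le> real_of_int \<lfloor>eff n \<alpha>\<rfloor>" by simp
  then have "eff n \<alpha> / 2 \<le> real_of_int \<lfloor>eff n \<alpha>\<rfloor>"
    using real_of_int_floor_add_one_gt[of "eff n \<alpha>"] by linarith
  then have m: "eff n \<alpha> / 2 \<le> real ?m" using eff_ge_1 by simp
  have "real ?m \<le> eff n \<alpha>" using eff_ge_1 by simp
  also have "\<dots> \<le> real K" using eff_le assms by linarith
  finally have mK: "?m \<le> K" by simp
  have t: "1 / (2 * (1 + C\<^sup>2)\<^sup>2) \<le> ln (1 + snr n \<alpha> i) - shr n \<alpha> i + (1 - shr n \<alpha> i) * sig n \<mu> i"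
    if "i < ?m" for i
  proof -
    have "real (Suc i) \<le> real ?m" using that by simp
    also have "\<dots> \<le> eff n \<alpha>" using eff_ge_1 by simp
    finally have "1 / C\<^sup>2 \<le> snr n \<alpha> i" by (rule snr_ge_inside)
    moreover have "0 < 1 / C\<^sup>2" using C by simp
    ultimately have "1 - shr n \<alpha> i \<le> 1 / (1 + 1 / C\<^sup>2)"
      unfolding one_minus_shr by (intro divide_left_mono mult_pos_pos) linarith+
    also have "\<dots> = 1 - 1 / (1 + C\<^sup>2)" using C by (simp add: field_simps add_nonneg_eq_0_iff)
    finally have "(1 / (1 + C\<^sup>2))\<^sup>2 \<le> (shr n \<alpha> i)\<^sup>2" by (intro power_mono) auto
    then have "1 / (2 * (1 + C\<^sup>2)\<^sup>2) \<le> (shr n \<alpha> i)\<^sup>2 / 2" by (simp add: power_divide)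
    then show ?thesis using kl_term_nonneg[of n \<alpha> i] kl_term_nonneg(2)[of n \<alpha> i \<mu>] by linarith
  qed
  have nn: "0 \<le> ln (1 + snr n \<alpha> i) - shr n \<alpha> i + (1 - shr n \<alpha> i) * sig n \<mu> i" for i
    using kl_term_nonneg[of n \<alpha> i] kl_term_nonneg(2)[of n \<alpha> i \<mu>] zero_le_power2[of "shr n \<alpha> i"] by linarith
  have "eff n \<alpha> / (4 * (1 + C\<^sup>2)\<^sup>2) = (eff n \<alpha> / 2) * (1 / (2 * (1 + C\<^sup>2)\<^sup>2))" by simp
  also have "\<dots> \<le> real ?m * (1 / (2 * (1 + C\<^sup>2)\<^sup>2))" using m by (intro mult_right_mono) auto
  also have "\<dots> = (\<Sum>i<?m. 1 / (2 * (1 + C\<^sup>2)\<^sup>2))" by simp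
  also have "\<dots> \<le> (\<Sum>i<?m. ln (1 + snr n \<alpha> i) - shr n \<alpha> i + (1 - shr n \<alpha> i) * sig n \<mu> i)"
    using t by (intro sum_mono) auto
  also have "\<dots> \<le> kl n \<mu> K \<alpha>"
    unfolding kl_def using mK nn by (intro sum_mono2) auto
  finally show ?thesis .
qed

text \<open>The prior parameter here equals the smoothness of the truth, so both regimes balance at
  \<open>eff n \<alpha>\<close>: below it \<open>1 - shr\<close> is at most 1/\<open>snr\<close>,
  above it the factor is dropped and the smoothness weight makes the signal small.\<close>

lemma sum_bias_le:
  assumes S: "summable (\<lambda>i. real (Suc i) powr (2*\<alpha>) * (\<mu> i)\<^sup>2)"
  shows "(\<Sum>i<K. (1 - shr n \<alpha> i) * sig n \<mu> i) \<le> C^4 * eff n \<alpha> * (\<Sum>i. real (Suc i) powr (2*\<alpha>) * (\<mu> i)\<^sup>2)"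
proof -
  have "(1 - shr n \<alpha> i) * sig n \<mu> i \<le> C^4 * eff n \<alpha> * (real (Suc i) powr (2*\<alpha>) * (\<mu> i)\<^sup>2)" for i
  proof -
    let ?x = "real (Suc i)" and ?N = "eff n \<alpha>" and ?q = "1 + 2*\<alpha> + 2*p"
    have sg: "sig n \<mu> i \<le> C\<^sup>2 * (real n * ?x powr (-2*p)) * (\<mu> i)\<^sup>2"
      unfolding sig_def power_mult_distrib
      using mult_left_mono[OF mult_right_mono[OF kappa_sq_le[of i], of "(\<mu> i)\<^sup>2"], of "real n"]
      by (simp add: algebra_simps)
    have C4: "C\<^sup>2 \<le> C^4" using C by (intro power_increasing) auto
    show ?thesis
    proof (cases "?x \<le> ?N")
      case True
      have "0 < real n * ?x powr (-?q) / C\<^sup>2" using n C by simp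
      then have "1 - shr n \<alpha> i \<le> 1 / (real n * ?x powr (-?q) / C\<^sup>2)"
        unfolding one_minus_shr using snr_ge[of n i \<alpha>] by (intro divide_left_mono mult_pos_pos) linarith+
      also have "\<dots> = C\<^sup>2 * ?x powr ?q / real n"
        unfolding powr_minus by (simp add: divide_inverse)
      finally have "(1 - shr n \<alpha> i) * sig n \<mu> i \<le>
          (C\<^sup>2 * ?x powr ?q / real n) * (C\<^sup>2 * (real n * ?x powr (-2*p)) * (\<mu> i)\<^sup>2)"
        using sg sig_nonneg[of n \<mu> i] by (intro mult_mono) auto
      also have "\<dots> = C^4 * (?x powr ?q * ?x powr (-2*p)) * (\<mu> i)\<^sup>2"
        using n by (simp add: power4_eq_xxxx power2_eq_square)
      also have "?x powr ?q * ?x powr (-2*p) = ?x * ?x powr (2*\<alpha>)"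
        by (simp add: powr_add[symmetric] powr_mult_base add.commute)
      also have "C^4 * (?x * ?x powr (2*\<alpha>)) * (\<mu> i)\<^sup>2 = C^4 * ?x * (?x powr (2*\<alpha>) * (\<mu> i)\<^sup>2)"
        by simp
      also have "\<dots> \<le> C^4 * ?N * (?x powr (2*\<alpha>) * (\<mu> i)\<^sup>2)"
        using True C by (intro mult_right_mono mult_left_mono) auto
      finally show ?thesis .
    next
      case False
      have "(1 - shr n \<alpha> i) * sig n \<mu> i \<le> 1 * sig n \<mu> i"
        using shr_bounds[of n \<alpha> i] sig_nonneg[of n \<mu> i] by (intro mult_right_mono) auto
      also have "\<dots> \<le> C\<^sup>2 * (real n * ?x powr (-2*p)) * (\<mu> i)\<^sup>2" using sg by simp
      also have "?x powr (-2*p) = ?x powr (-(2*\<alpha>+2*p)) * ?x powr (2*\<alpha>)"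
        by (simp flip: powr_add)
      also have "C\<^sup>2 * (real n * (?x powr (-(2*\<alpha>+2*p)) * ?x powr (2*\<alpha>))) * (\<mu> i)\<^sup>2
          = C\<^sup>2 * (real n * ?x powr (-(2*\<alpha>+2*p))) * (?x powr (2*\<alpha>) * (\<mu> i)\<^sup>2)" by simp
      also have "\<dots> \<le> C\<^sup>2 * (real n * ?N powr (-(2*\<alpha>+2*p))) * (?x powr (2*\<alpha>) * (\<mu> i)\<^sup>2)"
        using False eff_ge_1 p \<alpha> by (intro mult_right_mono mult_left_mono powr_mono2') auto
      also have "real n * ?N powr (-(2*\<alpha>+2*p)) = ?N"
        using eff_ge_1 by (simp add: eff_powr[symmetric] powr_add[symmetric] del: eff_powr)
      also have "C\<^sup>2 * ?N * (?x powr (2*\<alpha>) * (\<mu> i)\<^sup>2) \<le> C^4 * ?N * (?x powr (2*\<alpha>) * (\<mu> i)\<^sup>2)"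
        using eff_ge_1 C4 by (intro mult_right_mono) auto
      finally show ?thesis .
    qed
  qed
  then have "(\<Sum>i<K. (1 - shr n \<alpha> i) * sig n \<mu> i) \<le> (\<Sum>i<K. C^4 * eff n \<alpha> * (real (Suc i) powr (2*\<alpha>) * (\<mu> i)\<^sup>2))"
    by (intro sum_mono)
  also have "\<dots> = C^4 * eff n \<alpha> * (\<Sum>i<K. real (Suc i) powr (2*\<alpha>) * (\<mu> i)\<^sup>2)"
    by (simp add: sum_distrib_left)
  also have "\<dots> \<le> C^4 * eff n \<alpha> * (\<Sum>i. real (Suc i) powr (2*\<alpha>) * (\<mu> i)\<^sup>2)"
    using eff_ge_1 C S by (intro mult_left_mono sum_le_suminf) auto
  finally show ?thesis .
qed

end

text \<open>The divergence at the comparison parameter. The 24 anticipates \<open>K = n^24\<close>;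
  of the constant 29, the logarithmic terms take 28 and the bias takes 1.\<close>

lemma kl_le:
  assumes n: "n \<ge> 3" and \<beta>: "0 \<le> \<beta>" and R: "1 \<le> R" and K: "1 \<le> K" "ln (real K) \<le> 24 * ln (real n)"
    and S: "summable (\<lambda>i. real (Suc i) powr (2*\<beta>) * (\<mu> i)\<^sup>2)" "(\<Sum>i. real (Suc i) powr (2*\<beta>) * (\<mu> i)\<^sup>2) \<le> R\<^sup>2"
    and l: "1 \<le> ln (real n)"
  shows "kl n \<mu> K \<beta> \<le> 29 * C^4 * ln (real n) * R\<^sup>2 * eff n \<beta>"
proof -
  let ?l = "ln (real n)" and ?N = "eff n \<beta>"
  have N: "1 \<le> ?N" using n \<beta> by (intro eff_ge_1) auto
  have C2: "1 \<le> C\<^sup>2" "1 \<le> C^4" "C\<^sup>2 \<le> C^4" using C by (auto intro: power_increasing)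
  have R2: "1 \<le> R\<^sup>2" using R by auto
  have "ln (1 + C\<^sup>2 * real n) \<le> ln ((1 + C\<^sup>2) * real n)"
  proof (intro ln_mono)
    show "1 + C\<^sup>2 * real n \<le> (1 + C\<^sup>2) * real n" using n by (simp add: algebra_simps)
  qed (use n C2 in \<open>auto intro!: add_pos_nonneg\<close>)
  also have "\<dots> = ln (1 + C\<^sup>2) + ?l"
    using n one_plus_C_pos by (simp add: ln_mult)
  also have "ln (1 + C\<^sup>2) \<le> C\<^sup>2" by (rule ln_add_one_self_le_self) simp
  finally have A: "ln (1 + C\<^sup>2 * real n) \<le> C\<^sup>2 + ?l" by simp
  have Cl: "C\<^sup>2 \<le> C^4 * ?l" "?l \<le> C^4 * ?l" "C\<^sup>2 * ?l \<le> C^4 * ?l"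
    using mult_mono[OF C2(3) l] mult_right_mono[OF C2(2), of ?l] mult_right_mono[OF C2(3), of ?l] l C by auto
  have "ln (1 + C\<^sup>2 * real n) + C\<^sup>2 * (1 + ln (real K)) \<le> C\<^sup>2 + ?l + C\<^sup>2 * (1 + 24 * ?l)"
    using A K C2 by (intro add_mono mult_left_mono) auto
  also have "\<dots> = 2 * C\<^sup>2 + ?l + 24 * (C\<^sup>2 * ?l)" by (simp add: algebra_simps)
  also have "\<dots> \<le> 28 * (C^4 * ?l)" using Cl C2 by linarith
  finally have B: "ln (1 + C\<^sup>2 * real n) + C\<^sup>2 * (1 + ln (real K)) \<le> 28 * (C^4 * ?l)" .
  have "kl n \<mu> K \<beta> \<le> (\<Sum>i<K. ln (1 + snr n \<beta> i)) + (\<Sum>i<K. (1 - shr n \<beta> i) * sig n \<mu> i)"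
    unfolding kl_def sum.distrib[symmetric] using shr_bounds by (intro sum_mono) auto
  also have "\<dots> \<le> ?N * (28 * (C^4 * ?l)) + C^4 * ?N * R\<^sup>2"
  proof (rule add_mono)
    show "(\<Sum>i<K. ln (1 + snr n \<beta> i)) \<le> ?N * (28 * (C^4 * ?l))"
      using order_trans[OF sum_ln_snr_le[of n \<beta> K] mult_left_mono[OF B, of ?N]] n \<beta> K N by simp
    show "(\<Sum>i<K. (1 - shr n \<beta> i) * sig n \<mu> i) \<le> C^4 * ?N * R\<^sup>2"
      using sum_bias_le[of n \<beta> \<mu> K] S n \<beta> N C by (auto intro!: order_trans[OF _ mult_left_mono[OF S(2)]])
  qed
  also have "\<dots> \<le> C^4 * ?N * (28 * (?l * R\<^sup>2)) + C^4 * ?N * (?l * R\<^sup>2)"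
  proof (rule add_mono)
    have "?l * 1 \<le> ?l * R\<^sup>2" using R2 l by (intro mult_left_mono) auto
    then have "C^4 * ?N * (28 * ?l) \<le> C^4 * ?N * (28 * (?l * R\<^sup>2))"
      using N C by (intro mult_left_mono) auto
    then show "?N * (28 * (C^4 * ?l)) \<le> C^4 * ?N * (28 * (?l * R\<^sup>2))"
      by (simp add: algebra_simps)
    show "C^4 * ?N * R\<^sup>2 \<le> C^4 * ?N * (?l * R\<^sup>2)"
      using N C l R2 mult_right_mono[OF l, of "R\<^sup>2"] by (intro mult_left_mono) auto
  qed
  finally show ?thesis by (simp add: algebra_simps)
qed

section \<open>Discretization of the parameter and comparison of divergences\<close>

text \<open>Fine enough that moving \<alpha> by one step costs at most a quarter of the divergence,
  coarse enough that a grid on [0, ln n] has only order (ln n)^3 points. The 20000 makes 48 * 26 /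
  20000 at most 1/16, as used in \<open>kl_comparison\<close>.\<close>

definition mesh :: "nat \<Rightarrow> real" where
  "mesh n = 1 / (20000 * C\<^sup>2 * (1 + C\<^sup>2)\<^sup>2 * (ln (real n))\<^sup>2)"

lemma mesh_pos: "1 \<le> ln (real n) \<Longrightarrow> 0 < mesh n"
  unfolding mesh_def using C one_plus_C_pos by (auto intro!: divide_pos_pos mult_pos_pos zero_less_power)

context
  fixes n K :: nat and \<alpha> \<alpha>' :: real
  assumes n: "n \<ge> 3" and l: "1 \<le> ln (real n)" and K: "n \<le> K" "ln (real K) \<le> 24 * ln (real n)"
    and \<alpha>: "0 \<le> \<alpha>" "\<alpha> \<le> \<alpha>'" "\<alpha>' \<le> \<alpha> + mesh n"
begin

lemma mesh_ln_bounds: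
  assumes "i < K"
  shows "0 \<le> 2 * mesh n * ln (real (Suc i))" "2 * mesh n * ln (real (Suc i)) \<le> 48 * mesh n * ln (real n)"
    "48 * mesh n * ln (real n) \<le> 1"
proof -
  show "0 \<le> 2 * mesh n * ln (real (Suc i))" using mesh_pos[OF l] by auto
  have "ln (real (Suc i)) \<le> ln (real K)" using assms by (intro ln_mono) auto
  then have "2 * mesh n * ln (real (Suc i)) \<le> 2 * mesh n * (24 * ln (real n))"
    using K mesh_pos[OF l] by (intro mult_left_mono) auto
  then show "2 * mesh n * ln (real (Suc i)) \<le> 48 * mesh n * ln (real n)" by simp
  have "1 \<le> C\<^sup>2 * (1 + C\<^sup>2)\<^sup>2"
    using mult_mono[of 1 "C\<^sup>2" 1 "(1 + C\<^sup>2)\<^sup>2"] C by (auto intro!: one_le_power)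
  then have "1 * 1 \<le> (C\<^sup>2 * (1 + C\<^sup>2)\<^sup>2) * ln (real n)"
    using l by (intro mult_mono) auto
  then have "48 \<le> 20000 * (C\<^sup>2 * (1 + C\<^sup>2)\<^sup>2 * ln (real n))" by linarith
  then have "48 \<le> 20000 * C\<^sup>2 * (1 + C\<^sup>2)\<^sup>2 * ln (real n)" by (simp only: mult.assoc)
  then show "48 * mesh n * ln (real n) \<le> 1"
    unfolding mesh_def using l C by (simp add: field_simps power2_eq_square[of "ln _"])
qed

text \<open>One mesh step damps the signal-to-noise ratio by a factor of at least exp(-1), hence at
  least 1/3.\<close>

lemma bias_factor_le:
  assumes "i < K"
  shows "1 - shr n \<alpha>' i \<le> 3 * (1 - shr n \<alpha> i)"
proof -
  define v where "v = 2 * mesh n * ln (real (Suc i))"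
  have v: "0 \<le> v" "v \<le> 1" using mesh_ln_bounds[OF assms] by (auto simp: v_def)
  have e: "1 / 3 \<le> exp (- v)" "exp (- v) \<le> 1"
  proof -
    have "exp v \<le> exp 1" using v by simp
    also have "\<dots> \<le> 3" by (rule exp_le)
    finally show "1 / 3 \<le> exp (- v)" by (simp add: exp_minus field_simps)
  qed (use v in auto)
  have "snr n (\<alpha> + mesh n) i = snr n \<alpha> i * exp (- v)" by (simp add: snr_shift v_def)
  then have "snr n \<alpha> i * exp (- v) \<le> snr n \<alpha>' i" using snr_antimono[OF \<alpha>(3), of n i] by simp
  moreover have "snr n \<alpha> i * (1 / 3) \<le> snr n \<alpha> i * exp (- v)"
    using e snr_nonneg by (intro mult_left_mono) auto
  ultimately have "(1 + snr n \<alpha> i) / 3 \<le> 1 + snr n \<alpha>' i" by simp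
  then have "1 / (1 + snr n \<alpha>' i) \<le> 1 / ((1 + snr n \<alpha> i) / 3)"
    using snr_nonneg[of n \<alpha> i] snr_nonneg[of n \<alpha>' i] by (intro divide_left_mono mult_pos_pos) auto
  then show ?thesis by (simp add: one_minus_shr)
qed

text \<open>Since \<open>\<alpha>\<close> and \<open>\<alpha>'\<close> are within one mesh width, monotonicity of both parts of the
  likelihood in the parameter brackets its value at \<open>\<alpha>'\<close> by quantities at \<open>\<alpha>\<close>, so that
  only finitely many noise sums have to be controlled.\<close>

lemma kl_comparison:
  fixes X \<mu> :: "nat \<Rightarrow> real"
  assumes T: "(\<Sum>i<K. lik_term (snr n \<alpha>' i) (X i)) \<le> (\<Sum>i<K. lik_term (snr n \<beta> i) (X i)) + 2"
    and noise: "(\<Sum>i<K. (shr n \<alpha> i - shr n \<beta> i) * ((X i)\<^sup>2 - 1 - sig n \<mu> i))\<^sup>2 \<le> t * (kl n \<mu> K \<alpha> + kl n \<mu> K \<beta>)"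
    and t: "0 \<le> t"
  shows "kl n \<mu> K \<alpha> \<le> 3 * kl n \<mu> K \<beta> + 4 + 2 * t"
proof -
  let ?l = "ln (real n)"
  define Z where "Z i = (X i)\<^sup>2 - 1 - sig n \<mu> i" for i
  define M where "M = (\<Sum>i<K. sig n \<mu> i)"
  define W where "W = (\<Sum>i<K. shr n \<alpha> i)"
  define V where "V = kl n \<mu> K \<alpha> + kl n \<mu> K \<beta>"
  have V: "0 \<le> V" by (simp add: V_def kl_nonneg)
  \<comment> \<open>Splits the likelihood into divergence and centred noise. The total signal
    \<open>M\<close> does not depend on the parameter and cancels in comparisons.\<close>
  have id: "(\<Sum>i<K. ln (1 + snr n a i) - shr n a i * (X i)\<^sup>2) = kl n \<mu> K a - M - (\<Sum>i<K. shr n a i * Z i)" for a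
    unfolding kl_def M_def Z_def sum_subtractf[symmetric] by (intro sum.cong) (auto simp: algebra_simps)
  \<comment> \<open>Total price of a mesh step. The 48 is 2 * 24 from
    \<open>ln (Suc i) \<le> 24 * ln n\<close>; with
    \<open>W \<le> 26 * C\<^sup>2 * ln n * eff n \<alpha>\<close> and the choice of
    \<open>mesh\<close>, a quarter of the lower bound \<open>kl_ge_eff\<close> suffices.\<close>
  have Wb: "48 * mesh n * ?l * W \<le> kl n \<mu> K \<alpha> / 4"
  proof -
    have N: "1 \<le> eff n \<alpha>" using n \<alpha> by (intro eff_ge_1) auto
    have C2: "1 \<le> C\<^sup>2" using C by auto
    have "1 \<le> C\<^sup>2 * ?l" using mult_mono[OF C2 l] by simp
    moreover have "C\<^sup>2 \<le> C\<^sup>2 * ?l" using mult_left_mono[OF l, of "C\<^sup>2"] by simp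
    moreover have "C\<^sup>2 * (1 + ln (real K)) \<le> C\<^sup>2 * (1 + 24 * ?l)" using K by (intro mult_left_mono) auto
    ultimately have "1 + C\<^sup>2 * (1 + ln (real K)) \<le> 26 * (C\<^sup>2 * ?l)" by (simp add: algebra_simps)
    then have "W \<le> eff n \<alpha> * (26 * (C\<^sup>2 * ?l))"
      unfolding W_def
      using order_trans[OF sum_shr_le[of n \<alpha> K] mult_left_mono[of _ _ "eff n \<alpha>"]] n \<alpha> K N by simp
    then have "48 * mesh n * ?l * W \<le> 48 * mesh n * ?l * (eff n \<alpha> * (26 * (C\<^sup>2 * ?l)))"
      using mesh_pos[OF l] l by (intro mult_left_mono) auto
    also have "\<dots> = 1248 / 20000 * eff n \<alpha> / (1 + C\<^sup>2)\<^sup>2"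
      unfolding mesh_def using l C by (simp add: power2_eq_square[of ?l] field_simps)
    also have "\<dots> = 1248 / 20000 * (eff n \<alpha> / (1 + C\<^sup>2)\<^sup>2)" by simp
    also have "\<dots> \<le> 1 / 16 * (eff n \<alpha> / (1 + C\<^sup>2)\<^sup>2)"
      using N by (intro mult_right_mono) auto
    also have "\<dots> = (eff n \<alpha> / (4 * (1 + C\<^sup>2)\<^sup>2)) / 4" by simp
    also have "\<dots> \<le> kl n \<mu> K \<alpha> / 4"
      using kl_ge_eff[of n \<alpha> K \<mu>] n \<alpha> K by (intro divide_right_mono) auto
    finally show ?thesis .
  qed
  have "kl n \<mu> K \<alpha> - M - (\<Sum>i<K. shr n \<alpha> i * Z i) - 48 * mesh n * ?l * W =
     (\<Sum>i<K. ln (1 + snr n \<alpha> i) - shr n \<alpha> i * (X i)\<^sup>2 - 48 * mesh n * ?l * shr n \<alpha> i)"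
    by (simp add: id[symmetric] W_def sum_subtractf sum_distrib_left)
  \<comment> \<open>The logarithm loses at most \<open>shr n \<alpha> i * v\<close>, which the
    subtracted term covers; the quadratic part moves in the favourable direction because
    \<open>shr\<close> decreases in the parameter.\<close>
  also have "\<dots> \<le> (\<Sum>i<K. lik_term (snr n \<alpha>' i) (X i))"
  proof (rule sum_mono)
    fix i assume "i \<in> {..<K}"
    then have i: "i < K" by simp
    define v where "v = 2 * mesh n * ln (real (Suc i))"
    have v: "0 \<le> v" "v \<le> 48 * mesh n * ?l" using mesh_ln_bounds[OF i] by (auto simp: v_def)
    have "ln (1 + snr n \<alpha> i) - shr n \<alpha> i * v \<le> ln (1 + snr n \<alpha> i * exp (- v))"
      unfolding shr_def using snr_nonneg v by (intro ln_one_plus_scaled_ge) auto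
    also have "\<dots> \<le> ln (1 + snr n \<alpha>' i)"
    proof (intro ln_mono)
      have "snr n (\<alpha> + mesh n) i = snr n \<alpha> i * exp (- v)" by (simp add: snr_shift v_def)
      then show "1 + snr n \<alpha> i * exp (- v) \<le> 1 + snr n \<alpha>' i"
        using snr_antimono[OF \<alpha>(3), of n i] by simp
    qed (use snr_nonneg[of n \<alpha> i] snr_nonneg[of n \<alpha>' i] in \<open>auto intro!: add_pos_nonneg\<close>)
    finally have "ln (1 + snr n \<alpha> i) - shr n \<alpha> i * v \<le> ln (1 + snr n \<alpha>' i)" .
    moreover have "shr n \<alpha> i * v \<le> shr n \<alpha> i * (48 * mesh n * ?l)"
      using v shr_bounds by (intro mult_left_mono) auto
    moreover have "shr n \<alpha>' i * (X i)\<^sup>2 \<le> shr n \<alpha> i * (X i)\<^sup>2"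
      using shr_antimono[OF \<alpha>(2)] by (intro mult_right_mono) auto
    moreover have "lik_term (snr n \<alpha>' i) (X i) = ln (1 + snr n \<alpha>' i) - shr n \<alpha>' i * (X i)\<^sup>2"
      by (simp add: lik_term_def shr_def)
    moreover have "shr n \<alpha> i * (48 * mesh n * ?l) = 48 * mesh n * ?l * shr n \<alpha> i" by simp
    ultimately show "ln (1 + snr n \<alpha> i) - shr n \<alpha> i * (X i)\<^sup>2 - 48 * mesh n * ?l * shr n \<alpha> i
        \<le> lik_term (snr n \<alpha>' i) (X i)" by linarith
  qed
  also have "\<dots> \<le> (\<Sum>i<K. lik_term (snr n \<beta> i) (X i)) + 2" by (rule T)
  also have "(\<Sum>i<K. lik_term (snr n \<beta> i) (X i)) = kl n \<mu> K \<beta> - M - (\<Sum>i<K. shr n \<beta> i * Z i)"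
    unfolding id[symmetric] by (simp add: lik_term_def shr_def)
  finally have main: "kl n \<mu> K \<alpha> - 48 * mesh n * ?l * W \<le> kl n \<mu> K \<beta> + 2
      + ((\<Sum>i<K. shr n \<alpha> i * Z i) - (\<Sum>i<K. shr n \<beta> i * Z i))"
    by linarith
  have nz: "(\<Sum>i<K. shr n \<alpha> i * Z i) - (\<Sum>i<K. shr n \<beta> i * Z i) = (\<Sum>i<K. (shr n \<alpha> i - shr n \<beta> i) * Z i)"
    by (simp add: sum_subtractf algebra_simps)
  \<comment> \<open>The inequality sqrt(t * V) \<le> V/4 + t leaves only a quarter of the divergence
    on the right, so that it can be absorbed on the left.\<close>
  have "(\<Sum>i<K. (shr n \<alpha> i - shr n \<beta> i) * Z i) \<le> V / 4 + t"
  proof (rule power2_le_imp_le)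
    have "0 \<le> (V / 4 - t)\<^sup>2" by simp
    then have "t * V \<le> (V / 4 + t)\<^sup>2" by (simp add: power2_eq_square algebra_simps)
    then show "(\<Sum>i<K. (shr n \<alpha> i - shr n \<beta> i) * Z i)\<^sup>2 \<le> (V / 4 + t)\<^sup>2"
      using noise by (simp add: Z_def V_def)
  qed (use V t in auto)
  \<comment> \<open>Both error terms contain a/4; moving them to the left leaves a/2, whence a \<le>
    (5/2) b + 4 + 2 t.\<close>
  moreover have "a \<le> 3 * b + 4 + 2 * t"
    if "a - w \<le> b + 2 + s" "s \<le> (a + b) / 4 + t" "w \<le> a / 4" "0 \<le> b" for a b w s :: real
    using that by (simp add: field_simps)
  ultimately show ?thesis using main Wb kl_nonneg[of n \<mu> K \<beta>] unfolding nz V_def by blast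
qed

end

end

section \<open>Moments under the law of the observations\<close>

lemma nn_integral_le_ennreal:
  assumes "has_bochner_integral M f c" "\<And>x. 0 \<le> f x" "\<And>x. g x \<le> f x"
  shows "(\<integral>\<^sup>+x. ennreal (g x) \<partial>M) \<le> ennreal c"
proof -
  have "(\<integral>\<^sup>+x. ennreal (g x) \<partial>M) \<le> (\<integral>\<^sup>+x. ennreal (f x) \<partial>M)"
    using assms by (intro nn_integral_mono ennreal_leI) auto
  also have "\<dots> = ennreal c"
    using assms by (subst nn_integral_eq_integral) (auto simp: has_bochner_integral_iff)
  finally show ?thesis .
qed

text \<open>Comparison with a telescoping series, by 1/x^2 \<le> 2 (1/x - 1/(x+1)) for x \<ge>
  1.\<close>

lemma suminf_inverse_squares_le:
  assumes "k0 \<ge> 1" "0 \<le> c"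
  shows "(\<Sum>k. ennreal (c / (real (k + k0))\<^sup>2)) \<le> ennreal (2 * c / real k0)"
proof -
  let ?f = "\<lambda>k. 2 * c * (1 / real (k + k0) - 1 / real (Suc k + k0))"
  have "(\<lambda>k. 1 / real (k + k0)) \<longlonglongrightarrow> 0"
    using lim_1_over_n[THEN LIMSEQ_ignore_initial_segment, of k0] by simp
  then have "(\<lambda>k. 1 / real (k + k0) - 1 / real (Suc k + k0)) sums (1 / real (0 + k0) - 0)"
    by (rule telescope_sums')
  from sums_mult[OF this, of "2 * c"] have f: "?f sums (2 * c * (1 / real k0))" by simp
  have le: "c / (real (k + k0))\<^sup>2 \<le> ?f k" for k
  proof -
    define x where "x = real (k + k0)"
    have x: "x \<ge> 1" using assms by (simp add: x_def)
    have "1 / x\<^sup>2 \<le> 2 * (1 / x - 1 / (x + 1))"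
      using x by (simp add: divide_simps power2_eq_square)
    then have "c * (1 / x\<^sup>2) \<le> c * (2 * (1 / x - 1 / (x + 1)))" using assms by (intro mult_left_mono)
    then show ?thesis by (simp add: x_def add_ac right_diff_distrib mult.commute)
  qed
  have nn: "0 \<le> ?f k" for k
    by (rule order_trans[OF _ le]) (use assms in simp)
  have "(\<Sum>k. ennreal (c / (real (k + k0))\<^sup>2)) \<le> (\<Sum>k. ennreal (?f k))"
    using le by (intro suminf_le summableI ennreal_leI) auto
  also have "\<dots> = ennreal (2 * c * (1 / real k0))"
    using suminf_ennreal2[OF nn] f by (simp add: sums_iff)
  finally show ?thesis by simp
qed

lemma power2_sum_le: "(x + y)\<^sup>2 \<le> 2 * x\<^sup>2 + 2 * (y::real)\<^sup>2"
  using zero_le_power2[of "x - y"] by (simp add: power2_eq_square algebra_simps)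

text \<open>Markov's inequality for the squared distance, written as the extended series
  \<open>u\<close>: it is infinite where the distance is, and its mean is computed coordinate by
  coordinate.\<close>

lemma posterior_Markov:
  assumes pv: "\<And>i. 0 < post_var \<kappa> n \<alpha> i" and r: "0 < r"
  shows "ennreal (measure (posterior \<kappa> n \<alpha> Y) {\<mu> \<in> space (posterior \<kappa> n \<alpha> Y). ennreal r \<le> l2norm (\<lambda>i. \<mu> i - \<mu>0 i)})
    \<le> ennreal (1 / r\<^sup>2) * (\<Sum>i. ennreal (post_var \<kappa> n \<alpha> i + (post_mean \<kappa> n \<alpha> Y i - \<mu>0 i)\<^sup>2))"
proof -
  let ?P = "posterior \<kappa> n \<alpha> Y"
  let ?M = "\<lambda>i. density lborel (normal_density (post_mean \<kappa> n \<alpha> Y i) (sqrt (post_var \<kappa> n \<alpha> i)))"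
  have M: "prob_space (?M i)" for i
    using pv by (intro prob_space_normal_density) auto
  interpret prob_space ?P unfolding posterior_def by (intro prob_space_PiM M)
  have [measurable]: "(\<lambda>\<mu>. \<mu> i) \<in> borel_measurable ?P" for i
    using measurable_component_singleton[of i UNIV ?M] by (simp add: posterior_def)
  define u where "u \<mu> = (\<Sum>i. ennreal ((\<mu> i - \<mu>0 i)\<^sup>2))" for \<mu>
  have [measurable]: "u \<in> borel_measurable ?P" unfolding u_def by measurable
  \<comment> \<open>Only the larger set is shown to be measurable; that is enough for monotonicity
    of the measure.\<close>
  have sub: "{\<mu> \<in> space ?P. ennreal r \<le> l2norm (\<lambda>i. \<mu> i - \<mu>0 i)} \<subseteq> {\<mu> \<in> space ?P. 1 \<le> ennreal (1 / r\<^sup>2) * u \<mu>}"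
  proof safe
    fix \<mu> assume h: "ennreal r \<le> l2norm (\<lambda>i. \<mu> i - \<mu>0 i)"
    have "ennreal (r\<^sup>2) \<le> u \<mu>"
    proof (cases "summable (\<lambda>i. (\<mu> i - \<mu>0 i)\<^sup>2)")
      case True
      then have "r \<le> sqrt (\<Sum>i. (\<mu> i - \<mu>0 i)\<^sup>2)"
        using h r by (simp add: l2norm_def suminf_nonneg)
      then have "r\<^sup>2 \<le> (\<Sum>i. (\<mu> i - \<mu>0 i)\<^sup>2)"
        using r True by (simp add: sqrt_ge_absD)
      then show ?thesis unfolding u_def using True by (subst suminf_ennreal2) (auto intro: ennreal_leI)
    next
      case False
      have "u \<mu> = \<top>"
      proof (rule ccontr)
        assume "u \<mu> \<noteq> \<top>"
        then have "summable (\<lambda>i. (\<mu> i - \<mu>0 i)\<^sup>2)"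
          unfolding u_def by (intro summable_suminf_not_top) auto
        then show False using False by simp
      qed
      then show ?thesis by simp
    qed
    then have "ennreal (1 / r\<^sup>2) * ennreal (r\<^sup>2) \<le> ennreal (1 / r\<^sup>2) * u \<mu>" by (intro mult_left_mono) auto
    then show "1 \<le> ennreal (1 / r\<^sup>2) * u \<mu>" using r by (simp add: ennreal_mult[symmetric])
  qed
  have "ennreal (measure ?P {\<mu> \<in> space ?P. ennreal r \<le> l2norm (\<lambda>i. \<mu> i - \<mu>0 i)}) \<le>
      emeasure ?P {\<mu> \<in> space ?P. 1 \<le> ennreal (1 / r\<^sup>2) * u \<mu>}"
    unfolding emeasure_eq_measure[symmetric]
  proof (rule emeasure_mono[OF sub])
    have "(\<lambda>\<mu>. ennreal (1 / r\<^sup>2) * u \<mu>) \<in> borel_measurable ?P" by measurable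
    then show "{\<mu> \<in> space ?P. 1 \<le> ennreal (1 / r\<^sup>2) * u \<mu>} \<in> sets ?P"
      by (intro borel_measurable_le borel_measurable_const)
  qed
  also have "\<dots> \<le> ennreal (1 / r\<^sup>2) * (\<integral>\<^sup>+\<mu>. u \<mu> * indicator (space ?P) \<mu> \<partial>?P)"
    using nn_integral_Markov_inequality[of u "space ?P" ?P "ennreal (1 / r\<^sup>2)"] by simp
  also have "(\<integral>\<^sup>+\<mu>. u \<mu> * indicator (space ?P) \<mu> \<partial>?P) = (\<integral>\<^sup>+\<mu>. u \<mu> \<partial>?P)"
    by (intro nn_integral_cong) auto
  also have "\<dots> = (\<Sum>i. \<integral>\<^sup>+\<mu>. ennreal ((\<mu> i - \<mu>0 i)\<^sup>2) \<partial>?P)"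
    unfolding u_def by (intro nn_integral_suminf) measurable
  also have "(\<lambda>i. \<integral>\<^sup>+\<mu>. ennreal ((\<mu> i - \<mu>0 i)\<^sup>2) \<partial>?P) =
     (\<lambda>i. ennreal (post_var \<kappa> n \<alpha> i + (post_mean \<kappa> n \<alpha> Y i - \<mu>0 i)\<^sup>2))"
  proof
    fix i
    have "(\<integral>\<^sup>+\<mu>. ennreal ((\<mu> i - \<mu>0 i)\<^sup>2) \<partial>?P) = (\<integral>\<^sup>+x. ennreal ((x - \<mu>0 i)\<^sup>2) \<partial>?M i)"
      unfolding posterior_def using nn_integral_PiM_component[of ?M "\<lambda>x. ennreal ((x - \<mu>0 i)\<^sup>2)" i] M by simp
    also have "\<dots> = ennreal (post_var \<kappa> n \<alpha> i + (post_mean \<kappa> n \<alpha> Y i - \<mu>0 i)\<^sup>2)"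
      using normal_measure_second_moment[of "sqrt (post_var \<kappa> n \<alpha> i)" "post_mean \<kappa> n \<alpha> Y i" "\<mu>0 i"] pv[of i]
      by (subst nn_integral_eq_integral) (auto simp: has_bochner_integral_iff)
    finally show "(\<integral>\<^sup>+\<mu>. ennreal ((\<mu> i - \<mu>0 i)\<^sup>2) \<partial>?P) =
      ennreal (post_var \<kappa> n \<alpha> i + (post_mean \<kappa> n \<alpha> Y i - \<mu>0 i)\<^sup>2)" .
  qed
  finally show ?thesis .
qed

section \<open>Likelihood, posterior and noise expressed through the shrinkage weights\<close>

context mildly_ill_posed
begin

lemma prior_precision_pos: "0 < real (Suc i) powr (1 + 2*\<alpha>) * (\<kappa> i) powi (-2)"
  using kappa_pos[of i] by (intro mult_pos_pos zero_less_power_int) auto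

lemma shr_eq: "n \<ge> 1 \<Longrightarrow> shr n \<alpha> i = real n / (real (Suc i) powr (1 + 2*\<alpha>) * (\<kappa> i) powi (-2) + real n)"
  unfolding shr_def snr_eq[symmetric] using prior_precision_pos[of i \<alpha>] kappa_pos[of i] by (simp add: field_simps)

lemma post_var_eq: "n \<ge> 1 \<Longrightarrow> post_var \<kappa> n \<alpha> i = shr n \<alpha> i / (\<kappa> i)\<^sup>2 / real n"
  by (simp add: post_var_def shr_eq kappa_powi)

lemma post_mean_eq: "n \<ge> 1 \<Longrightarrow> post_mean \<kappa> n \<alpha> Y i = shr n \<alpha> i / \<kappa> i * Y i"
  by (simp add: post_mean_def shr_eq divide_inverse)

lemma post_var_pos: "n \<ge> 1 \<Longrightarrow> 0 < post_var \<kappa> n \<alpha> i"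
  unfolding post_var_def using prior_precision_pos[of i \<alpha>] kappa_pos[of i]
  by (intro divide_pos_pos add_pos_nonneg zero_less_power_int) auto

lemma loglik_eq:
  assumes "n \<ge> 1"
  shows "loglik \<kappa> n \<alpha> Y = - 1/2 * (\<Sum>i. lik_term (snr n \<alpha> i) (sqrt (real n) * Y i))"
proof -
  have "(real n)\<^sup>2 / (real (Suc i) powr (1 + 2*\<alpha>) * (\<kappa> i) powi (-2) + real n) = real n * shr n \<alpha> i" for i
    using assms by (simp add: shr_eq power2_eq_square)
  then show ?thesis
    unfolding loglik_def lik_term_def snr_eq by (simp add: shr_def power_mult_distrib algebra_simps)
qed

context
  fixes n :: nat and \<mu> :: "nat \<Rightarrow> real"
  assumes n: "n \<ge> 1"
begin

lemma prob_space_obs: "prob_space (density lborel (normal_density (\<kappa> i * \<mu> i) (1 / sqrt (real n))))"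
  using n by (intro prob_space_normal_density) auto

lemma prob_space_obs_law: "prob_space (obs_law \<kappa> n \<mu>)"
  unfolding obs_law_def by (intro prob_space_PiM prob_space_obs)

lemma measurable_obs_law [measurable]: "(\<lambda>Y. Y i) \<in> borel_measurable (obs_law \<kappa> n \<mu>)"
  using measurable_component_singleton[of i UNIV "\<lambda>i. density lborel (normal_density (\<kappa> i * \<mu> i) (1 / sqrt (real n)))"]
  by (simp add: obs_law_def)

lemma centered_square_obs:
  "has_bochner_integral (density lborel (normal_density (\<kappa> i * \<mu> i) (1 / sqrt (real n)))) (\<lambda>x. real n * x\<^sup>2 - 1 - sig n \<mu> i) 0"
  "has_bochner_integral (density lborel (normal_density (\<kappa> i * \<mu> i) (1 / sqrt (real n)))) (\<lambda>x. (real n * x\<^sup>2 - 1 - sig n \<mu> i)\<^sup>2) (2 + 4 * sig n \<mu> i)"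
  unfolding sig_def
  using normal_measure_centered_square[of "real n" "\<kappa> i * \<mu> i"]
    normal_measure_centered_square_variance[of "real n" "\<kappa> i * \<mu> i"] n by (auto simp: mult.assoc)

lemma centered_square_obs_law:
  "has_bochner_integral (obs_law \<kappa> n \<mu>) (\<lambda>Y. (real n * (Y i)\<^sup>2 - 1 - sig n \<mu> i)\<^sup>2) (2 + 4 * sig n \<mu> i)"
  unfolding obs_law_def
  using has_bochner_integral_PiM_component[where M="\<lambda>i. density lborel (normal_density (\<kappa> i * \<mu> i) (1 / sqrt (real n)))" and i=i, OF _ centered_square_obs(2)] prob_space_obs
  by simp

lemma weighted_noise_second_moment:
  assumes "finite I"
  shows "has_bochner_integral (obs_law \<kappa> n \<mu>)
     (\<lambda>Y. (\<Sum>i\<in>I. c i * (real n * (Y i)\<^sup>2 - 1 - sig n \<mu> i))\<^sup>2) (\<Sum>i\<in>I. (c i)\<^sup>2 * (2 + 4 * sig n \<mu> i))"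
  unfolding obs_law_def
  using integral_PiM_sum_coordinates_square[OF prob_space_obs assms centered_square_obs] by simp

lemma noise_square_obs_law:
  "has_bochner_integral (obs_law \<kappa> n \<mu>) (\<lambda>Y. (Y i - \<kappa> i * \<mu> i)\<^sup>2) (1 / real n)"
  unfolding obs_law_def
  using has_bochner_integral_PiM_component[where M="\<lambda>i. density lborel (normal_density (\<kappa> i * \<mu> i) (1 / sqrt (real n)))" and i=i, OF _
      normal_measure_second_moment[of "1 / sqrt (real n)" "\<kappa> i * \<mu> i" "\<kappa> i * \<mu> i"]] prob_space_obs n
  by (simp add: power_divide)

text \<open>With x, y the two shrinkage weights, (x - y)^2 has two bounds. The bound x^2 + y^2
  serves the constant part of the chi-square variance, through
  \<open>ln_one_plus_minus_ratio_ge\<close>; the bound (1 - x) + (1 - y) serves the part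
  proportional to the signal, which thus becomes the bias part of \<open>kl\<close>.\<close>

lemma noise_bound:
  shows "(\<integral>\<^sup>+Y. ennreal ((\<Sum>i<K. (shr n \<alpha> i - shr n \<beta> i) * (real n * (Y i)\<^sup>2 - 1 - sig n \<mu> i))\<^sup>2) \<partial>obs_law \<kappa> n \<mu>)
    \<le> ennreal (4 * (kl n \<mu> K \<alpha> + kl n \<mu> K \<beta>))"
proof -
  have t: "(shr n \<alpha> i - shr n \<beta> i)\<^sup>2 * (2 + 4 * sig n \<mu> i) \<le>
     4 * ((ln (1 + snr n \<alpha> i) - shr n \<alpha> i + (1 - shr n \<alpha> i) * sig n \<mu> i) +
          (ln (1 + snr n \<beta> i) - shr n \<beta> i + (1 - shr n \<beta> i) * sig n \<mu> i))" for i
  proof -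
    define x y where "x = shr n \<alpha> i" and "y = shr n \<beta> i"
    have xy: "0 \<le> x" "x \<le> 1" "0 \<le> y" "y \<le> 1" using shr_bounds by (auto simp: x_def y_def)
    have 1: "(x - y)\<^sup>2 \<le> x\<^sup>2 + y\<^sup>2" using xy by (simp add: power2_diff)
    have "(x - y)\<^sup>2 = ((1 - x) - (1 - y))\<^sup>2" by (simp add: power2_commute)
    also have "\<dots> \<le> (1 - x)\<^sup>2 + (1 - y)\<^sup>2" using xy unfolding power2_diff[of "1 - x" "1 - y"] by simp
    also have "\<dots> \<le> (1 - x) + (1 - y)"
      using xy by (intro add_mono) (auto simp: power2_eq_square intro!: mult_left_le)
    finally have 2: "(x - y)\<^sup>2 * sig n \<mu> i \<le> ((1 - x) + (1 - y)) * sig n \<mu> i"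
      using sig_nonneg by (intro mult_right_mono) auto
    have "(x - y)\<^sup>2 * (2 + 4 * sig n \<mu> i) = 2 * (x - y)\<^sup>2 + 4 * ((x - y)\<^sup>2 * sig n \<mu> i)"
      by (simp add: algebra_simps)
    also have "\<dots> \<le> 2 * (x\<^sup>2 + y\<^sup>2) + 4 * ((1 - x) * sig n \<mu> i + (1 - y) * sig n \<mu> i)"
      using 1 2 by (simp add: algebra_simps)
    also have "\<dots> \<le> 4 * ((ln (1 + snr n \<alpha> i) - x + (1 - x) * sig n \<mu> i) + (ln (1 + snr n \<beta> i) - y + (1 - y) * sig n \<mu> i))"
      using kl_term_nonneg(1)[of n \<alpha> i] kl_term_nonneg(1)[of n \<beta> i] unfolding x_def[symmetric] y_def[symmetric]
      by (simp add: algebra_simps)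
    finally show ?thesis by (simp add: x_def y_def)
  qed
  have "(\<integral>\<^sup>+Y. ennreal ((\<Sum>i<K. (shr n \<alpha> i - shr n \<beta> i) * (real n * (Y i)\<^sup>2 - 1 - sig n \<mu> i))\<^sup>2) \<partial>obs_law \<kappa> n \<mu>)
    \<le> ennreal (\<Sum>i<K. (shr n \<alpha> i - shr n \<beta> i)\<^sup>2 * (2 + 4 * sig n \<mu> i))"
    by (rule nn_integral_le_ennreal[OF weighted_noise_second_moment]) auto
  also have "\<dots> \<le> ennreal (4 * (kl n \<mu> K \<alpha> + kl n \<mu> K \<beta>))"
    unfolding kl_def sum.distrib[symmetric] sum_distrib_left
    by (intro ennreal_leI sum_mono t)
  finally show ?thesis .
qed

text \<open>On the block, \<open>amp\<close> is at most \<open>C\<^sup>2 / k^3\<close> and there are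
  at most \<open>7 * k\<^sup>2\<close> indices; each weighted sum of squares is then of order k^2 *
  k^2 * k^-6. The signal enters only through the bound \<open>S\<close> on its total.\<close>

lemma block_bound_expectation:
  assumes k: "k \<ge> 1" and S: "\<And>I. finite I \<Longrightarrow> (\<Sum>i\<in>I. sig n \<mu> i) \<le> S"
  shows "(\<integral>\<^sup>+Y. ennreal (block_bound amp (\<lambda>i. sqrt (real n) * Y i) k) \<partial>obs_law \<kappa> n \<mu>)
    \<le> ennreal (400 * C^4 * (1 + S)\<^sup>2 / (real k)\<^sup>2)"
proof -
  define I where "I = {k^3..<(Suc k)^3}"
  define \<zeta> where "\<zeta> Y i = real n * (Y i)\<^sup>2 - 1 - sig n \<mu> i" for Y i
  \<comment> \<open>A majorant in which (a + b)^2 \<le> 2 a^2 + 2 b^2 separates the centred noise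
    from the signal; \<open>E\<close> is its mean.\<close>
  define G where "G Y = (real k)\<^sup>2 * (2 * (\<Sum>i\<in>I. amp i * \<zeta> Y i)\<^sup>2 + 2 * (\<Sum>i\<in>I. amp i * sig n \<mu> i)\<^sup>2)
      + 1 / (real k)\<^sup>2 + 7 * (real k)\<^sup>2 * (\<Sum>i\<in>I. (amp i)\<^sup>2 * (3 + (2 * (\<zeta> Y i)\<^sup>2 + 2 * (sig n \<mu> i)\<^sup>2)))" for Y
  define E where "E = (real k)\<^sup>2 * (2 * (\<Sum>i\<in>I. (amp i)\<^sup>2 * (2 + 4 * sig n \<mu> i)) + 2 * (\<Sum>i\<in>I. amp i * sig n \<mu> i)\<^sup>2)
      + 1 / (real k)\<^sup>2 + 7 * (real k)\<^sup>2 * (\<Sum>i\<in>I. (amp i)\<^sup>2 * (3 + (2 * (2 + 4 * sig n \<mu> i) + 2 * (sig n \<mu> i)\<^sup>2)))"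
  interpret prob_space "obs_law \<kappa> n \<mu>" by (rule prob_space_obs_law)
  have const: "has_bochner_integral (obs_law \<kappa> n \<mu>) (\<lambda>Y. c) c" for c :: real
    by (simp add: has_bochner_integral_iff prob_space)
  have GE: "has_bochner_integral (obs_law \<kappa> n \<mu>) G E"
    unfolding G_def E_def \<zeta>_def
    by (intro has_bochner_integral_add has_bochner_integral_mult_right has_bochner_integral_sum
        weighted_noise_second_moment centered_square_obs_law const) (simp add: I_def)
  have le: "block_bound amp (\<lambda>i. sqrt (real n) * Y i) k \<le> G Y" for Y
  proof -
    have u: "(sqrt (real n) * Y i)\<^sup>2 - 1 = \<zeta> Y i + sig n \<mu> i" for i
      by (simp add: \<zeta>_def power_mult_distrib)
    have "(\<Sum>i\<in>I. amp i * (\<zeta> Y i + sig n \<mu> i)) = (\<Sum>i\<in>I. amp i * \<zeta> Y i) + (\<Sum>i\<in>I. amp i * sig n \<mu> i)"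
      by (simp add: algebra_simps sum.distrib)
    then have "(\<Sum>i\<in>I. amp i * (\<zeta> Y i + sig n \<mu> i))\<^sup>2 \<le> 2 * (\<Sum>i\<in>I. amp i * \<zeta> Y i)\<^sup>2 + 2 * (\<Sum>i\<in>I. amp i * sig n \<mu> i)\<^sup>2"
      using power2_sum_le by simp
    then show ?thesis
      unfolding block_bound_def G_def u I_def[symmetric]
      by (intro add_mono mult_left_mono sum_mono power2_sum_le order_refl) auto
  qed
  have "E \<le> 400 * C^4 * (1 + S)\<^sup>2 / (real k)\<^sup>2"
  proof -
    define x where "x = real k"
    have x: "1 \<le> x" using k by (simp add: x_def)
    have S0: "0 \<le> S" using S[of "{}"] by simp
    have sS: "sig n \<mu> i \<le> S" for i using S[of "{i}"] by simp
    have a: "amp i \<le> C\<^sup>2 / x^3" if "i \<in> I" for i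
    proof -
      have "k^3 \<le> Suc i" using that by (auto simp: I_def)
      then have "real (k^3) \<le> real (Suc i)" by (rule of_nat_mono)
      then have "x^3 \<le> real (Suc i)" by (simp add: x_def)
      then have "C\<^sup>2 / real (Suc i) \<le> C\<^sup>2 / x^3" using x by (intro divide_left_mono) auto
      then show ?thesis using amp_le[of i] by linarith
    qed
    have a2: "(amp i)\<^sup>2 \<le> C^4 / x^6" if "i \<in> I" for i
    proof -
      have "(amp i)\<^sup>2 \<le> (C\<^sup>2 / x^3)\<^sup>2" using a[OF that] amp_pos[of i] by (intro power_mono) auto
      then show ?thesis by (simp add: power_divide flip: power_mult)
    qed
    have card: "real (card I) \<le> 7 * x\<^sup>2"
      unfolding I_def x_def using cube_gap_le[OF k] by simp
    have sumb: "(\<Sum>i\<in>I. (amp i)\<^sup>2 * f i) \<le> 7 * x\<^sup>2 * (C^4 / x^6 * b)" if "\<And>i. 0 \<le> f i" "\<And>i. f i \<le> b" for f b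
    proof -
      have b: "0 \<le> b" using that(1,2)[of 0] by linarith
      have "(\<Sum>i\<in>I. (amp i)\<^sup>2 * f i) \<le> (\<Sum>i\<in>I. C^4 / x^6 * b)"
        using that a2 x C by (intro sum_mono mult_mono) auto
      also have "\<dots> = real (card I) * (C^4 / x^6 * b)" by simp
      also have "\<dots> \<le> 7 * x\<^sup>2 * (C^4 / x^6 * b)"
        using card x C b by (intro mult_right_mono) auto
      finally show ?thesis .
    qed
    have s1: "(\<Sum>i\<in>I. (amp i)\<^sup>2 * (2 + 4 * sig n \<mu> i)) \<le> 7 * x\<^sup>2 * (C^4 / x^6 * (2 + 4 * S))"
      using sS sig_nonneg by (intro sumb) auto
    have s2: "(\<Sum>i\<in>I. (amp i)\<^sup>2 * (3 + (2 * (2 + 4 * sig n \<mu> i) + 2 * (sig n \<mu> i)\<^sup>2)))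
       \<le> 7 * x\<^sup>2 * (C^4 / x^6 * (3 + (2 * (2 + 4 * S) + 2 * S\<^sup>2)))"
      using sS sig_nonneg by (intro sumb add_mono mult_left_mono power_mono) auto
    have "(\<Sum>i\<in>I. amp i * sig n \<mu> i) \<le> (\<Sum>i\<in>I. C\<^sup>2 / x^3 * sig n \<mu> i)"
      using a sig_nonneg by (intro sum_mono mult_right_mono) auto
    also have "\<dots> \<le> C\<^sup>2 / x^3 * S"
      unfolding sum_distrib_left[symmetric] using S[of I] x by (intro mult_left_mono) (auto simp: I_def)
    finally have "(\<Sum>i\<in>I. amp i * sig n \<mu> i)\<^sup>2 \<le> (C\<^sup>2 / x^3 * S)\<^sup>2"
      using amp_pos sig_nonneg by (intro power_mono sum_nonneg mult_nonneg_nonneg) (auto intro: less_imp_le)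
    also have "\<dots> = C^4 / x^6 * S\<^sup>2" by (simp add: power_mult_distrib power_divide flip: power_mult)
    finally have s3: "(\<Sum>i\<in>I. amp i * sig n \<mu> i)\<^sup>2 \<le> C^4 / x^6 * S\<^sup>2" .
    have "E \<le> x\<^sup>2 * (2 * (7 * x\<^sup>2 * (C^4 / x^6 * (2 + 4 * S))) + 2 * (C^4 / x^6 * S\<^sup>2)) + 1 / x\<^sup>2
       + 7 * x\<^sup>2 * (7 * x\<^sup>2 * (C^4 / x^6 * (3 + (2 * (2 + 4 * S) + 2 * S\<^sup>2))))"
      unfolding E_def x_def[symmetric] using s1 s2 s3 by (intro add_mono mult_left_mono) auto
    also have "\<dots> = (14 * C^4 * (2 + 4 * S)) / x\<^sup>2 + (2 * C^4 * S\<^sup>2) / x^4 + 1 / x\<^sup>2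
       + 49 * C^4 * (7 + 8 * S + 2 * S\<^sup>2) / x\<^sup>2"
      using x by (simp add: field_simps eval_nat_numeral)
    also have "\<dots> \<le> (14 * C^4 * (2 + 4 * S)) / x\<^sup>2 + (2 * C^4 * S\<^sup>2) / x\<^sup>2 + C^4 / x\<^sup>2
       + 49 * C^4 * (7 + 8 * S + 2 * S\<^sup>2) / x\<^sup>2"
      using x C power_increasing[of 2 4 x]
      by (intro add_mono divide_right_mono divide_left_mono order_refl) auto
    also have "\<dots> = C^4 * (372 + 448 * S + 100 * S\<^sup>2) / x\<^sup>2"
      by (simp add: algebra_simps flip: add_divide_distrib)
    also have "\<dots> \<le> C^4 * (400 * (1 + S)\<^sup>2) / x\<^sup>2"
      using C S0 by (intro divide_right_mono mult_left_mono) (auto simp: power2_sum power2_eq_square algebra_simps)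
    finally show ?thesis by (simp add: x_def mult_ac)
  qed
  moreover have "(\<integral>\<^sup>+Y. ennreal (block_bound amp (\<lambda>i. sqrt (real n) * Y i) k) \<partial>obs_law \<kappa> n \<mu>) \<le> ennreal E"
    by (rule nn_integral_le_ennreal[OF GE _ le]) (auto intro: order_trans[OF block_bound_nonneg le])
  ultimately show ?thesis by (meson ennreal_leI order_trans)
qed

lemma block_series_expectation:
  assumes k0: "k0 \<ge> 1" and S: "\<And>I. finite I \<Longrightarrow> (\<Sum>i\<in>I. sig n \<mu> i) \<le> S"
  shows "(\<integral>\<^sup>+Y. (\<Sum>k. ennreal (block_bound amp (\<lambda>i. sqrt (real n) * Y i) (k + k0))) \<partial>obs_law \<kappa> n \<mu>)
    \<le> ennreal (800 * C^4 * (1 + S)\<^sup>2 / real k0)"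
proof -
  have "(\<integral>\<^sup>+Y. (\<Sum>k. ennreal (block_bound amp (\<lambda>i. sqrt (real n) * Y i) (k + k0))) \<partial>obs_law \<kappa> n \<mu>)
    = (\<Sum>k. \<integral>\<^sup>+Y. ennreal (block_bound amp (\<lambda>i. sqrt (real n) * Y i) (k + k0)) \<partial>obs_law \<kappa> n \<mu>)"
    unfolding block_bound_def by (intro nn_integral_suminf) measurable
  also have "\<dots> \<le> (\<Sum>k. ennreal (400 * C^4 * (1 + S)\<^sup>2 / (real (k + k0))\<^sup>2))"
    using k0 S by (intro suminf_le summableI block_bound_expectation) auto
  also have "\<dots> \<le> ennreal (2 * (400 * C^4 * (1 + S)\<^sup>2) / real k0)"
    using k0 C by (intro suminf_inverse_squares_le) auto
  finally show ?thesis by (simp add: mult.assoc)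
qed

end

end

section \<open>Posterior second moments\<close>

text \<open>The right-hand side is the integral of t^(-1-a) over [y - 1, y]. With u = 1 - 1/y the
  claim reduces to 1 + a/y \<le> 1 - a ln u \<le> u^(-a).\<close>

lemma powr_minus_le_diff:
  assumes "1 < y" "0 < a"
  shows "y powr (-1 - a) \<le> ((y - 1) powr (-a) - y powr (-a)) / (a::real)"
proof -
  define u where "u = 1 - 1 / y"
  have u: "0 < u" using assms by (simp add: u_def)
  have "1 + a / y \<le> 1 - a * ln u"
    using ln_le_minus_one[OF u] mult_left_mono[of "1 / y" "- ln u" a] assms by (simp add: u_def)
  also have "\<dots> \<le> exp (- a * ln u)" using exp_ge_add_one_self[of "- a * ln u"] by simp
  also have "\<dots> = u powr (-a)" using u by (simp add: powr_def)
  finally have "y powr (-a) * (1 + a / y) \<le> y powr (-a) * u powr (-a)"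
    by (intro mult_left_mono) auto
  also have "\<dots> = (y * u) powr (-a)" using assms u by (simp add: powr_mult)
  also have "y * u = y - 1" using assms by (simp add: u_def field_simps)
  finally have "y powr (-a) + a * (y powr (-a) / y) \<le> (y - 1) powr (-a)" by (simp add: algebra_simps)
  moreover have "y powr (-1 - a) = y powr (-a) / y"
    using assms by (simp add: powr_diff powr_minus field_simps)
  ultimately have "a * y powr (-1 - a) \<le> (y - 1) powr (-a) - y powr (-a)" by simp
  then show ?thesis using assms by (simp add: pos_le_divide_eq mult.commute)
qed

lemma sum_powr_tail_le:
  assumes N: "1 \<le> N" and a: "0 < a"
  shows "(\<Sum>i<m. if N < real (Suc i) then real (Suc i) powr (-1 - a) else 0) \<le> N powr (-a) * (1 + 1 / a)"
proof -
  \<comment> \<open>The antiderivative, frozen below \<open>N\<close>, so that the telescoping sum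
    starts there. The interval from \<open>i1\<close> to \<open>i1 + 1\<close> straddles
    \<open>N\<close>; its term is charged separately with \<open>N powr (-a)\<close>.\<close>
  define H where "H y = max N y powr (-a) / a" for y
  define i1 where "i1 = nat \<lfloor>N\<rfloor>"
  have mono: "H (real (Suc i)) \<le> H (real i)" for i
    unfolding H_def using N a by (intro divide_right_mono powr_mono2') auto
  have "(if N < real (Suc i) then real (Suc i) powr (-1 - a) else 0) \<le>
      (H (real i) - H (real (Suc i))) + (if i = i1 then N powr (-a) else 0)" for i
  proof (cases "N < real (Suc i)")
    case True
    show ?thesis
    proof (cases "N \<le> real i")
      case True
      then have y: "1 < real (Suc i)" using N by simp
      have "real (Suc i) powr (-1 - a) \<le> (real i powr (-a) - real (Suc i) powr (-a)) / a"
        using powr_minus_le_diff[OF y a] by simp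
      also have "\<dots> = H (real i) - H (real (Suc i))"
        using True by (simp add: H_def max_def diff_divide_distrib)
      finally show ?thesis using \<open>N < real (Suc i)\<close> powr_ge_zero[of N "-a"] by (auto simp del: powr_ge_zero)
    next
      case False
      then have "\<lfloor>N\<rfloor> = int i" using True by (intro floor_unique) auto
      then have "i = i1" by (simp add: i1_def)
      moreover have "real (Suc i) powr (-1 - a) \<le> N powr (-a)"
      proof -
        have "real (Suc i) powr (-1 - a) \<le> real (Suc i) powr (-a)" using a by (intro powr_mono) auto
        also have "\<dots> \<le> N powr (-a)" using True N a by (intro powr_mono2') auto
        finally show ?thesis .
      qed
      ultimately show ?thesis using mono[of i] True by auto
    qed
  next
    case False
    then show ?thesis using mono[of i] by auto
  qed
  then have "(\<Sum>i<m. if N < real (Suc i) then real (Suc i) powr (-1 - a) else 0) \<le>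
     (\<Sum>i<m. (H (real i) - H (real (Suc i))) + (if i = i1 then N powr (-a) else 0))"
    by (intro sum_mono)
  also have "\<dots> = (H (real 0) - H (real m)) + (\<Sum>i<m. if i = i1 then N powr (-a) else 0)"
    unfolding sum.distrib by (subst sum_lessThan_telescope') simp
  also have "\<dots> \<le> H (real 0) + N powr (-a)"
    using a by (intro add_mono) (auto simp: H_def)
  also have "\<dots> = N powr (-a) * (1 + 1 / a)" using N by (simp add: H_def algebra_simps max_def)
  finally show ?thesis .
qed

text \<open>The Bochner integral of a nonintegrable function is 0, so an upper bound through the
  nonnegative integral holds in either case. It spares a proof that the risk integrand is
  measurable.\<close>

lemma integral_le_nn_integral:
  fixes f :: "'a \<Rightarrow> real"
  assumes "\<And>x. 0 \<le> f x" "(\<integral>\<^sup>+x. ennreal (f x) \<partial>M) \<le> ennreal c" "0 \<le> c"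
  shows "integral\<^sup>L M f \<le> c"
proof (cases "integrable M f")
  case True
  then have "ennreal (integral\<^sup>L M f) \<le> ennreal c"
    using assms by (subst nn_integral_eq_integral[symmetric]) auto
  then show ?thesis using assms(3) by simp
qed (use assms(3) in \<open>simp add: not_integrable_integral_eq\<close>)

context mildly_ill_posed
begin

text \<open>On the event described by \<open>Q\<close> the likelihood is continuous on [0, ln n] and
  attains its maximum, so the selector must be a maximizer. Its value is compared with that at
  \<beta>, truncation costing at most 1 at each of the two parameters, and
  \<open>kl_comparison\<close> applies at the grid point just below it.\<close>

lemma selector_kl:
  fixes ah :: "nat \<Rightarrow> (nat \<Rightarrow> real) \<Rightarrow> real" and n k0 K :: nat
  assumes eb: "eb_selector \<kappa> ah" and n: "n \<ge> 3" and l: "1 \<le> ln (real n)"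
    and \<beta>: "0 \<le> \<beta>" "\<beta> \<le> ln (real n)" and k0: "k0 \<ge> 1"
    and K: "K = k0 ^ 3" "n \<le> K" "ln (real K) \<le> 24 * ln (real n)" and t: "0 \<le> t"
    and Q: "(\<Sum>k. ennreal (block_bound amp (\<lambda>i. sqrt (real n) * Y i) (k + k0))) \<le> ennreal (1 / (9 * real n ^ 4))"
    and noise: "\<And>j. j \<le> nat \<lfloor>ln (real n) / mesh n\<rfloor> \<Longrightarrow>
      (\<Sum>i<K. (shr n (real j * mesh n) i - shr n \<beta> i) * (real n * (Y i)\<^sup>2 - 1 - sig n \<mu> i))\<^sup>2
        \<le> t * (kl n \<mu> K (real j * mesh n) + kl n \<mu> K \<beta>)"
  obtains \<alpha> where "0 \<le> \<alpha>" "\<alpha> \<le> ah n Y" "ah n Y \<le> \<alpha> + mesh n" "kl n \<mu> K \<alpha> \<le> 3 * kl n \<mu> K \<beta> + 4 + 2 * t"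
proof -
  let ?X = "\<lambda>i. sqrt (real n) * Y i" and ?l = "ln (real n)" and ?a = "ah n Y"
  define T where "T \<alpha> i = lik_term (snr n \<alpha> i) (?X i)" for \<alpha> i
  have sm: "summable (\<lambda>k. block_bound amp ?X (k + k0))"
    using Q by (intro summable_suminf_not_top) (auto simp: block_bound_nonneg top_unique)
  have sumQ: "(\<Sum>k. block_bound amp ?X (k + k0)) \<le> 1 / (9 * real n ^ 4)"
    using Q sm by (subst (asm) suminf_ennreal2) (auto simp: block_bound_nonneg)
  have n1: "1 \<le> real n" using n by simp
  note series = lik_series_bounds[OF n1 less_imp_le[OF amp_pos] k0 sm sumQ, folded snr_def, folded T_def]
  have ll: "loglik \<kappa> n \<alpha> Y = - 1/2 * (\<Sum>i. T \<alpha> i)" for \<alpha>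
    using n by (simp add: loglik_eq T_def)
  have "continuous_on {0..?l} (\<lambda>\<alpha>. loglik \<kappa> n \<alpha> Y)"
    unfolding ll by (intro continuous_intros continuous_on_subset[OF series(3)]) auto
  then have "\<exists>a\<in>{0..?l}. \<forall>b\<in>{0..?l}. loglik \<kappa> n b Y \<le> loglik \<kappa> n a Y"
    using l by (intro continuous_attains_sup) auto
  then have "\<forall>b\<in>{0..?l}. loglik \<kappa> n b Y \<le> loglik \<kappa> n ?a Y" and a: "?a \<in> {0..?l}"
    using eb unfolding eb_selector_def by blast+
  then have "loglik \<kappa> n \<beta> Y \<le> loglik \<kappa> n ?a Y" using \<beta> by auto
  then have "(\<Sum>i. T ?a i) \<le> (\<Sum>i. T \<beta> i)" unfolding ll by simp
  then have T: "(\<Sum>i<K. T ?a i) \<le> (\<Sum>i<K. T \<beta> i) + 2"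
    using series(2)[of ?a] series(2)[of \<beta>] a \<beta> unfolding K(1) by (auto simp: abs_le_iff)
  have mp: "0 < mesh n" by (rule mesh_pos[OF l])
  define j where "j = nat \<lfloor>?a / mesh n\<rfloor>"
  have q0: "0 \<le> ?a / mesh n" using a mp by simp
  have j1: "real j \<le> ?a / mesh n" "?a / mesh n \<le> real j + 1"
    using q0 real_of_int_floor_add_one_ge[of "?a / mesh n"] unfolding j_def by auto
  have jJ: "j \<le> nat \<lfloor>?l / mesh n\<rfloor>"
    unfolding j_def using a mp by (intro nat_mono floor_mono divide_right_mono) auto
  have 1: "0 \<le> real j * mesh n" using mp by simp
  have 2: "real j * mesh n \<le> ?a" using j1(1) mp by (simp add: field_simps)
  have 3: "?a \<le> real j * mesh n + mesh n" using j1(2) mp by (simp add: field_simps)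
  have 4: "kl n \<mu> K (real j * mesh n) \<le> 3 * kl n \<mu> K \<beta> + 4 + 2 * t"
    by (rule kl_comparison[OF n l K(2,3) 1 2 3, where X = ?X])
       (use T noise[OF jJ] t in \<open>simp_all add: T_def power_mult_distrib\<close>)
  show ?thesis using that[OF 1 2 3 4] .
qed

text \<open>Below \<open>eff n \<beta>\<close> the passage from direct to inverse problem costs
  \<open>\<kappa>\<close> to the power -2, at most C^2 times
  \<open>eff n \<beta> powr (2*p)\<close>, and the direct bias is part of \<open>kl\<close>; above
  it the smoothness of the truth is used. Variance and noise are moved to the deterministic
  \<open>\<alpha>s\<close> by monotonicity of \<open>shr\<close>.\<close>

lemma posterior_second_moment_le:
  fixes n K :: nat
  assumes n: "n \<ge> 3" and l: "1 \<le> ln (real n)" and K: "n \<le> K" "ln (real K) \<le> 24 * ln (real n)"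
    and \<alpha>: "0 \<le> \<alpha>" "\<alpha> \<le> \<alpha>'" "\<alpha>' \<le> \<alpha> + mesh n" and \<alpha>s: "\<alpha>s \<le> \<alpha>'" and \<beta>: "0 < \<beta>"
    and S: "summable (\<lambda>i. real (Suc i) powr (2*\<beta>) * (\<mu> i)\<^sup>2)" "(\<Sum>i. real (Suc i) powr (2*\<beta>) * (\<mu> i)\<^sup>2) \<le> R\<^sup>2"
    and kl: "kl n \<mu> K \<alpha> \<le> \<Delta>"
  shows "(\<Sum>i. ennreal (post_var \<kappa> n \<alpha>' i + (post_mean \<kappa> n \<alpha>' Y i - \<mu> i)\<^sup>2)) \<le>
     ennreal (2 * (3 * C\<^sup>2 * eff n \<beta> powr (2*p) / real n * \<Delta> + eff n \<beta> powr (-2*\<beta>) * R\<^sup>2)) +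
     (\<Sum>i. ennreal (2 * (shr n \<alpha>s i / (\<kappa> i)\<^sup>2) * (1 / real n + (Y i - \<kappa> i * \<mu> i)\<^sup>2)))"
proof -
  define N where "N = eff n \<beta>"
  define c where "c = 3 * C\<^sup>2 * N powr (2*p) / real n"
  \<comment> \<open>A majorant of the squared bias in both regimes.\<close>
  define g where "g i = (if i < K then c * ((1 - shr n \<alpha> i) * sig n \<mu> i) else 0)
      + N powr (-2*\<beta>) * (real (Suc i) powr (2*\<beta>) * (\<mu> i)\<^sup>2)" for i
  have n1: "n \<ge> 1" using n by simp
  have N: "1 \<le> N" "N \<le> real n" unfolding N_def using n1 \<beta> by (auto intro!: eff_ge_1 eff_le)
  have c0: "0 \<le> c" by (simp add: c_def)
  have bias: "(1 - shr n \<alpha>' i)\<^sup>2 * (\<mu> i)\<^sup>2 \<le> g i" for i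
  proof -
    let ?x = "real (Suc i)" and ?z = "1 - shr n \<alpha>' i"
    have z: "0 \<le> ?z" "?z \<le> 1" using shr_bounds[of n \<alpha>' i] by auto
    have z2: "?z\<^sup>2 \<le> ?z" using z by (simp add: power2_eq_square mult_left_le)
    have p1: "0 \<le> N powr (-2*\<beta>) * (?x powr (2*\<beta>) * (\<mu> i)\<^sup>2)" by simp
    have p2: "0 \<le> c * ((1 - shr n \<alpha> i) * sig n \<mu> i)" using c0 kl_term_nonneg(2)[of n \<alpha> i \<mu>] by simp
    show ?thesis
    proof (cases "?x \<le> N")
      case True
      then have "?x \<le> real K" using N K by linarith
      then have iK: "i < K" by simp
      have "(\<mu> i)\<^sup>2 = sig n \<mu> i * (1 / (\<kappa> i)\<^sup>2) / real n"
        using n kappa_pos[of i] by (simp add: sig_def power_mult_distrib)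
      also have "\<dots> \<le> sig n \<mu> i * (C\<^sup>2 * N powr (2*p)) / real n"
      proof (intro divide_right_mono mult_left_mono)
        have "?x powr (2*p) \<le> N powr (2*p)" using True p by (intro powr_mono2) auto
        then have "C\<^sup>2 * ?x powr (2*p) \<le> C\<^sup>2 * N powr (2*p)" by (intro mult_left_mono) auto
        then show "1 / (\<kappa> i)\<^sup>2 \<le> C\<^sup>2 * N powr (2*p)" using inverse_kappa_sq_le[of i] by linarith
      qed (auto simp: sig_nonneg)
      finally have m: "(\<mu> i)\<^sup>2 \<le> sig n \<mu> i * (C\<^sup>2 * N powr (2*p)) / real n" .
      have "?z \<le> 3 * (1 - shr n \<alpha> i)" by (rule bias_factor_le[OF n l K \<alpha> iK])
      then have "?z\<^sup>2 \<le> 3 * (1 - shr n \<alpha> i)" using z2 by linarith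
      then have "?z\<^sup>2 * (\<mu> i)\<^sup>2 \<le> 3 * (1 - shr n \<alpha> i) * (sig n \<mu> i * (C\<^sup>2 * N powr (2*p)) / real n)"
        using m shr_bounds[of n \<alpha> i] by (intro mult_mono) auto
      also have "\<dots> = c * ((1 - shr n \<alpha> i) * sig n \<mu> i)" by (simp add: c_def)
      finally show ?thesis using iK by (simp only: g_def if_True) (rule add_increasing2[OF p1])
    next
      case False
      have "?z\<^sup>2 * (\<mu> i)\<^sup>2 \<le> 1 * (\<mu> i)\<^sup>2" using z z2 by (intro mult_right_mono) auto
      also have "\<dots> = ?x powr (-2*\<beta>) * (?x powr (2*\<beta>) * (\<mu> i)\<^sup>2)"
        by (simp add: powr_minus)
      also have "\<dots> \<le> N powr (-2*\<beta>) * (?x powr (2*\<beta>) * (\<mu> i)\<^sup>2)"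
        using False N \<beta> by (intro mult_right_mono powr_mono2') auto
      finally show ?thesis using p2 unfolding g_def by simp
    qed
  qed
  have gsums: "g sums ((\<Sum>i<K. c * ((1 - shr n \<alpha> i) * sig n \<mu> i)) + N powr (-2*\<beta>) * (\<Sum>i. real (Suc i) powr (2*\<beta>) * (\<mu> i)\<^sup>2))"
    unfolding g_def using sums_If_finite_set[of "{..<K}" "\<lambda>i. c * ((1 - shr n \<alpha> i) * sig n \<mu> i)"]
    by (intro sums_add sums_mult summable_sums S(1)) auto
  have "(\<Sum>i. g i) = c * (\<Sum>i<K. (1 - shr n \<alpha> i) * sig n \<mu> i) + N powr (-2*\<beta>) * (\<Sum>i. real (Suc i) powr (2*\<beta>) * (\<mu> i)\<^sup>2)"
    using gsums by (simp add: sums_iff sum_distrib_left)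
  also have "\<dots> \<le> c * \<Delta> + N powr (-2*\<beta>) * R\<^sup>2"
    using order_trans[OF kl_ge_bias kl] c0 S(2) by (intro add_mono mult_left_mono) auto
  finally have gs: "(\<Sum>i. g i) \<le> c * \<Delta> + N powr (-2*\<beta>) * R\<^sup>2" .
  have g0: "0 \<le> g i" for i using bias[of i] by (rule order_trans[rotated]) simp
  have pt: "post_var \<kappa> n \<alpha>' i + (post_mean \<kappa> n \<alpha>' Y i - \<mu> i)\<^sup>2 \<le>
      2 * g i + 2 * (shr n \<alpha>s i / (\<kappa> i)\<^sup>2) * (1 / real n + (Y i - \<kappa> i * \<mu> i)\<^sup>2)" for i
  proof -
    define w d where "w = shr n \<alpha>' i" and "d = Y i - \<kappa> i * \<mu> i"
    have w: "0 \<le> w" "w \<le> 1" using shr_bounds by (auto simp: w_def)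
    have ws: "w \<le> shr n \<alpha>s i" unfolding w_def by (rule shr_antimono[OF \<alpha>s])
    have "post_mean \<kappa> n \<alpha>' Y i - \<mu> i = w / \<kappa> i * d + - ((1 - w) * \<mu> i)"
      using n1 kappa_pos[of i] by (simp add: post_mean_eq w_def d_def field_simps)
    then have "(post_mean \<kappa> n \<alpha>' Y i - \<mu> i)\<^sup>2 \<le> 2 * (w / \<kappa> i * d)\<^sup>2 + 2 * ((1 - w) * \<mu> i)\<^sup>2"
      using power2_sum_le[of "w / \<kappa> i * d" "- ((1 - w) * \<mu> i)"] by simp
    also have "(w / \<kappa> i * d)\<^sup>2 = w\<^sup>2 * (d\<^sup>2 / (\<kappa> i)\<^sup>2)" by (simp add: power_mult_distrib power_divide)
    also have "w\<^sup>2 * (d\<^sup>2 / (\<kappa> i)\<^sup>2) \<le> w * (d\<^sup>2 / (\<kappa> i)\<^sup>2)"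
      using w by (intro mult_right_mono) (auto simp: power2_eq_square mult_left_le)
    also have "((1 - w) * \<mu> i)\<^sup>2 \<le> g i" using bias[of i] by (simp add: w_def power_mult_distrib)
    finally have A: "(post_mean \<kappa> n \<alpha>' Y i - \<mu> i)\<^sup>2 \<le> 2 * (w * (d\<^sup>2 / (\<kappa> i)\<^sup>2)) + 2 * g i" by simp
    have "post_var \<kappa> n \<alpha>' i = w * (1 / real n / (\<kappa> i)\<^sup>2)"
      using n1 by (simp add: post_var_eq w_def)
    also have "\<dots> \<le> 2 * (w * (1 / real n / (\<kappa> i)\<^sup>2))"
    proof -
      have "0 \<le> w * (1 / real n / (\<kappa> i)\<^sup>2)" using w by simp
      then show ?thesis by linarith
    qed
    finally have "post_var \<kappa> n \<alpha>' i + (post_mean \<kappa> n \<alpha>' Y i - \<mu> i)\<^sup>2 \<le>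
       2 * g i + w * (2 * ((1 / real n + d\<^sup>2) / (\<kappa> i)\<^sup>2))"
      using A by (simp add: algebra_simps add_divide_distrib)
    also have "w * (2 * ((1 / real n + d\<^sup>2) / (\<kappa> i)\<^sup>2)) \<le> shr n \<alpha>s i * (2 * ((1 / real n + d\<^sup>2) / (\<kappa> i)\<^sup>2))"
      using ws by (intro mult_right_mono) auto
    also have "\<dots> = 2 * (shr n \<alpha>s i / (\<kappa> i)\<^sup>2) * (1 / real n + d\<^sup>2)" by (simp only: divide_inverse mult_ac)
    finally show ?thesis by (simp add: d_def)
  qed
  have "(\<Sum>i. ennreal (post_var \<kappa> n \<alpha>' i + (post_mean \<kappa> n \<alpha>' Y i - \<mu> i)\<^sup>2)) \<le>
     (\<Sum>i. ennreal (2 * g i) + ennreal (2 * (shr n \<alpha>s i / (\<kappa> i)\<^sup>2) * (1 / real n + (Y i - \<kappa> i * \<mu> i)\<^sup>2)))"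
  proof (intro suminf_le summableI)
    fix i
    have "0 \<le> 2 * (shr n \<alpha>s i / (\<kappa> i)\<^sup>2) * (1 / real n + (Y i - \<kappa> i * \<mu> i)\<^sup>2)"
      using shr_bounds by (intro mult_nonneg_nonneg divide_nonneg_nonneg add_nonneg_nonneg) auto
    then show "ennreal (post_var \<kappa> n \<alpha>' i + (post_mean \<kappa> n \<alpha>' Y i - \<mu> i)\<^sup>2) \<le>
      ennreal (2 * g i) + ennreal (2 * (shr n \<alpha>s i / (\<kappa> i)\<^sup>2) * (1 / real n + (Y i - \<kappa> i * \<mu> i)\<^sup>2))"
      using pt[of i] g0[of i] by (subst ennreal_plus[symmetric]) (auto intro!: ennreal_leI simp del: ennreal_plus)
  qed
  also have "\<dots> = (\<Sum>i. ennreal (2 * g i)) + (\<Sum>i. ennreal (2 * (shr n \<alpha>s i / (\<kappa> i)\<^sup>2) * (1 / real n + (Y i - \<kappa> i * \<mu> i)\<^sup>2)))"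
    by (intro suminf_add[symmetric] summableI)
  also have "(\<Sum>i. ennreal (2 * g i)) = ennreal (\<Sum>i. 2 * g i)"
    using gsums g0 by (intro suminf_ennreal2 summable_mult) (auto simp: sums_iff)
  also have "(\<Sum>i. 2 * g i) = 2 * (\<Sum>i. g i)" using gsums by (intro suminf_mult) (auto simp: sums_iff)
  also have "ennreal (2 * (\<Sum>i. g i)) \<le> ennreal (2 * (c * \<Delta> + N powr (-2*\<beta>) * R\<^sup>2))"
    using gs by (intro ennreal_leI) auto
  finally show ?thesis unfolding c_def N_def by simp
qed

text \<open>Beyond the effective dimension \<open>shr\<close> is replaced by \<open>snr\<close>,
  whose factor \<open>(\<kappa> i)\<^sup>2\<close> cancels; what remains is summable because
  \<alpha> > 0, and its tail is of the same order as the contribution of the coordinates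
  below.\<close>

lemma sum_shr_kappa_le:
  assumes n: "n \<ge> 1" and \<alpha>: "0 < \<alpha>"
  shows "(\<Sum>i<m. shr n \<alpha> i / (\<kappa> i)\<^sup>2) \<le> eff n \<alpha> powr (1 + 2*p) * (C\<^sup>2 + 1 + 1 / (2*\<alpha>))"
proof -
  let ?N = "eff n \<alpha>"
  have N: "1 \<le> ?N" using n \<alpha> by (intro eff_ge_1) auto
  have "shr n \<alpha> i / (\<kappa> i)\<^sup>2 \<le> (if real (Suc i) \<le> ?N then C\<^sup>2 * ?N powr (2*p) else 0)
      + real n * (if ?N < real (Suc i) then real (Suc i) powr (-1 - 2*\<alpha>) else 0)" for i
  proof (cases "real (Suc i) \<le> ?N")
    case True
    have "real (Suc i) powr (2*p) \<le> ?N powr (2*p)" using True p by (intro powr_mono2) auto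
    then have "C\<^sup>2 * real (Suc i) powr (2*p) \<le> C\<^sup>2 * ?N powr (2*p)" by (intro mult_left_mono) auto
    then have "1 / (\<kappa> i)\<^sup>2 \<le> C\<^sup>2 * ?N powr (2*p)" using inverse_kappa_sq_le[of i] by linarith
    moreover have "shr n \<alpha> i / (\<kappa> i)\<^sup>2 \<le> 1 / (\<kappa> i)\<^sup>2" using shr_bounds by (intro divide_right_mono) auto
    ultimately show ?thesis using True by simp
  next
    case False
    have "shr n \<alpha> i / (\<kappa> i)\<^sup>2 \<le> snr n \<alpha> i / (\<kappa> i)\<^sup>2" using shr_bounds by (intro divide_right_mono) auto
    also have "\<dots> = real n * real (Suc i) powr (-1 - 2*\<alpha>)"
      using kappa_pos[of i] by (simp add: snr_alt)
    finally show ?thesis using False by simp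
  qed
  then have "(\<Sum>i<m. shr n \<alpha> i / (\<kappa> i)\<^sup>2) \<le> (\<Sum>i<m. (if real (Suc i) \<le> ?N then C\<^sup>2 * ?N powr (2*p) else 0)
      + real n * (if ?N < real (Suc i) then real (Suc i) powr (-1 - 2*\<alpha>) else 0))"
    by (intro sum_mono)
  also have "\<dots> = C\<^sup>2 * ?N powr (2*p) * real (card {i. i < m \<and> real (Suc i) \<le> ?N})
      + real n * (\<Sum>i<m. if ?N < real (Suc i) then real (Suc i) powr (-1 - 2*\<alpha>) else 0)"
    by (simp add: sum.distrib sum.If_cases Int_def sum_distrib_left[symmetric] del: of_nat_Suc)
  also have "\<dots> \<le> C\<^sup>2 * ?N powr (2*p) * ?N + real n * (?N powr (-(2*\<alpha>)) * (1 + 1 / (2*\<alpha>)))"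
    using N \<alpha> by (intro add_mono mult_left_mono card_Suc_le_real sum_powr_tail_le) auto
  also have "\<dots> = C\<^sup>2 * (?N powr (2*p) * ?N) + (real n * ?N powr (-(2*\<alpha>))) * (1 + 1 / (2*\<alpha>))" by simp
  also have "?N powr (2*p) * ?N = ?N powr (1 + 2*p)" using N by (simp add: powr_add)
  also have "real n * ?N powr (-(2*\<alpha>)) = ?N powr (1 + 2*\<alpha> + 2*p) * ?N powr (-(2*\<alpha>))"
    using eff_powr[of n \<alpha>] n \<alpha> by simp
  also have "\<dots> = ?N powr (1 + 2*p)" by (simp flip: powr_add)
  finally show ?thesis by (simp add: algebra_simps)
qed

lemma posterior_noise_expectation:
  assumes n: "n \<ge> 1" and \<alpha>: "0 < \<alpha>"
  shows "(\<integral>\<^sup>+Y. (\<Sum>i. ennreal (2 * (shr n \<alpha> i / (\<kappa> i)\<^sup>2) * (1 / real n + (Y i - \<kappa> i * \<mu> i)\<^sup>2))) \<partial>obs_law \<kappa> n \<mu>)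
    \<le> ennreal (4 / real n * (eff n \<alpha> powr (1 + 2*p) * (C\<^sup>2 + 1 + 1 / (2*\<alpha>))))"
proof -
  interpret prob_space "obs_law \<kappa> n \<mu>" using n by (rule prob_space_obs_law)
  note [measurable] = measurable_obs_law[OF n, of _ \<mu>]
  have const: "has_bochner_integral (obs_law \<kappa> n \<mu>) (\<lambda>Y. c) c" for c :: real
    by (simp add: has_bochner_integral_iff prob_space)
  have s0: "0 \<le> shr n \<alpha> i / (\<kappa> i)\<^sup>2" for i using shr_bounds by simp
  have "(\<integral>\<^sup>+Y. (\<Sum>i. ennreal (2 * (shr n \<alpha> i / (\<kappa> i)\<^sup>2) * (1 / real n + (Y i - \<kappa> i * \<mu> i)\<^sup>2))) \<partial>obs_law \<kappa> n \<mu>)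
    = (\<Sum>i. \<integral>\<^sup>+Y. ennreal (2 * (shr n \<alpha> i / (\<kappa> i)\<^sup>2) * (1 / real n + (Y i - \<kappa> i * \<mu> i)\<^sup>2)) \<partial>obs_law \<kappa> n \<mu>)"
    by (intro nn_integral_suminf) measurable
  also have "\<dots> \<le> (\<Sum>i. ennreal (4 / real n * (shr n \<alpha> i / (\<kappa> i)\<^sup>2)))"
  proof (intro suminf_le summableI)
    fix i
    have "has_bochner_integral (obs_law \<kappa> n \<mu>) (\<lambda>Y. 2 * (shr n \<alpha> i / (\<kappa> i)\<^sup>2) * (1 / real n + (Y i - \<kappa> i * \<mu> i)\<^sup>2))
       (2 * (shr n \<alpha> i / (\<kappa> i)\<^sup>2) * (1 / real n + 1 / real n))"
      by (intro has_bochner_integral_mult_right has_bochner_integral_add const noise_square_obs_law n)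
    moreover have "0 \<le> 2 * (shr n \<alpha> i / (\<kappa> i)\<^sup>2) * (1 / real n + (Y i - \<kappa> i * \<mu> i)\<^sup>2)" for Y
      using s0[of i] by (intro mult_nonneg_nonneg add_nonneg_nonneg) auto
    ultimately have "(\<integral>\<^sup>+Y. ennreal (2 * (shr n \<alpha> i / (\<kappa> i)\<^sup>2) * (1 / real n + (Y i - \<kappa> i * \<mu> i)\<^sup>2)) \<partial>obs_law \<kappa> n \<mu>)
      \<le> ennreal (2 * (shr n \<alpha> i / (\<kappa> i)\<^sup>2) * (1 / real n + 1 / real n))"
      by (rule nn_integral_le_ennreal) simp
    then show "(\<integral>\<^sup>+Y. ennreal (2 * (shr n \<alpha> i / (\<kappa> i)\<^sup>2) * (1 / real n + (Y i - \<kappa> i * \<mu> i)\<^sup>2)) \<partial>obs_law \<kappa> n \<mu>)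
      \<le> ennreal (4 / real n * (shr n \<alpha> i / (\<kappa> i)\<^sup>2))"
      by (simp add: mult.commute)
  qed
  also have "\<dots> \<le> ennreal (4 / real n * (eff n \<alpha> powr (1 + 2*p) * (C\<^sup>2 + 1 + 1 / (2*\<alpha>))))"
  proof (rule suminf_le_const[OF summableI])
    fix m
    have "(\<Sum>i<m. ennreal (4 / real n * (shr n \<alpha> i / (\<kappa> i)\<^sup>2))) = ennreal (4 / real n * (\<Sum>i<m. shr n \<alpha> i / (\<kappa> i)\<^sup>2))"
      unfolding sum_distrib_left by (rule sum_ennreal) (intro mult_nonneg_nonneg s0, simp)
    also have "\<dots> \<le> ennreal (4 / real n * (eff n \<alpha> powr (1 + 2*p) * (C\<^sup>2 + 1 + 1 / (2*\<alpha>))))"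
      using sum_shr_kappa_le[OF n \<alpha>] by (intro ennreal_leI mult_left_mono) auto
    finally show "(\<Sum>i<m. ennreal (4 / real n * (shr n \<alpha> i / (\<kappa> i)\<^sup>2))) \<le>
       ennreal (4 / real n * (eff n \<alpha> powr (1 + 2*p) * (C\<^sup>2 + 1 + 1 / (2*\<alpha>))))" .
  qed
  finally show ?thesis .
qed

end

section \<open>Contraction rates\<close>

text \<open>Over the reals a supremum can be bounded only for nonempty bounded families; boundedness
  comes from the eventual bound \<open>e\<close>.\<close>

lemma SUP_tendsto_0:
  fixes f :: "nat \<Rightarrow> 'b \<Rightarrow> real"
  assumes A: "A \<noteq> {}" and f: "\<And>n x. 0 \<le> f n x" and le: "eventually (\<lambda>n. \<forall>x\<in>A. f n x \<le> e n) sequentially"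
    and e: "e \<longlonglongrightarrow> 0"
  shows "(\<lambda>n. SUP x\<in>A. f n x) \<longlonglongrightarrow> 0"
proof (rule tendsto_sandwich[OF _ _ tendsto_const e])
  show "\<forall>\<^sub>F n in sequentially. (SUP x\<in>A. f n x) \<le> e n"
    using le by eventually_elim (use A in \<open>auto intro!: cSUP_least\<close>)
  show "\<forall>\<^sub>F n in sequentially. 0 \<le> (SUP x\<in>A. f n x)"
    using le
  proof eventually_elim
    case (elim n)
    obtain x where x: "x \<in> A" using A by blast
    show ?case
      by (rule cSUP_upper2[OF _ x f]) (use elim in \<open>auto intro!: bdd_aboveI2\<close>)
  qed
qed

section \<open>A nonasymptotic risk bound and its uniform limit\<close>

context mildly_ill_posed
begin

text \<open>The constant for which \<open>dim_const * l^4 * R\<^sup>2 * eff n \<beta>\<close> bounds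
  the effective dimension at the selected grid point in \<open>risk_bound\<close>: 372 = 4 * 93,
  with 4 (1 + C^2)^2 from \<open>kl_ge_eff\<close> and 93 C^4 from the bound on the
  divergence.\<close>

definition dim_const :: real where
  "dim_const = 372 * C^4 * (1 + C\<^sup>2)\<^sup>2"

lemma dim_const_ge_1: "1 \<le> dim_const"
proof -
  have "1 * 1 \<le> C^4 * (1 + C\<^sup>2)\<^sup>2" using C by (intro mult_mono one_le_power) auto
  then show ?thesis by (simp add: dim_const_def)
qed

text \<open>The summands account for excessive noise at some grid point, for a large tail of the
  likelihood series, and for the posterior second moment elsewhere. Smoothness and radius may vary
  with \<open>n\<close>, as the analytic case requires; \<open>small\<close> keeps
  \<open>\<alpha>s\<close> above \<beta>/2 and hence away from 0.\<close>

lemma risk_bound: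
  fixes ah :: "nat \<Rightarrow> (nat \<Rightarrow> real) \<Rightarrow> real" and n :: nat
  defines "l \<equiv> ln (real n)"
  assumes eb: "eb_selector \<kappa> ah" and n: "n \<ge> 3" and l: "1 \<le> l"
    and \<beta>: "0 < \<beta>" "\<beta> \<le> l" and R: "1 \<le> R" "R^4 \<le> real n" and r: "0 < r"
    and small: "(1 + \<beta> + 2*p) * ln (dim_const * l^4 * R\<^sup>2 * eff n \<beta>) \<le> l"
    and S: "summable (\<lambda>i. real (Suc i) powr (2*\<beta>) * (\<mu> i)\<^sup>2)" "(\<Sum>i. real (Suc i) powr (2*\<beta>) * (\<mu> i)\<^sup>2) \<le> R\<^sup>2"
  shows "eb_risk \<kappa> ah n \<mu> r \<le> (80000 * C\<^sup>2 * (1 + C\<^sup>2)\<^sup>2 * l^3 + 4) / l^4 + 28800 * C^8 / real n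
    + 1 / r\<^sup>2 * eff n \<beta> powr (-2*\<beta>) *
      (560 * C^6 * l^4 * R\<^sup>2 + 4 * (dim_const * l^4 * R\<^sup>2) powr (1 + 2*p) * (C\<^sup>2 + 1 + 1 / \<beta>))"
proof -
  define N where "N = eff n \<beta>"
  define Ns where "Ns = dim_const * l^4 * R\<^sup>2 * N"
  \<comment> \<open>The solution of \<open>eff n \<alpha>s = Ns\<close>.\<close>
  define \<alpha>s where "\<alpha>s = (l / ln Ns - 1 - 2*p) / 2"
  \<comment> \<open>The tail series has mean of order (1 + S)^2 / k0, at most of order n^3 / k0
    since \<open>R^4 \<le> n\<close>; multiplied by \<open>9 * n^4\<close> this is of order 1/n for
    \<open>k0 = n^8\<close>.\<close>
  define k0 where "k0 = n^8"
  define K where "K = k0^3"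
  define J where "J = nat \<lfloor>l / mesh n\<rfloor>"
  \<comment> \<open>93 = 3 * 29 + 4 + 2, from the conclusion of \<open>kl_comparison\<close> with
    \<open>t = l^4\<close> and from \<open>kl_le\<close>.\<close>
  define \<Delta> where "\<Delta> = 93 * C^4 * l^4 * R\<^sup>2 * N"
  have n1: "n \<ge> 1" using n by simp
  have N: "1 \<le> N" "N \<le> real n" unfolding N_def using n1 \<beta> by (auto intro!: eff_ge_1 eff_le)
  have R2: "1 \<le> R\<^sup>2" using R by auto
  have l4: "1 \<le> l^4" using l by auto
  have k0: "k0 \<ge> 1" using n by (simp add: k0_def)
  have Kn: "K = n^24" by (simp add: K_def k0_def flip: power_mult)
  have K: "K = k0^3" "n \<le> K" "ln (real K) \<le> 24 * ln (real n)"
    using n self_le_power[of n 24] by (auto simp: Kn K_def[symmetric] ln_realpow)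
  note l' = l[unfolded l_def]
  have mp: "0 < mesh n" by (rule mesh_pos[OF l'])
  have RlN: "1 \<le> R\<^sup>2 * N" "1 \<le> l^4 * (R\<^sup>2 * N)" "1 \<le> l^4 * R\<^sup>2"
  proof -
    show "1 \<le> R\<^sup>2 * N" using mult_mono[OF R2 N(1)] R2 by simp
    then show "1 \<le> l^4 * (R\<^sup>2 * N)" using mult_mono[of 1 "l^4" 1 "R\<^sup>2 * N"] l4 by simp
    show "1 \<le> l^4 * R\<^sup>2" using mult_mono[of 1 "l^4" 1 "R\<^sup>2"] l4 R2 by simp
  qed
  have C4: "1 \<le> C^4" using C by auto
  have kl\<Delta>: "3 * kl n \<mu> K \<beta> + 4 + 2 * l^4 \<le> \<Delta>"
  proof -
    have "kl n \<mu> K \<beta> \<le> 29 * C^4 * l * R\<^sup>2 * N"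
      unfolding N_def l_def using n \<beta> R K S l' by (intro kl_le) auto
    also have "\<dots> = 29 * C^4 * (l * (R\<^sup>2 * N))" by simp
    also have "\<dots> \<le> 29 * C^4 * (l^4 * (R\<^sup>2 * N))"
      using C4 RlN l power_increasing[of 1 4 l] by (intro mult_left_mono mult_right_mono) auto
    finally have "kl n \<mu> K \<beta> \<le> 29 * (C^4 * (l^4 * (R\<^sup>2 * N)))" by (simp only: mult.assoc)
    then have 1: "3 * kl n \<mu> K \<beta> \<le> 87 * (C^4 * (l^4 * (R\<^sup>2 * N)))" by linarith
    have 2: "1 \<le> C^4 * (l^4 * (R\<^sup>2 * N))" using mult_mono[of 1 "C^4" 1 "l^4 * (R\<^sup>2 * N)"] C4 RlN by simp
    have "l^4 * 1 \<le> l^4 * (R\<^sup>2 * N)" using RlN l4 by (intro mult_left_mono) auto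
    also have "\<dots> \<le> C^4 * (l^4 * (R\<^sup>2 * N))"
      using mult_right_mono[OF C4, of "l^4 * (R\<^sup>2 * N)"] RlN by simp
    finally have 3: "l^4 \<le> C^4 * (l^4 * (R\<^sup>2 * N))" by simp
    have "\<Delta> = 93 * (C^4 * (l^4 * (R\<^sup>2 * N)))" by (simp add: \<Delta>_def)
    then show ?thesis using 1 2 3 by linarith
  qed
  have Ns_eq: "Ns = 4 * (1 + C\<^sup>2)\<^sup>2 * \<Delta>" by (simp add: Ns_def \<Delta>_def dim_const_def)
  have Ns1: "1 < Ns"
  proof -
    have "372 * 1 \<le> 372 * (C^4 * (1 + C\<^sup>2)\<^sup>2)"
      using mult_mono[of 1 "C^4" 1 "(1 + C\<^sup>2)\<^sup>2"] C4 by (intro mult_left_mono) auto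
    then have "372 \<le> dim_const" by (simp add: dim_const_def)
    then have "372 * 1 \<le> dim_const * (l^4 * (R\<^sup>2 * N))" using RlN by (intro mult_mono) auto
    then show ?thesis by (simp add: Ns_def mult.assoc)
  qed
  have lnNs: "0 < ln Ns" using Ns1 by simp
  have q\<alpha>s: "1 + 2*\<alpha>s + 2*p = l / ln Ns" 
  proof -
    have "1 + 2 * ((x - 1 - 2*p) / 2) + 2*p = x" for x :: real by (simp add: field_simps)
    then show ?thesis unfolding \<alpha>s_def .
  qed
  have \<alpha>s: "\<beta> / 2 \<le> \<alpha>s"
  proof -
    have "1 + \<beta> + 2*p \<le> l / ln Ns" using small lnNs by (simp add: Ns_def N_def pos_le_divide_eq)
    then show ?thesis by (simp add: \<alpha>s_def)
  qed
  have \<alpha>s0: "0 < \<alpha>s" using \<alpha>s \<beta> by linarith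
  have eff\<alpha>s: "eff n \<alpha>s = Ns"
  proof -
    have "eff n \<alpha>s = exp (1 / (l / ln Ns) * l)"
      unfolding eff_def q\<alpha>s using n by (simp add: powr_def l_def)
    also have "1 / (l / ln Ns) * l = ln Ns" using l by simp
    finally show ?thesis using Ns1 by simp
  qed
  have \<alpha>s_le: "\<alpha>s \<le> \<alpha>" if "0 \<le> \<alpha>" "kl n \<mu> K \<alpha> \<le> \<Delta>" for \<alpha>
  proof -
    have "eff n \<alpha> / (4 * (1 + C\<^sup>2)\<^sup>2) \<le> \<Delta>"
      using kl_ge_eff[OF n1 that(1) K(2)] that(2) by (rule order_trans)
    then have "eff n \<alpha> \<le> Ns"
      unfolding Ns_eq using one_plus_C_pos by (simp add: pos_divide_le_eq mult.commute)
    then have "ln (eff n \<alpha>) \<le> ln Ns" using eff_ge_1[OF n1 that(1)] by (intro ln_mono) auto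
    moreover have "ln (eff n \<alpha>) = l / (1 + 2*\<alpha> + 2*p)" using n by (simp add: eff_def ln_powr l_def)
    moreover have "0 < 1 + 2*\<alpha> + 2*p" using that p by linarith
    ultimately have "l / ln Ns \<le> 1 + 2*\<alpha> + 2*p" using lnNs by (simp add: field_simps)
    then show ?thesis by (simp add: \<alpha>s_def)
  qed
  \<comment> \<open>The balance defining \<open>N\<close>: the variance of order N^(1+2p) / n equals
    the squared bias.\<close>
  have N_rate: "N powr (1 + 2*p) / real n = N powr (-2*\<beta>)"
  proof -
    have "real n = N powr (1 + 2*\<beta> + 2*p)" unfolding N_def using eff_powr[of n \<beta>] n1 \<beta> by simp
    then show ?thesis using N by (simp flip: powr_diff)
  qed
  define b where "b = 2 * (3 * C\<^sup>2 * N powr (2*p) / real n * \<Delta> + N powr (-2*\<beta>) * R\<^sup>2)"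
  have b: "b \<le> N powr (-2*\<beta>) * (560 * C^6 * l^4 * R\<^sup>2)" "0 \<le> b"
  proof -
    have "3 * C\<^sup>2 * N powr (2*p) / real n * \<Delta> = 279 * (C\<^sup>2 * C^4) * l^4 * R\<^sup>2 * ((N powr (2*p) * N) / real n)"
      by (simp add: \<Delta>_def)
    also have "C\<^sup>2 * C^4 = C^6" by (simp flip: power_add)
    also have "N powr (2*p) * N = N powr (1 + 2*p)" using N by (simp add: powr_add)
    finally have 1: "3 * C\<^sup>2 * N powr (2*p) / real n * \<Delta> = N powr (-2*\<beta>) * (279 * C^6 * l^4 * R\<^sup>2)"
      by (simp add: N_rate)
    have "1 \<le> C^6 * l^4" using mult_mono[of 1 "C^6" 1 "l^4"] C l4 by simp
    then have "1 * R\<^sup>2 \<le> C^6 * l^4 * R\<^sup>2" by (intro mult_right_mono) auto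
    then have "N powr (-2*\<beta>) * R\<^sup>2 \<le> N powr (-2*\<beta>) * (C^6 * l^4 * R\<^sup>2)" by (intro mult_left_mono) auto
    then show "b \<le> N powr (-2*\<beta>) * (560 * C^6 * l^4 * R\<^sup>2)"
      unfolding b_def 1 by (simp add: algebra_simps)
    show "0 \<le> b" unfolding b_def 1 using C l by (intro mult_nonneg_nonneg add_nonneg_nonneg) auto
  qed
  define v where "v = 4 / real n * (Ns powr (1 + 2*p) * (C\<^sup>2 + 1 + 1 / (2*\<alpha>s)))"
  have v: "v \<le> N powr (-2*\<beta>) * (4 * (dim_const * l^4 * R\<^sup>2) powr (1 + 2*p) * (C\<^sup>2 + 1 + 1 / \<beta>))" "0 \<le> v"
  proof -
    have "Ns powr (1 + 2*p) = (dim_const * l^4 * R\<^sup>2) powr (1 + 2*p) * N powr (1 + 2*p)"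
      unfolding Ns_def by (rule powr_mult)
    then have "v = 4 * (dim_const * l^4 * R\<^sup>2) powr (1 + 2*p) * (N powr (1 + 2*p) / real n) * (C\<^sup>2 + 1 + 1 / (2*\<alpha>s))"
      by (simp add: v_def)
    also have "\<dots> \<le> 4 * (dim_const * l^4 * R\<^sup>2) powr (1 + 2*p) * (N powr (1 + 2*p) / real n) * (C\<^sup>2 + 1 + 1 / \<beta>)"
      using \<alpha>s \<beta> \<alpha>s0 by (intro mult_left_mono add_mono divide_left_mono) auto
    finally show "v \<le> N powr (-2*\<beta>) * (4 * (dim_const * l^4 * R\<^sup>2) powr (1 + 2*p) * (C\<^sup>2 + 1 + 1 / \<beta>))"
      unfolding N_rate by (simp add: mult_ac)
    show "0 \<le> v" unfolding v_def using \<alpha>s0 by (intro mult_nonneg_nonneg add_nonneg_nonneg) auto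
  qed

  define noise where "noise Y j = (\<Sum>i<K. (shr n (real j * mesh n) i - shr n \<beta> i) * (real n * (Y i)\<^sup>2 - 1 - sig n \<mu> i))\<^sup>2" for Y j
  define V where "V j = kl n \<mu> K (real j * mesh n) + kl n \<mu> K \<beta>" for j
  define Q where "Q Y = (\<Sum>k. ennreal (block_bound amp (\<lambda>i. sqrt (real n) * Y i) (k + k0)))" for Y
  define W where "W Y = (\<Sum>i. ennreal (2 * (shr n \<alpha>s i / (\<kappa> i)\<^sup>2) * (1 / real n + (Y i - \<kappa> i * \<mu> i)\<^sup>2)))" for Y
  define f where "f Y = measure (posterior \<kappa> n (ah n Y) Y)
      {\<mu>' \<in> space (posterior \<kappa> n (ah n Y) Y). ennreal r \<le> l2norm (\<lambda>i. \<mu>' i - \<mu> i)}" for Y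
  have Vpos: "0 < V j" for j
  proof -
    have "0 < eff n \<beta> / (4 * (1 + C\<^sup>2)\<^sup>2)" using N one_plus_C_pos by (simp add: N_def)
    also have "\<dots> \<le> kl n \<mu> K \<beta>" using n1 \<beta> K by (intro kl_ge_eff) auto
    finally show ?thesis using kl_nonneg[of n \<mu> K "real j * mesh n"] by (simp add: V_def)
  qed
  have f1: "f Y \<le> 1" for Y
  proof -
    have "prob_space (posterior \<kappa> n (ah n Y) Y)"
      unfolding posterior_def using post_var_pos[OF n1]
      by (intro prob_space_PiM prob_space_normal_density) auto
    then show ?thesis unfolding f_def by (rule prob_space.prob_le_1)
  qed
  \<comment> \<open>Where the noise or the tail is large, the corresponding summand exceeds \<open>1 \<ge> f Y\<close>; hence
    Markov's inequality for all the events involved takes the form of a single pointwise bound,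
    and neither measurability of \<open>f\<close> nor null sets matter.\<close>
  have pointwise: "ennreal (f Y) \<le> (\<Sum>j\<le>J. ennreal (noise Y j / (l^4 * V j))) + ennreal (9 * real n^4) * Q Y
     + ennreal (1 / r\<^sup>2) * (ennreal b + W Y)" for Y
  proof -
    consider (noise) j where "j \<le> J" "l^4 * V j < noise Y j" | (tail) "\<not> Q Y \<le> ennreal (1 / (9 * real n^4))"
      | (good) "\<And>j. j \<le> J \<Longrightarrow> noise Y j \<le> l^4 * V j" "Q Y \<le> ennreal (1 / (9 * real n^4))"
      by (meson not_less)
    then show ?thesis
    proof cases
      case (noise j)
      have "1 \<le> noise Y j / (l^4 * V j)" using noise Vpos[of j] l by (simp add: pos_le_divide_eq)
      then have "f Y \<le> noise Y j / (l^4 * V j)" using f1[of Y] by linarith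
      then have "ennreal (f Y) \<le> ennreal (noise Y j / (l^4 * V j))" by (rule ennreal_leI)
      also have "\<dots> \<le> (\<Sum>j\<le>J. ennreal (noise Y j / (l^4 * V j)))"
        using noise(1) by (intro member_le_sum) auto
      finally show ?thesis by (simp add: add_increasing2 add.assoc)
    next
      case tail
      then have "ennreal (1 / (9 * real n^4)) \<le> Q Y" by simp
      then have "ennreal (9 * real n^4) * ennreal (1 / (9 * real n^4)) \<le> ennreal (9 * real n^4) * Q Y"
        by (intro mult_left_mono) auto
      then have "1 \<le> ennreal (9 * real n^4) * Q Y" using n1 by (simp flip: ennreal_mult)
      moreover have "ennreal (f Y) \<le> 1" using f1[of Y] by (simp add: ennreal_le_1)
      ultimately have "ennreal (f Y) \<le> ennreal (9 * real n^4) * Q Y" by (rule order_trans[rotated])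
      then show ?thesis by (simp add: add_increasing add_increasing2)
    next
      case good
      obtain \<alpha> where \<alpha>: "0 \<le> \<alpha>" "\<alpha> \<le> ah n Y" "ah n Y \<le> \<alpha> + mesh n" "kl n \<mu> K \<alpha> \<le> 3 * kl n \<mu> K \<beta> + 4 + 2 * l^4"
        by (rule selector_kl[OF eb n l' less_imp_le[OF \<beta>(1)] \<beta>(2)[unfolded l_def] k0 K, of "l^4" Y \<mu>])
           (use good l in \<open>auto simp: Q_def noise_def V_def J_def l_def\<close>)
      have kl: "kl n \<mu> K \<alpha> \<le> \<Delta>" using \<alpha>(4) kl\<Delta> by linarith
      have as: "\<alpha>s \<le> ah n Y" using \<alpha>s_le[OF \<alpha>(1) kl] \<alpha>(2) by linarith
      have "ennreal (f Y) \<le> ennreal (1 / r\<^sup>2) * (\<Sum>i. ennreal (post_var \<kappa> n (ah n Y) i + (post_mean \<kappa> n (ah n Y) Y i - \<mu> i)\<^sup>2))"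
        unfolding f_def by (rule posterior_Markov[OF post_var_pos[OF n1] r])
      also have "\<dots> \<le> ennreal (1 / r\<^sup>2) * (ennreal b + W Y)"
        unfolding b_def W_def N_def
        by (intro mult_left_mono posterior_second_moment_le[OF n l' K(2,3) \<alpha>(1-3) as \<beta>(1) S kl]) auto
      finally show ?thesis by (simp add: add_increasing)
    qed
  qed
  note [measurable] = measurable_obs_law[OF n1, of _ \<mu>]
  interpret O: prob_space "obs_law \<kappa> n \<mu>" using n1 by (rule prob_space_obs_law)
  have [measurable]: "Q \<in> borel_measurable (obs_law \<kappa> n \<mu>)" unfolding Q_def block_bound_def by measurable
  have [measurable]: "W \<in> borel_measurable (obs_law \<kappa> n \<mu>)" unfolding W_def by measurable
  have [measurable]: "(\<lambda>Y. noise Y j) \<in> borel_measurable (obs_law \<kappa> n \<mu>)" for j unfolding noise_def by measurable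
  \<comment> \<open>Each grid point contributes at most 4 / l^4 and there are of order l^3 of them;
    the noise threshold \<open>l^4 * V j\<close> was chosen to outweigh their number.\<close>
  have I1: "(\<integral>\<^sup>+Y. (\<Sum>j\<le>J. ennreal (noise Y j / (l^4 * V j))) \<partial>obs_law \<kappa> n \<mu>)
     \<le> ennreal ((80000 * C\<^sup>2 * (1 + C\<^sup>2)\<^sup>2 * l^3 + 4) / l^4)"
  proof -
    have "(\<integral>\<^sup>+Y. ennreal (noise Y j / (l^4 * V j)) \<partial>obs_law \<kappa> n \<mu>) \<le> ennreal (4 / l^4)" for j
    proof -
      have "(\<integral>\<^sup>+Y. ennreal (noise Y j / (l^4 * V j)) \<partial>obs_law \<kappa> n \<mu>) =
         (\<integral>\<^sup>+Y. ennreal (1 / (l^4 * V j)) * ennreal (noise Y j) \<partial>obs_law \<kappa> n \<mu>)"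
        using Vpos[of j] l by (intro nn_integral_cong) (simp add: noise_def flip: ennreal_mult)
      also have "\<dots> = ennreal (1 / (l^4 * V j)) * (\<integral>\<^sup>+Y. ennreal (noise Y j) \<partial>obs_law \<kappa> n \<mu>)"
        by (intro nn_integral_cmult) measurable
      also have "\<dots> \<le> ennreal (1 / (l^4 * V j)) * ennreal (4 * V j)"
        unfolding noise_def V_def by (intro mult_left_mono noise_bound n1) auto
      also have "\<dots> = ennreal (4 / l^4)"
        using Vpos[of j] l by (simp flip: ennreal_mult)
      finally show ?thesis .
    qed
    then have "(\<Sum>j\<le>J. \<integral>\<^sup>+Y. ennreal (noise Y j / (l^4 * V j)) \<partial>obs_law \<kappa> n \<mu>) \<le> (\<Sum>j\<le>J. ennreal (4 / l^4))"
      by (intro sum_mono)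
    also have "\<dots> = ennreal (\<Sum>j\<le>J. 4 / l^4)" by (subst sum_ennreal) auto
    also have "\<dots> \<le> ennreal ((80000 * C\<^sup>2 * (1 + C\<^sup>2)\<^sup>2 * l^3 + 4) / l^4)"
    proof (rule ennreal_leI)
      have "real J \<le> l / mesh n" unfolding J_def using l mp by simp
      also have "\<dots> = 20000 * C\<^sup>2 * (1 + C\<^sup>2)\<^sup>2 * l^3"
        unfolding mesh_def l_def[symmetric] by (simp add: power2_eq_square[of l] power3_eq_cube)
      finally have "(real J + 1) * 4 / l^4 \<le> (20000 * C\<^sup>2 * (1 + C\<^sup>2)\<^sup>2 * l^3 + 1) * 4 / l^4"
        using l by (intro divide_right_mono mult_right_mono) auto
      then show "(\<Sum>j\<le>J. 4 / l^4) \<le> (80000 * C\<^sup>2 * (1 + C\<^sup>2)\<^sup>2 * l^3 + 4) / l^4"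
        by (simp add: algebra_simps)
    qed
    finally show ?thesis by (subst nn_integral_sum) auto
  qed
  have I2: "(\<integral>\<^sup>+Y. ennreal (9 * real n^4) * Q Y \<partial>obs_law \<kappa> n \<mu>) \<le> ennreal (28800 * C^8 / real n)"
  proof -
    define S' where "S' = real n * C\<^sup>2 * R\<^sup>2"
    have sumS: "(\<Sum>i\<in>I. sig n \<mu> i) \<le> S'" if "finite I" for I
    proof -
      have "sig n \<mu> i \<le> real n * C\<^sup>2 * (real (Suc i) powr (2*\<beta>) * (\<mu> i)\<^sup>2)" for i
      proof -
        have "1 \<le> real (Suc i) powr (2*\<beta>)" using \<beta> by (intro ge_one_powr_ge_zero) auto
        then have m: "1 * (\<mu> i)\<^sup>2 \<le> real (Suc i) powr (2*\<beta>) * (\<mu> i)\<^sup>2" by (intro mult_right_mono) auto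
        have "(\<kappa> i)\<^sup>2 * (\<mu> i)\<^sup>2 \<le> C\<^sup>2 * (real (Suc i) powr (2*\<beta>) * (\<mu> i)\<^sup>2)"
          using kappa_sq_le_const m by (intro mult_mono) auto
        then show ?thesis by (simp add: sig_def power_mult_distrib mult.assoc mult_left_mono)
      qed
      then have "(\<Sum>i\<in>I. sig n \<mu> i) \<le> (\<Sum>i\<in>I. real n * C\<^sup>2 * (real (Suc i) powr (2*\<beta>) * (\<mu> i)\<^sup>2))"
        by (intro sum_mono)
      also have "\<dots> = real n * C\<^sup>2 * (\<Sum>i\<in>I. real (Suc i) powr (2*\<beta>) * (\<mu> i)\<^sup>2)"
        by (simp add: sum_distrib_left)
      also have "\<dots> \<le> real n * C\<^sup>2 * R\<^sup>2"
        using sum_le_suminf[OF S(1) that] S(2) by (intro mult_left_mono) auto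
      finally show ?thesis by (simp add: S'_def)
    qed
    have "(\<integral>\<^sup>+Y. ennreal (9 * real n^4) * Q Y \<partial>obs_law \<kappa> n \<mu>) = ennreal (9 * real n^4) * (\<integral>\<^sup>+Y. Q Y \<partial>obs_law \<kappa> n \<mu>)"
      by (intro nn_integral_cmult) measurable
    also have "\<dots> \<le> ennreal (9 * real n^4) * ennreal (800 * C^4 * (1 + S')\<^sup>2 / real k0)"
      unfolding Q_def by (intro mult_left_mono block_series_expectation n1 k0 sumS) auto
    also have "\<dots> = ennreal (9 * real n^4 * (800 * C^4 * (1 + S')\<^sup>2 / real k0))"
      using C by (subst ennreal_mult) auto
    also have "\<dots> \<le> ennreal (28800 * C^8 / real n)"
    proof (rule ennreal_leI)
      have "1 \<le> real n * C\<^sup>2" using mult_mono[of 1 "real n" 1 "C\<^sup>2"] n C by simp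
      then have S1: "1 \<le> S'" unfolding S'_def using mult_mono[of 1 "real n * C\<^sup>2" 1 "R\<^sup>2"] R2 by simp
      then have "(1 + S')\<^sup>2 \<le> (2 * S')\<^sup>2" by (intro power_mono) auto
      also have "\<dots> = 4 * (real n)\<^sup>2 * C^4 * R^4" by (simp add: S'_def power_mult_distrib flip: power_mult)
      also have "\<dots> \<le> 4 * (real n)\<^sup>2 * C^4 * real n" using R C by (intro mult_left_mono) auto
      finally have "(1 + S')\<^sup>2 \<le> 4 * (real n)\<^sup>2 * C^4 * real n" .
      then have "9 * real n^4 * (800 * C^4 * (1 + S')\<^sup>2 / real k0) \<le>
         9 * real n^4 * (800 * C^4 * (4 * (real n)\<^sup>2 * C^4 * real n) / real k0)"
        using C by (intro mult_left_mono divide_right_mono) auto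
      also have "\<dots> = 28800 * C^8 / real n"
        using n by (simp add: k0_def field_simps eval_nat_numeral)
      finally show "9 * real n^4 * (800 * C^4 * (1 + S')\<^sup>2 / real k0) \<le> 28800 * C^8 / real n" .
    qed
    finally show ?thesis .
  qed
  have I3: "(\<integral>\<^sup>+Y. ennreal (1 / r\<^sup>2) * (ennreal b + W Y) \<partial>obs_law \<kappa> n \<mu>) \<le> ennreal (1 / r\<^sup>2 * (b + v))"
  proof -
    have "(\<integral>\<^sup>+Y. ennreal (1 / r\<^sup>2) * (ennreal b + W Y) \<partial>obs_law \<kappa> n \<mu>) =
       ennreal (1 / r\<^sup>2) * (ennreal b + (\<integral>\<^sup>+Y. W Y \<partial>obs_law \<kappa> n \<mu>))"
      by (subst nn_integral_cmult, measurable) (subst nn_integral_add, auto simp: O.emeasure_space_1)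
    also have "\<dots> \<le> ennreal (1 / r\<^sup>2) * (ennreal b + ennreal v)"
      unfolding W_def v_def eff\<alpha>s[symmetric]
      by (intro mult_left_mono add_left_mono posterior_noise_expectation n1 \<alpha>s0) auto
    also have "\<dots> = ennreal (1 / r\<^sup>2 * (b + v))" using b v by (subst ennreal_mult) auto
    finally show ?thesis .
  qed
  have "(\<integral>\<^sup>+Y. ennreal (f Y) \<partial>obs_law \<kappa> n \<mu>) \<le>
     (\<integral>\<^sup>+Y. (\<Sum>j\<le>J. ennreal (noise Y j / (l^4 * V j))) + ennreal (9 * real n^4) * Q Y
     + ennreal (1 / r\<^sup>2) * (ennreal b + W Y) \<partial>obs_law \<kappa> n \<mu>)"
    by (intro nn_integral_mono pointwise)
  also have "\<dots> = (\<integral>\<^sup>+Y. (\<Sum>j\<le>J. ennreal (noise Y j / (l^4 * V j))) \<partial>obs_law \<kappa> n \<mu>)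
     + (\<integral>\<^sup>+Y. ennreal (9 * real n^4) * Q Y \<partial>obs_law \<kappa> n \<mu>)
     + (\<integral>\<^sup>+Y. ennreal (1 / r\<^sup>2) * (ennreal b + W Y) \<partial>obs_law \<kappa> n \<mu>)"
  proof -
    have m: "(\<lambda>Y. \<Sum>j\<le>J. ennreal (noise Y j / (l^4 * V j))) \<in> borel_measurable (obs_law \<kappa> n \<mu>)"
      "(\<lambda>Y. ennreal (9 * real n^4) * Q Y) \<in> borel_measurable (obs_law \<kappa> n \<mu>)"
      "(\<lambda>Y. ennreal (1 / r\<^sup>2) * (ennreal b + W Y)) \<in> borel_measurable (obs_law \<kappa> n \<mu>)"
      by measurable
    show ?thesis
      using nn_integral_add[OF m(1,2)] nn_integral_add[OF borel_measurable_add[OF m(1,2)] m(3)] by (simp only:)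
  qed
  also have "\<dots> \<le> ennreal ((80000 * C\<^sup>2 * (1 + C\<^sup>2)\<^sup>2 * l^3 + 4) / l^4) + ennreal (28800 * C^8 / real n)
     + ennreal (1 / r\<^sup>2 * (b + v))"
    by (intro add_mono I1 I2 I3)
  also have "\<dots> = ennreal ((80000 * C\<^sup>2 * (1 + C\<^sup>2)\<^sup>2 * l^3 + 4) / l^4 + 28800 * C^8 / real n + 1 / r\<^sup>2 * (b + v))"
    using l C b v by (simp add: ennreal_plus[symmetric] del: ennreal_plus)
  finally have "eb_risk \<kappa> ah n \<mu> r \<le> (80000 * C\<^sup>2 * (1 + C\<^sup>2)\<^sup>2 * l^3 + 4) / l^4 + 28800 * C^8 / real n + 1 / r\<^sup>2 * (b + v)"
    unfolding eb_risk_def f_def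
    using l C b v by (intro integral_le_nn_integral) auto
  also have "1 / r\<^sup>2 * (b + v) \<le> 1 / r\<^sup>2 * (N powr (-2*\<beta>) * (560 * C^6 * l^4 * R\<^sup>2 + 4 * (dim_const * l^4 * R\<^sup>2) powr (1 + 2*p) * (C\<^sup>2 + 1 + 1 / \<beta>)))"
    using b v by (intro mult_left_mono) (auto simp: distrib_left)
  finally show ?thesis by (simp add: N_def mult.assoc)
qed

lemma eff_powr_rate: "eff n \<beta> powr (-2*\<beta>) = real n powr (-2*\<beta> / (1 + 2*\<beta> + 2*p))"
  by (simp add: eff_def powr_powr)

lemma eb_risk_nonneg: "0 \<le> eb_risk \<kappa> ah n \<mu> r"
  unfolding eb_risk_def by (intro Bochner_Integration.integral_nonneg) auto

text \<open>Common form of both claims. The radius \<open>exp (sqrt (ln n))\<close> eventually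
  exceeds every fixed one and accommodates the growing one of the analytic case. The hypothesis on
  \<open>r\<close> grants a loss \<open>exp ((1/2 + p) * ln n powr (3/4))\<close> against the
  squared Sobolev rate, and \<open>small\<close> is the condition of \<open>risk_bound\<close>
  cleared of denominators.\<close>

lemma sup_risk_tendsto_0:
  fixes b r :: "nat \<Rightarrow> real" and B :: real and A :: "(nat \<Rightarrow> real) set"
  assumes eb: "eb_selector \<kappa> ah" and A: "A \<noteq> {}"
    and b: "\<forall>\<^sub>F n in sequentially. 0 < b n \<and> b n \<le> ln (real n) \<and> 1 / b n \<le> B"
    and small: "\<forall>\<^sub>F n in sequentially. (1 + b n + 2*p) * (1 + 2 * b n + 2*p) *
      (ln dim_const + 4 * ln (ln (real n)) + 2 * sqrt (ln (real n))) \<le> b n * ln (real n)"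
    and r: "\<forall>\<^sub>F n in sequentially. 0 < r n \<and> 1 / (r n)\<^sup>2 * real n powr (-2 * b n / (1 + 2 * b n + 2*p))
      \<le> exp (-2 * ln (real n) powr (7/8) + (1/2 + p) * ln (real n) powr (3/4))"
    and S: "\<forall>\<^sub>F n in sequentially. \<forall>\<mu>\<in>A. summable (\<lambda>i. real (Suc i) powr (2 * b n) * (\<mu> i)\<^sup>2)
      \<and> (\<Sum>i. real (Suc i) powr (2 * b n) * (\<mu> i)\<^sup>2) \<le> (exp (sqrt (ln (real n))))\<^sup>2"
  shows "(\<lambda>n. SUP \<mu>\<in>A. eb_risk \<kappa> ah n \<mu> (r n)) \<longlonglongrightarrow> 0"
proof -
  define d where "d = dim_const"
  have d: "0 < d" using dim_const_ge_1 by (simp add: d_def)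
  define e where "e n = (80000 * C\<^sup>2 * (1 + C\<^sup>2)\<^sup>2 * (ln (real n))^3 + 4) / (ln (real n))^4 + 28800 * C^8 / real n
    + exp (-2 * ln (real n) powr (7/8) + (1/2 + p) * ln (real n) powr (3/4)) *
      (560 * C^6 * (ln (real n))^4 * (exp (sqrt (ln (real n))))\<^sup>2
       + 4 * (d * (ln (real n))^4 * (exp (sqrt (ln (real n))))\<^sup>2) powr (1 + 2*p) * (C\<^sup>2 + 1 + B))" for n :: nat
  \<comment> \<open>The exponent 7/8 exceeds both 3/4 and 1/2, so the negative term wins against the
    granted loss, the powers of the radius and the powers of \<open>ln n\<close>.\<close>
  have "e \<longlonglongrightarrow> 0"
    unfolding e_def using d p by real_asymp
  moreover have R4: "\<forall>\<^sub>F n in sequentially. (exp (sqrt (ln (real n))))^4 \<le> real n" by real_asymp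
  have "\<forall>\<^sub>F n in sequentially. \<forall>\<mu>\<in>A. eb_risk \<kappa> ah n \<mu> (r n) \<le> e n"
    using b small r S R4 eventually_ge_at_top[of 3]
  proof eventually_elim
    case (elim n)
    define l where "l = ln (real n)"
    define R where "R = exp (sqrt l)"
    have "exp 1 \<le> real n" using elim exp_le by linarith
    then have l: "1 \<le> l" using elim by (simp add: l_def ln_ge_iff)
    define q where "q = 1 + 2 * b n + 2*p"
    have q: "0 < q" using elim p by (simp add: q_def)
    have R: "1 \<le> R" "ln R = sqrt l" using l by (auto simp: R_def)
    have "ln (dim_const * l^4 * R\<^sup>2 * eff n (b n)) = ln dim_const + 4 * ln l + 2 * sqrt l + l / q"
      using l d elim by (simp add: ln_mult ln_realpow R_def eff_def ln_powr l_def[symmetric] d_def q_def)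
    moreover have "(1 + b n + 2*p) * (ln dim_const + 4 * ln l + 2 * sqrt l + l / q) \<le> l"
    proof -
      have "(1 + b n + 2*p) * (ln dim_const + 4 * ln l + 2 * sqrt l) * q \<le> b n * l"
        using elim by (simp add: q_def l_def mult_ac)
      then have "(1 + b n + 2*p) * (ln dim_const + 4 * ln l + 2 * sqrt l) \<le> b n * l / q"
        using q by (simp add: pos_le_divide_eq)
      moreover have "(1 + b n + 2*p) * (l / q) = l - b n * l / q"
        using q by (simp add: q_def field_simps)
      ultimately show ?thesis by (simp add: distrib_left)
    qed
    ultimately have sm: "(1 + b n + 2*p) * ln (dim_const * l^4 * R\<^sup>2 * eff n (b n)) \<le> l" by simp
    show ?case
    proof
      fix \<mu> assume \<mu>: "\<mu> \<in> A"
      have "eb_risk \<kappa> ah n \<mu> (r n) \<le> (80000 * C\<^sup>2 * (1 + C\<^sup>2)\<^sup>2 * l^3 + 4) / l^4 + 28800 * C^8 / real n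
        + 1 / (r n)\<^sup>2 * eff n (b n) powr (-2 * b n) *
          (560 * C^6 * l^4 * R\<^sup>2 + 4 * (dim_const * l^4 * R\<^sup>2) powr (1 + 2*p) * (C\<^sup>2 + 1 + 1 / b n))"
        unfolding l_def
        by (rule risk_bound[OF eb]) (use elim l R sm \<mu> in \<open>auto simp: l_def R_def\<close>)
      also have "\<dots> \<le> e n"
        unfolding e_def l_def[symmetric] R_def[symmetric] d_def eff_powr_rate
        using elim C l R by (intro add_mono mult_mono order_refl) (auto simp: l_def intro!: add_nonneg_nonneg mult_nonneg_nonneg)
      finally show "eb_risk \<kappa> ah n \<mu> (r n) \<le> e n" .
    qed
  qed
  ultimately show ?thesis
    using A eb_risk_nonneg by (intro SUP_tendsto_0[where e = e]) auto
qed

end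

section \<open>Sobolev and analytic balls\<close>

lemma sobolev_ballD:
  assumes "sobolev_norm \<beta> \<mu> \<le> ennreal R" "0 \<le> R"
  shows "summable (\<lambda>i. real (Suc i) powr (2*\<beta>) * (\<mu> i)\<^sup>2)" "(\<Sum>i. real (Suc i) powr (2*\<beta>) * (\<mu> i)\<^sup>2) \<le> R\<^sup>2"
proof -
  show s: "summable (\<lambda>i. real (Suc i) powr (2*\<beta>) * (\<mu> i)\<^sup>2)"
    using assms by (auto simp: sobolev_norm_def top_unique split: if_splits)
  then have "sqrt (\<Sum>i. real (Suc i) powr (2*\<beta>) * (\<mu> i)\<^sup>2) \<le> R"
    using assms by (simp add: sobolev_norm_def)
  then show "(\<Sum>i. real (Suc i) powr (2*\<beta>) * (\<mu> i)\<^sup>2) \<le> R\<^sup>2"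
    by (rule sqrt_le_D)
qed

lemma analytic_ballD:
  assumes "analytic_norm \<gamma> \<mu> \<le> ennreal R" "0 \<le> R"
  shows "summable (\<lambda>i. exp (2*\<gamma>*real (Suc i)) * (\<mu> i)\<^sup>2)" "(\<Sum>i. exp (2*\<gamma>*real (Suc i)) * (\<mu> i)\<^sup>2) \<le> R\<^sup>2"
proof -
  show s: "summable (\<lambda>i. exp (2*\<gamma>*real (Suc i)) * (\<mu> i)\<^sup>2)"
    using assms by (auto simp: analytic_norm_def top_unique split: if_splits)
  then have "sqrt (\<Sum>i. exp (2*\<gamma>*real (Suc i)) * (\<mu> i)\<^sup>2) \<le> R"
    using assms by (simp add: analytic_norm_def)
  then show "(\<Sum>i. exp (2*\<gamma>*real (Suc i)) * (\<mu> i)\<^sup>2) \<le> R\<^sup>2"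
    by (rule sqrt_le_D)
qed

text \<open>Writing x = (\<beta>/\<gamma>) (\<gamma> x/\<beta>) and using t \<le> exp t for t =
  \<gamma> x/\<beta> yields x^(2\<beta>) \<le> (\<beta>/\<gamma>)^(2\<beta>) exp(2 \<gamma> x). The
  radius is explicit in \<beta> because \<beta> will grow with \<open>n\<close>.\<close>

lemma analytic_ball_subset_sobolev_ball:
  assumes S: "summable (\<lambda>i. exp (2*\<gamma>*real (Suc i)) * (\<mu> i)\<^sup>2)" "(\<Sum>i. exp (2*\<gamma>*real (Suc i)) * (\<mu> i)\<^sup>2) \<le> R\<^sup>2"
    and \<gamma>: "0 < \<gamma>" and \<beta>: "0 < \<beta>"
  shows "summable (\<lambda>i. real (Suc i) powr (2*\<beta>) * (\<mu> i)\<^sup>2)"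
    "(\<Sum>i. real (Suc i) powr (2*\<beta>) * (\<mu> i)\<^sup>2) \<le> (R * (\<beta> / \<gamma>) powr \<beta>)\<^sup>2"
proof -
  let ?c = "(\<beta> / \<gamma>) powr (2*\<beta>)"
  have le: "real (Suc i) powr (2*\<beta>) * (\<mu> i)\<^sup>2 \<le> ?c * (exp (2*\<gamma>*real (Suc i)) * (\<mu> i)\<^sup>2)" for i
  proof -
    let ?x = "real (Suc i)"
    have "?x powr (2*\<beta>) = ((\<beta> / \<gamma>) * (\<gamma> * ?x / \<beta>)) powr (2*\<beta>)" using \<gamma> \<beta> by simp
    also have "\<dots> = ?c * (\<gamma> * ?x / \<beta>) powr (2*\<beta>)" by (rule powr_mult)
    also have "\<dots> \<le> ?c * exp (\<gamma> * ?x / \<beta>) powr (2*\<beta>)"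
    proof (intro mult_left_mono powr_mono2)
      show "\<gamma> * ?x / \<beta> \<le> exp (\<gamma> * ?x / \<beta>)"
        using exp_ge_add_one_self[of "\<gamma> * ?x / \<beta>"] by linarith
    qed (use \<gamma> \<beta> in auto)
    also have "exp (\<gamma> * ?x / \<beta>) powr (2*\<beta>) = exp (2*\<gamma>*?x)"
      using \<beta> by (simp add: powr_def)
    finally have "?x powr (2*\<beta>) * (\<mu> i)\<^sup>2 \<le> ?c * exp (2*\<gamma>*?x) * (\<mu> i)\<^sup>2"
      by (intro mult_right_mono) auto
    then show ?thesis by (simp add: mult.assoc)
  qed
  have s: "summable (\<lambda>i. ?c * (exp (2*\<gamma>*real (Suc i)) * (\<mu> i)\<^sup>2))" using S(1) by (rule summable_mult)
  show s': "summable (\<lambda>i. real (Suc i) powr (2*\<beta>) * (\<mu> i)\<^sup>2)"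
    by (rule summable_comparison_test'[OF s, of 0]) (use le in \<open>simp del: of_nat_Suc\<close>)
  have "(\<Sum>i. real (Suc i) powr (2*\<beta>) * (\<mu> i)\<^sup>2) \<le> (\<Sum>i. ?c * (exp (2*\<gamma>*real (Suc i)) * (\<mu> i)\<^sup>2))"
    by (intro suminf_le le s s')
  also have "\<dots> = ?c * (\<Sum>i. exp (2*\<gamma>*real (Suc i)) * (\<mu> i)\<^sup>2)" using S(1) by (rule suminf_mult)
  also have "\<dots> \<le> ?c * R\<^sup>2" using S(2) by (intro mult_left_mono) auto
  also have "\<dots> = (R * (\<beta> / \<gamma>) powr \<beta>)\<^sup>2"
    by (simp add: power_mult_distrib power2_eq_square[of "_ powr _"] flip: powr_add)
  finally show "(\<Sum>i. real (Suc i) powr (2*\<beta>) * (\<mu> i)\<^sup>2) \<le> (R * (\<beta> / \<gamma>) powr \<beta>)\<^sup>2" .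
qed

text \<open>The analytic case is the Sobolev case with the smoothness \<open>(ln n) powr (1/4)\<close> and the radius
  \<open>exp (sqrt (ln n))\<close>, both growing with \<open>n\<close>; the losses are absorbed by \<open>L\<close>.\<close>

theorem theorem2p2:
  fixes \<kappa> :: "nat \<Rightarrow> real" and p C :: real
  assumes "p \<ge> 0" and "C \<ge> 1"
    and "\<And>i. inverse C * real (Suc i) powr (-p) \<le> \<kappa> i \<and> \<kappa> i \<le> C * real (Suc i) powr (-p)"
  shows "\<exists>L. slowly_varying L \<and>
    (\<forall>ah. eb_selector \<kappa> ah \<longrightarrow>
      (\<forall>\<beta> \<gamma> R (M :: nat \<Rightarrow> real). \<beta> > 0 \<longrightarrow> \<gamma> > 0 \<longrightarrow> R > 0 \<longrightarrow> filterlim M at_top sequentially \<longrightarrow>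
        (\<lambda>n. SUP \<mu>0\<in>{\<mu>0. sobolev_norm \<beta> \<mu>0 \<le> ennreal R}.
            eb_risk \<kappa> ah n \<mu>0 (M n * L n * real n powr (-\<beta> / (1 + 2*\<beta> + 2*p)))) \<longlonglongrightarrow> 0
        \<and>
        (\<lambda>n. SUP \<mu>0\<in>{\<mu>0. analytic_norm \<gamma> \<mu>0 \<le> ennreal R}.
            eb_risk \<kappa> ah n \<mu>0 (M n * L n * ln (real n) powr (1/2 + p) * real n powr (-1/2))) \<longlonglongrightarrow> 0))"
proof -
  interpret mildly_ill_posed \<kappa> p C using assms by unfold_locales
  \<comment> \<open>The exponent must lie below 1 for slow variation and above 3/4 to outweigh the
    loss in the analytic case.\<close>
  define L where "L n = exp (ln (real n) powr (7/8))" for n :: nat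
  have L2: "1 / (L n)\<^sup>2 = exp (-2 * ln (real n) powr (7/8))" for n
    by (simp add: L_def exp_minus exp_double field_simps)
  have Lpos: "0 < L n" for n by (simp add: L_def)
  have "slowly_varying L"
    unfolding slowly_varying_def
  proof (intro conjI allI impI)
    fix \<epsilon> :: real assume "0 < \<epsilon>"
    then show "(\<lambda>n. L n / real n powr \<epsilon>) \<longlonglongrightarrow> 0" unfolding L_def by real_asymp
  qed (rule Lpos)
  moreover have "(\<lambda>n. SUP \<mu>0\<in>{\<mu>0. sobolev_norm \<beta> \<mu>0 \<le> ennreal R}.
        eb_risk \<kappa> ah n \<mu>0 (M n * L n * real n powr (-\<beta> / (1 + 2*\<beta> + 2*p)))) \<longlonglongrightarrow> 0"
    if eb: "eb_selector \<kappa> ah" and \<beta>: "\<beta> > 0" and R: "R > 0" and M: "filterlim M at_top sequentially"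
    for ah \<beta> R M
  proof (rule sup_risk_tendsto_0[OF eb, where b = "\<lambda>_. \<beta>" and B = "1 / \<beta>"])
    have "(\<lambda>_. 0) \<in> {\<mu>0. sobolev_norm \<beta> \<mu>0 \<le> ennreal R}" by (simp add: sobolev_norm_def)
    then show "{\<mu>0. sobolev_norm \<beta> \<mu>0 \<le> ennreal R} \<noteq> {}" by blast
    have "\<forall>\<^sub>F n in sequentially. \<beta> \<le> ln (real n)" by real_asymp
    then show "\<forall>\<^sub>F n in sequentially. 0 < \<beta> \<and> \<beta> \<le> ln (real n) \<and> 1 / \<beta> \<le> 1 / \<beta>"
      by eventually_elim (use \<beta> in simp)
    define c where "c = (1 + \<beta> + 2*p) * (1 + 2*\<beta> + 2*p)"
    have "(\<lambda>n. c * (ln dim_const + 4 * ln (ln (real n)) + 2 * sqrt (ln (real n))) / ln (real n)) \<longlonglongrightarrow> 0"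
      by real_asymp
    then have "\<forall>\<^sub>F n in sequentially. c * (ln dim_const + 4 * ln (ln (real n)) + 2 * sqrt (ln (real n))) / ln (real n) < \<beta>"
      using \<beta> by (rule order_tendstoD)
    then show "\<forall>\<^sub>F n in sequentially. (1 + \<beta> + 2*p) * (1 + 2*\<beta> + 2*p) *
       (ln dim_const + 4 * ln (ln (real n)) + 2 * sqrt (ln (real n))) \<le> \<beta> * ln (real n)"
      using eventually_ge_at_top[of 2]
    proof eventually_elim
      case (elim n)
      then have "0 < ln (real n)" by simp
      then show ?case using elim unfolding c_def by (simp add: pos_divide_less_eq)
    qed
    have "\<forall>\<^sub>F n in sequentially. 1 \<le> M n" using M by (simp add: filterlim_at_top)
    then show "\<forall>\<^sub>F n in sequentially. 0 < M n * L n * real n powr (-\<beta> / (1 + 2*\<beta> + 2*p)) \<and>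
       1 / (M n * L n * real n powr (-\<beta> / (1 + 2*\<beta> + 2*p)))\<^sup>2 * real n powr (-2*\<beta> / (1 + 2*\<beta> + 2*p))
       \<le> exp (-2 * ln (real n) powr (7/8) + (1/2 + p) * ln (real n) powr (3/4))"
      using eventually_ge_at_top[of 1]
    proof eventually_elim
      case (elim n)
      let ?z = "real n powr (-\<beta> / (1 + 2*\<beta> + 2*p))"
      have z: "0 < ?z" using elim by simp
      have z2: "real n powr (-2*\<beta> / (1 + 2*\<beta> + 2*p)) = ?z\<^sup>2"
        by (simp add: power2_eq_square flip: powr_add)
      have "1 / (M n * L n * ?z)\<^sup>2 * ?z\<^sup>2 = 1 / (M n)\<^sup>2 * (1 / (L n)\<^sup>2)"
        using z by (simp add: power_mult_distrib)
      also have "\<dots> \<le> 1 * (1 / (L n)\<^sup>2)"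
        using elim by (intro mult_right_mono) auto
      also have "\<dots> \<le> exp (-2 * ln (real n) powr (7/8) + (1/2 + p) * ln (real n) powr (3/4))"
        unfolding L2 using assms(1) by simp
      finally show ?case unfolding z2 using z Lpos[of n] elim by simp
    qed
    have "\<forall>\<^sub>F n in sequentially. R \<le> exp (sqrt (ln (real n)))" by real_asymp
    then show "\<forall>\<^sub>F n in sequentially. \<forall>\<mu>\<in>{\<mu>0. sobolev_norm \<beta> \<mu>0 \<le> ennreal R}.
       summable (\<lambda>i. real (Suc i) powr (2*\<beta>) * (\<mu> i)\<^sup>2) \<and>
       (\<Sum>i. real (Suc i) powr (2*\<beta>) * (\<mu> i)\<^sup>2) \<le> (exp (sqrt (ln (real n))))\<^sup>2"
    proof eventually_elim
      case (elim n)
      have "R\<^sup>2 \<le> (exp (sqrt (ln (real n))))\<^sup>2" using elim R by (intro power_mono) auto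
      moreover have "summable (\<lambda>i. real (Suc i) powr (2*\<beta>) * (\<mu> i)\<^sup>2)"
        "(\<Sum>i. real (Suc i) powr (2*\<beta>) * (\<mu> i)\<^sup>2) \<le> R\<^sup>2" if "sobolev_norm \<beta> \<mu> \<le> ennreal R" for \<mu>
        using sobolev_ballD[OF that] R by auto
      ultimately show ?case by fastforce
    qed
  qed
  moreover have "(\<lambda>n. SUP \<mu>0\<in>{\<mu>0. analytic_norm \<gamma> \<mu>0 \<le> ennreal R}.
        eb_risk \<kappa> ah n \<mu>0 (M n * L n * ln (real n) powr (1/2 + p) * real n powr (-1/2))) \<longlonglongrightarrow> 0"
    if eb: "eb_selector \<kappa> ah" and \<gamma>: "\<gamma> > 0" and R: "R > 0" and M: "filterlim M at_top sequentially"
    for ah \<gamma> R M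
  \<comment> \<open>The smoothness must grow for the rate to approach n^(-1/2), but slowly: the
    condition \<open>small\<close> needs b^2 sqrt(ln n) to be negligible against b ln n, and the
    radius (b/\<gamma>)^b must stay below exp(sqrt(ln n)).\<close>
  proof (rule sup_risk_tendsto_0[OF eb, where b = "\<lambda>n. ln (real n) powr (1/4)" and B = 1])
    have "(\<lambda>_. 0) \<in> {\<mu>0. analytic_norm \<gamma> \<mu>0 \<le> ennreal R}" by (simp add: analytic_norm_def)
    then show "{\<mu>0. analytic_norm \<gamma> \<mu>0 \<le> ennreal R} \<noteq> {}" by blast
    have b: "\<forall>\<^sub>F n in sequentially. 1 \<le> ln (real n)" by real_asymp
    then show "\<forall>\<^sub>F n in sequentially. 0 < ln (real n) powr (1/4) \<and> ln (real n) powr (1/4) \<le> ln (real n) \<and> 1 / ln (real n) powr (1/4) \<le> 1"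
    proof eventually_elim
      case (elim n)
      have "1 \<le> ln (real n) powr (1/4)" using elim by (intro ge_one_powr_ge_zero) auto
      moreover have "ln (real n) powr (1/4) \<le> ln (real n) powr 1" using elim by (intro powr_mono) auto
      ultimately show ?case using elim by (simp add: divide_le_eq_1)
    qed
    show "\<forall>\<^sub>F n in sequentially. (1 + ln (real n) powr (1/4) + 2*p) * (1 + 2 * ln (real n) powr (1/4) + 2*p) *
       (ln dim_const + 4 * ln (ln (real n)) + 2 * sqrt (ln (real n))) \<le> ln (real n) powr (1/4) * ln (real n)"
      by real_asymp
    have "\<forall>\<^sub>F n in sequentially. 1 \<le> M n" using M by (simp add: filterlim_at_top)
    then show "\<forall>\<^sub>F n in sequentially. 0 < M n * L n * ln (real n) powr (1/2 + p) * real n powr (-1/2) \<and>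
       1 / (M n * L n * ln (real n) powr (1/2 + p) * real n powr (-1/2))\<^sup>2 *
         real n powr (-2 * ln (real n) powr (1/4) / (1 + 2 * ln (real n) powr (1/4) + 2*p))
       \<le> exp (-2 * ln (real n) powr (7/8) + (1/2 + p) * ln (real n) powr (3/4))"
      using eventually_ge_at_top[of 3] b
    proof eventually_elim
      case (elim n)
      define l where "l = ln (real n)"
      define z where "z = l powr (1/4)"
      have l: "1 \<le> l" using elim by (simp add: l_def)
      have z: "1 \<le> z" unfolding z_def using l by (intro ge_one_powr_ge_zero) auto
      have nexp: "real n powr y = exp (y * l)" for y using elim by (simp add: powr_def l_def)
      have lz: "l / z = l powr (3/4)"
        unfolding z_def using l powr_diff[of l 1 "1/4"] by simp
      have "real n powr (-1/2) * real n powr (-1/2) = 1 / real n"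
        using elim by (simp add: powr_minus_divide flip: powr_add)
      then have n2: "(real n powr (-1/2))\<^sup>2 = 1 / real n" by (simp add: power2_eq_square)
      have l2: "1 \<le> (l powr (1/2 + p))\<^sup>2"
        using l assms(1) by (intro one_le_power ge_one_powr_ge_zero) auto
      have M2: "1 \<le> (M n)\<^sup>2" using elim by (intro one_le_power)
      have Ml: "1 \<le> (M n)\<^sup>2 * (l powr (1/2 + p))\<^sup>2" using mult_mono[OF M2 l2] by simp
      \<comment> \<open>The squared Sobolev rate relative to 1/n. Its exponent is at most (1/2 + p)
        l / z, and l / z = l^(3/4).\<close>
      have "real n * real n powr (-2 * z / (1 + 2*z + 2*p)) = exp ((1 + 2*p) / (1 + 2*z + 2*p) * l)"
      proof -
        have "1 + -2 * z / (1 + 2*z + 2*p) = (1 + 2*p) / (1 + 2*z + 2*p)"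
          using z assms(1) by (simp add: field_simps)
        moreover have "real n * real n powr (-2 * z / (1 + 2*z + 2*p)) = real n powr (1 + -2 * z / (1 + 2*z + 2*p))"
          by (subst powr_mult_base) auto
        ultimately show ?thesis by (simp only: nexp)
      qed
      also have "\<dots> \<le> exp ((1/2 + p) * l powr (3/4))"
      proof -
        have "(1 + 2*p) / (1 + 2*z + 2*p) \<le> (1 + 2*p) / (2*z)"
          using z assms(1) by (intro divide_left_mono mult_pos_pos) auto
        then have "(1 + 2*p) / (1 + 2*z + 2*p) * l \<le> (1 + 2*p) / (2*z) * l"
          using l by (intro mult_right_mono) auto
        also have "\<dots> = (1/2 + p) * (l / z)" using z by (simp add: field_simps)
        finally show ?thesis by (simp add: lz)
      qed
      finally have A: "real n * real n powr (-2 * z / (1 + 2*z + 2*p)) \<le> exp ((1/2 + p) * l powr (3/4))" .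
      have "1 / (M n * L n * l powr (1/2 + p) * real n powr (-1/2))\<^sup>2 * real n powr (-2 * z / (1 + 2*z + 2*p))
        = 1 / ((M n)\<^sup>2 * (l powr (1/2 + p))\<^sup>2) * (1 / (L n)\<^sup>2 * (real n * real n powr (-2 * z / (1 + 2*z + 2*p))))"
        unfolding power_mult_distrib n2 by simp
      also have "\<dots> \<le> 1 * (1 / (L n)\<^sup>2 * exp ((1/2 + p) * l powr (3/4)))"
        using A Ml by (intro mult_mono) auto
      also have "\<dots> = exp (-2 * l powr (7/8) + (1/2 + p) * l powr (3/4))"
        unfolding L2 l_def by (simp flip: exp_add)
      finally show ?case using Lpos[of n] elim l unfolding l_def z_def by simp
    qed
    \<comment> \<open>The left-hand side is exp of order (ln n)^(1/4) ln ln n, far below exp(sqrt(ln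
      n)).\<close>
    have "\<forall>\<^sub>F n in sequentially. R * (ln (real n) powr (1/4) / \<gamma>) powr (ln (real n) powr (1/4)) \<le> exp (sqrt (ln (real n)))"
      using \<gamma> R by real_asymp
    then show "\<forall>\<^sub>F n in sequentially. \<forall>\<mu>\<in>{\<mu>0. analytic_norm \<gamma> \<mu>0 \<le> ennreal R}.
       summable (\<lambda>i. real (Suc i) powr (2 * ln (real n) powr (1/4)) * (\<mu> i)\<^sup>2) \<and>
       (\<Sum>i. real (Suc i) powr (2 * ln (real n) powr (1/4)) * (\<mu> i)\<^sup>2) \<le> (exp (sqrt (ln (real n))))\<^sup>2"
      using b
    proof eventually_elim
      case (elim n)
      have R2: "(R * (ln (real n) powr (1/4) / \<gamma>) powr (ln (real n) powr (1/4)))\<^sup>2 \<le> (exp (sqrt (ln (real n))))\<^sup>2"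
        using elim R by (intro power_mono) auto
      have "0 < ln (real n) powr (1/4)" using elim by auto
      note * = analytic_ball_subset_sobolev_ball[OF analytic_ballD(1)[OF _ less_imp_le[OF R]]
          analytic_ballD(2)[OF _ less_imp_le[OF R]] \<gamma> this]
      show ?case
      proof (intro ballI conjI)
        fix \<mu> assume "\<mu> \<in> {\<mu>0. analytic_norm \<gamma> \<mu>0 \<le> ennreal R}"
        then have \<mu>: "analytic_norm \<gamma> \<mu> \<le> ennreal R" by simp
        show "summable (\<lambda>i. real (Suc i) powr (2 * ln (real n) powr (1/4)) * (\<mu> i)\<^sup>2)"
          by (rule *(1)[OF \<mu> \<mu>])
        show "(\<Sum>i. real (Suc i) powr (2 * ln (real n) powr (1/4)) * (\<mu> i)\<^sup>2) \<le> (exp (sqrt (ln (real n))))\<^sup>2"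
          by (rule order_trans[OF *(2)[OF \<mu> \<mu>] R2])
      qed
    qed
  qed
  ultimately show ?thesis by blast
qed

end
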